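(* Let $s\ge1$ and let $\varphi_{\mu_1\nu_1\dots\mu_s\nu_s}$ be a smooth complex spin-$s$ field strength on $dS_4$ satisfying the free field equations (for $s=1$: $\nabla^\mu\varphi_{\mu\nu}=0$ and $\nabla_{[\rho}\varphi_{\mu\nu]}=0$; for $s\ge2$: $\nabla^{\mu_1}\varphi_{\mu_1\nu_1\mu_2\nu_2\dots\mu_s\nu_s}=0$). Then the limits defining the boundary data $\mathcal E_{i_1\dots i_s}$ and $\mathcal B_{i_1\dots i_s}$ on $\mathcal I^\pm$ exist. The solution space is the direct sum of antipodally even and antipodally odd solutions, and: (1) if $\varphi$ is antipodally even, then $\mathcal E\equiv0$ on $\mathcal I^+$ and $\mathcal I^-$ (purely magnetic); (2) if $\varphi$ is antipodally odd, then $\mathcal B\equiv0$ on $\mathcal I^+$ and $\mathcal I^-$ (purely electric). Conversely, a smooth solution with $\mathcal E\equiv0$ on $\mathcal I^-$ is antipodally even, and one with $\mathcal B\equiv0$ on $\mathcal I^-$ is antipodally odd.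
   Context: Let $\mathbb R^{4,1}$ carry the metric $\eta=\mathrm{diag}(-1,1,1,1,1)$, and let $dS_4=\{x: x\cdot x=1\}$ with induced metric $g$ and Levi-Civita connection $\nabla$. Tensor fields on $dS_4$ are represented as ambient tensors tangent to $dS_4$. A rank-$k$ tensor field $w$ is antipodally even/odd if $w_{\mu_1\dots\mu_k}(-x)=\pm(-1)^k w_{\mu_1\dots\mu_k}(x)$ in ambient components, equivalently if its pullback under $x\mapsto-x$ equals $\pm w$. A spin-$s$ field strength is a rank-$2s$ tensor $\varphi_{\mu_1\nu_1\dots\mu_s\nu_s}$ that is antisymmetric within each pair $\mu_k\nu_k$, symmetric under interchange of any two pairs, totally traceless, and vanishes on antisymmetrization over any three indices. Fix an orientation of $\mathbb R^{4,1}$ with Levi-Civita tensor $\epsilon^{\mu\nu\rho\sigma\lambda}$ and set $\epsilon^{\mu\nu\rho\sigma}=\epsilon^{\mu\nu\rho\sigma\lambda}x_\lambda$ on $dS_4$. Use global coordinates $x=(x^0,\sqrt{1+(x^0)^2}\,\omega)$, $\omega\in S^3$, and $z=1/x^0$; $\mathcal I^\pm$ corresponds to $z\to0^\pm$, with points labelled by $\omega$. Let $n^\mu$ be the future-pointing unit normal to the slices $x^0=\mathrm{const}$. Define $E_{\mu_1\dots\mu_s}=n^{\nu_1}\cdots n^{\nu_s}\varphi_{\mu_1\nu_1\dots\mu_s\nu_s}$ and $B_{\mu_1\dots\mu_s}=\tfrac12\epsilon_{\mu_1\nu_1}{}^{\rho\sigma}n^{\nu_1}n^{\nu_2}\cdots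 n^{\nu_s}\varphi_{\rho\sigma\mu_2\nu_2\dots\mu_s\nu_s}$. With components $E_{i_1\dots i_s}$, $B_{i_1\dots i_s}$ taken with respect to the coordinate vector fields of a chart $(\omega^i)$ on $S^3$ (in coordinates $(z,\omega^i)$), the boundary data are $\mathcal E_{i_1\dots i_s}|_{\mathcal I^\pm}(\omega)=(\pm1)^{s+1}\lim_{z\to0^\pm}E_{i_1\dots i_s}/z$ and $\mathcal B_{i_1\dots i_s}|_{\mathcal I^\pm}(\omega)=(\pm1)^{s}\lim_{z\to0^\pm}B_{i_1\dots i_s}/z$. *)

theory Defs
  imports "HOL-Analysis.Analysis"
begin

text \<open>Ambient space R^{4,1}: points are real^5, indices range over the type 5
 (index 0 is the time direction).  A rank-k (covariant) tensor at a point is given by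
 its components, a function on index lists of length k.\<close>

definition eta :: "5 \<Rightarrow> real" where
  "eta \<mu> = (if \<mu> = 0 then -1 else 1)"

definition mink :: "real^5 \<Rightarrow> real^5 \<Rightarrow> real" where
  "mink x y = (\<Sum>\<mu>\<in>UNIV. eta \<mu> * x$\<mu> * y$\<mu>)"

definition dS4 :: "(real^5) set" where
  "dS4 = {x. mink x x = 1}"

definition lower :: "real^5 \<Rightarrow> 5 \<Rightarrow> real" where
  "lower x \<mu> = eta \<mu> * x$\<mu>"

definition lists_len :: "nat \<Rightarrow> 5 list set" where
  "lists_len k = {\<mu>s. length \<mu>s = k}"

fun Ck :: "nat \<Rightarrow> (real^5) set \<Rightarrow> (real^5 \<Rightarrow> complex) \<Rightarrow> bool" where
  "Ck 0 U f = continuous_on U f"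
| "Ck (Suc k) U f = ((\<forall>x\<in>U. f differentiable (at x)) \<and>
      (\<forall>v. Ck k U (\<lambda>x. frechet_derivative f (at x) v)))"

definition smooth_on :: "(real^5) set \<Rightarrow> (real^5 \<Rightarrow> complex) \<Rightarrow> bool" where
  "smooth_on U f = (\<forall>k. Ck k U f)"

definition pd :: "5 \<Rightarrow> (real^5 \<Rightarrow> complex) \<Rightarrow> real^5 \<Rightarrow> complex" where
  "pd \<alpha> f x = frechet_derivative f (at x) (axis \<alpha> 1)"

definition Proj :: "real^5 \<Rightarrow> 5 \<Rightarrow> 5 \<Rightarrow> real" where
  "Proj x \<nu> \<alpha> = (if \<nu> = \<alpha> then 1 else 0) - lower x \<nu> * x$\<alpha>"

definition proj_tensor :: "real^5 \<Rightarrow> (5 list \<Rightarrow> complex) \<Rightarrow> 5 list \<Rightarrow> complex" where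
  "proj_tensor x T \<mu>s = (\<Sum>\<beta>s\<in>lists_len (length \<mu>s).
      of_real (\<Prod>i<length \<mu>s. Proj x (\<mu>s!i) (\<beta>s!i)) * T \<beta>s)"

fun Dtensor :: "(real^5 \<Rightarrow> 5 list \<Rightarrow> complex) \<Rightarrow> real^5 \<Rightarrow> 5 list \<Rightarrow> complex" where
  "Dtensor \<Phi> x [] = 0"
| "Dtensor \<Phi> x (\<alpha> # \<beta>s) = pd \<alpha> (\<lambda>y. \<Phi> y \<beta>s) x"

text \<open>Levi-Civita connection of dS4 applied to a tangent tensor field (Gauss formula):
  nabla_nu T_{mu...} = P P ... d T, where \<Phi> is any smooth ambient extension.
  Components: nabla \<Phi> x (nu # mus).\<close>
definition nabla :: "(real^5 \<Rightarrow> 5 list \<Rightarrow> complex) \<Rightarrow> real^5 \<Rightarrow> 5 list \<Rightarrow> complex" where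
  "nabla \<Phi> x = proj_tensor x (Dtensor \<Phi> x)"

definition swap_pos :: "nat \<Rightarrow> nat \<Rightarrow> 5 list \<Rightarrow> 5 list" where
  "swap_pos i j \<mu>s = \<mu>s[i := \<mu>s!j, j := \<mu>s!i]"

definition alt3 :: "(5 list \<Rightarrow> complex) \<Rightarrow> nat \<Rightarrow> nat \<Rightarrow> nat \<Rightarrow> 5 list \<Rightarrow> complex" where
  "alt3 T i j k \<mu>s = (let a = \<mu>s!i; b = \<mu>s!j; c = \<mu>s!k in
        T (\<mu>s[i:=a, j:=b, k:=c]) - T (\<mu>s[i:=b, j:=a, k:=c]) - T (\<mu>s[i:=a, j:=c, k:=b])
      - T (\<mu>s[i:=c, j:=b, k:=a]) + T (\<mu>s[i:=b, j:=c, k:=a]) + T (\<mu>s[i:=c, j:=a, k:=b]))"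

definition field_strength_at :: "nat \<Rightarrow> real^5 \<Rightarrow> (5 list \<Rightarrow> complex) \<Rightarrow> bool" where
  "field_strength_at s x T \<longleftrightarrow>
     (\<forall>\<mu>s\<in>lists_len (2 * s). \<forall>i<2 * s. (\<Sum>\<alpha>\<in>UNIV. of_real (x$\<alpha>) * T (\<mu>s[i:=\<alpha>])) = 0) \<and>
     (\<forall>\<mu>s\<in>lists_len (2 * s). \<forall>k<s. T (swap_pos (2 * k) (2 * k+1) \<mu>s) = - T \<mu>s) \<and>
     (\<forall>\<mu>s\<in>lists_len (2 * s). \<forall>k<s. \<forall>l<s.
        T (\<mu>s[2 * k := \<mu>s!(2 * l), 2 * k+1 := \<mu>s!(2 * l+1), 2 * l := \<mu>s!(2 * k), 2 * l+1 := \<mu>s!(2 * k+1)])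
        = T \<mu>s) \<and>
     (\<forall>\<mu>s\<in>lists_len (2 * s). \<forall>i<2 * s. \<forall>j<2 * s. i \<noteq> j \<longrightarrow>
        (\<Sum>\<alpha>\<in>UNIV. of_real (eta \<alpha>) * T (\<mu>s[i:=\<alpha>, j:=\<alpha>])) = 0) \<and>
     (\<forall>\<mu>s\<in>lists_len (2 * s). \<forall>i<2 * s. \<forall>j<2 * s. \<forall>k<2 * s. i \<noteq> j \<and> j \<noteq> k \<and> i \<noteq> k \<longrightarrow>
        alt3 T i j k \<mu>s = 0)"

definition field_eqs :: "nat \<Rightarrow> (real^5 \<Rightarrow> 5 list \<Rightarrow> complex) \<Rightarrow> bool" where
  "field_eqs s \<Phi> \<longleftrightarrow>
    (if s = 1 then
       (\<forall>x\<in>dS4. (\<forall>\<nu>. (\<Sum>\<mu>\<in>UNIV. of_real (eta \<mu>) * nabla \<Phi> x [\<mu>, \<mu>, \<nu>]) = 0) \<and>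
                 (\<forall>\<mu>s\<in>lists_len 3. alt3 (nabla \<Phi> x) 0 1 2 \<mu>s = 0))
     else
       (\<forall>x\<in>dS4. \<forall>rest\<in>lists_len (2 * s - 1).
          (\<Sum>\<mu>\<in>UNIV. of_real (eta \<mu>) * nabla \<Phi> x (\<mu> # \<mu> # rest)) = 0))"

definition solution :: "nat \<Rightarrow> (real^5 \<Rightarrow> 5 list \<Rightarrow> complex) \<Rightarrow> bool" where
  "solution s \<phi> \<longleftrightarrow>
     (\<forall>x\<in>dS4. field_strength_at s x (\<phi> x)) \<and>
     (\<exists>U \<Phi>. open U \<and> dS4 \<subseteq> U \<and> (\<forall>\<mu>s\<in>lists_len (2 * s). smooth_on U (\<lambda>y. \<Phi> y \<mu>s)) \<and>
        (\<forall>x\<in>dS4. \<forall>\<mu>s\<in>lists_len (2 * s). \<Phi> x \<mu>s = \<phi> x \<mu>s) \<and> field_eqs s \<Phi>)"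

definition antip_even :: "nat \<Rightarrow> (real^5 \<Rightarrow> 5 list \<Rightarrow> complex) \<Rightarrow> bool" where
  "antip_even k w \<longleftrightarrow> (\<forall>x\<in>dS4. \<forall>\<mu>s\<in>lists_len k. w (-x) \<mu>s = (-1)^k * w x \<mu>s)"

definition antip_odd :: "nat \<Rightarrow> (real^5 \<Rightarrow> 5 list \<Rightarrow> complex) \<Rightarrow> bool" where
  "antip_odd k w \<longleftrightarrow> (\<forall>x\<in>dS4. \<forall>\<mu>s\<in>lists_len k. w (-x) \<mu>s = - ((-1)^k * w x \<mu>s))"

text \<open>Future-pointing unit normal to the slices x^0 = const (contravariant components).\<close>
definition nvec :: "real^5 \<Rightarrow> 5 \<Rightarrow> real" where
  "nvec x \<mu> = ((if \<mu> = 0 then 1 else 0) + x$\<mu> * x$0) / sqrt (1 + (x$0)^2)"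

fun interleave :: "'a list \<Rightarrow> 'a list \<Rightarrow> 'a list" where
  "interleave (a # as) (b # bs) = a # b # interleave as bs"
| "interleave _ _ = []"

text \<open>Levi-Civita symbol with eps^{01234} = 1 (fixes the orientation).\<close>
definition perm_sign :: "5 list \<Rightarrow> real" where
  "perm_sign l = (\<Prod>i<length l. \<Prod>j<length l.
      if i < j then (if l!i < l!j then 1 else if l!i = l!j then 0 else -1) else 1)"

definition levi :: "5 \<Rightarrow> 5 \<Rightarrow> 5 \<Rightarrow> 5 \<Rightarrow> 5 \<Rightarrow> real" where
  "levi a b c d e = perm_sign [a, b, c, d, e]"

definition eps_mix :: "real^5 \<Rightarrow> 5 \<Rightarrow> 5 \<Rightarrow> 5 \<Rightarrow> 5 \<Rightarrow> real" where
  "eps_mix x \<mu> \<nu> \<rho> \<sigma> = eta \<mu> * eta \<nu> * (\<Sum>l\<in>UNIV. levi \<mu> \<nu> \<rho> \<sigma> l * lower x l)"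

definition Efield :: "nat \<Rightarrow> (real^5 \<Rightarrow> 5 list \<Rightarrow> complex) \<Rightarrow> real^5 \<Rightarrow> 5 list \<Rightarrow> complex" where
  "Efield s \<phi> x \<mu>s = (\<Sum>\<nu>s\<in>lists_len s.
      of_real (\<Prod>k<s. nvec x (\<nu>s!k)) * \<phi> x (interleave \<mu>s \<nu>s))"

definition Bfield :: "nat \<Rightarrow> (real^5 \<Rightarrow> 5 list \<Rightarrow> complex) \<Rightarrow> real^5 \<Rightarrow> 5 list \<Rightarrow> complex" where
  "Bfield s \<phi> x \<mu>s = (1/2) * (\<Sum>\<nu>1\<in>UNIV. \<Sum>\<rho>\<in>UNIV. \<Sum>\<sigma>\<in>UNIV. \<Sum>\<nu>s\<in>lists_len (s - 1).
      of_real (eps_mix x (hd \<mu>s) \<nu>1 \<rho> \<sigma> * nvec x \<nu>1 * (\<Prod>k<s-1. nvec x (\<nu>s!k)))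
      * \<phi> x (\<rho> # \<sigma> # interleave (tl \<mu>s) \<nu>s))"

definition on_S3 :: "real^5 \<Rightarrow> bool" where
  "on_S3 \<omega> \<longleftrightarrow> \<omega>$0 = 0 \<and> mink \<omega> \<omega> = 1"

definition tangent_S3 :: "real^5 \<Rightarrow> real^5 \<Rightarrow> bool" where
  "tangent_S3 \<omega> u \<longleftrightarrow> u$0 = 0 \<and> mink u \<omega> = 0"

definition gpt :: "real \<Rightarrow> real^5 \<Rightarrow> real^5" where
  "gpt z \<omega> = (1/z) *\<^sub>R axis 0 1 + sqrt (1 + 1/z^2) *\<^sub>R \<omega>"

text \<open>Components of a rank-s tensor w.r.t. coordinate vector fields d/d omega^i at fixed z:
  a tangent vector u of S^3 at omega corresponds to the ambient vector sqrt(1+1/z^2) u.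
  Result divided by z.\<close>
definition comp_over_z :: "nat \<Rightarrow> (real^5 \<Rightarrow> 5 list \<Rightarrow> complex) \<Rightarrow> real^5 \<Rightarrow> (real^5) list \<Rightarrow> real \<Rightarrow> complex" where
  "comp_over_z s F \<omega> us z = (\<Sum>\<mu>s\<in>lists_len s.
      of_real (\<Prod>k<s. sqrt (1 + 1/z^2) * (us!k)$(\<mu>s!k)) * F (gpt z \<omega>) \<mu>s) / of_real z"

definition bdryE_plus :: "nat \<Rightarrow> (real^5 \<Rightarrow> 5 list \<Rightarrow> complex) \<Rightarrow> real^5 \<Rightarrow> (real^5) list \<Rightarrow> complex" where
  "bdryE_plus s \<phi> \<omega> us = 1^(s+1) * Lim (at_right 0) (comp_over_z s (Efield s \<phi>) \<omega> us)"
definition bdryE_minus :: "nat \<Rightarrow> (real^5 \<Rightarrow> 5 list \<Rightarrow> complex) \<Rightarrow> real^5 \<Rightarrow> (real^5) list \<Rightarrow> complex" where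
  "bdryE_minus s \<phi> \<omega> us = (-1)^(s+1) * Lim (at_left 0) (comp_over_z s (Efield s \<phi>) \<omega> us)"
definition bdryB_plus :: "nat \<Rightarrow> (real^5 \<Rightarrow> 5 list \<Rightarrow> complex) \<Rightarrow> real^5 \<Rightarrow> (real^5) list \<Rightarrow> complex" where
  "bdryB_plus s \<phi> \<omega> us = 1^s * Lim (at_right 0) (comp_over_z s (Bfield s \<phi>) \<omega> us)"
definition bdryB_minus :: "nat \<Rightarrow> (real^5 \<Rightarrow> 5 list \<Rightarrow> complex) \<Rightarrow> real^5 \<Rightarrow> (real^5) list \<Rightarrow> complex" where
  "bdryB_minus s \<phi> \<omega> us = (-1)^s * Lim (at_left 0) (comp_over_z s (Bfield s \<phi>) \<omega> us)"

definition bdry_args :: "nat \<Rightarrow> real^5 \<Rightarrow> (real^5) list \<Rightarrow> bool" where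
  "bdry_args s \<omega> us \<longleftrightarrow> on_S3 \<omega> \<and> length us = s \<and> (\<forall>u\<in>set us. tangent_S3 \<omega> u)"

end

theory Submission
  imports Defs
begin

text \<open>On the cone of spacelike vectors of the ambient space, the degree -2 homogeneous extension of a
  solution is divergence-free and satisfies the Bianchi identity in the flat sense (for spin at
  least 2 the Bianchi identity follows from the divergence equation, because a trace-free field has
  equal left and right duals).  So all its ambient components are harmonic, and so are their
  degree -1 extensions H; the same holds for the dual field.  Such an H is a conformally coupled
  scalar wave: on the points w - cos eta e0 of the Einstein cylinder, sin rho times its mean over the
  sphere of radius rho around w solves the one-dimensional wave equation.  Kirchhoff's formula
  therefore shows that H extends continuously to eta = 0 and eta = pi, that its values there satisfy
  H(pi, w) = - H(0, -w), and that H is antipodally even if it vanishes at eta = 0.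

  The boundary data are the components of the limits of the field and of its dual.  For an even
  field, evenness and H(pi, w) = - H(0, -w) force the limits to vanish; an odd field has an even dual.
  Conversely, wedging the limiting tensor with the null vector w - e0 gives zero in every index pair,
  so that its electric components determine it: if they vanish at past infinity, all ambient
  components vanish there, and the field is even.\<close>

text \<open>The two degrees are forced. In the cyclic sum of flat derivatives the index terms cancel
  the radial term exactly in degree -2. Going to degree -1 multiplies by the Minkowski length r, and
  in five dimensions box (r f) = r box f + (2 k + 4) f / r for f of degree k, so that k = -2 is the
  degree in which this keeps harmonic functions harmonic; degree -1 is the conformal weight of a
  scalar in four dimensions. Ambient components serve to decouple the tensor equations: each is a
  scalar wave by itself, and the spin survives only in the index algebra. The limits come without
  estimates near infinity, since the slice eta = pi/2 contains spheres of every radius: the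
  Kirchhoff integral over them is continuous in the radius and so continues the wave through eta = 0
  and eta = pi. The dual is not shown to solve the field equations. What is needed of it at infinity
  (scalar wave equation, tangency, index symmetries, wedge condition) is collected in
  \<open>asymptotic_tensor\<close>, which field and dual both satisfy.\<close>

lemma exhaust_5: fixes x :: 5 shows "x = 0 \<or> x = 1 \<or> x = 2 \<or> x = 3 \<or> x = 4"
proof (induct x)
  case (of_int z)
  then have "0 \<le> z" and "z < 5" by simp_all
  then have "z = 0 \<or> z = 1 \<or> z = 2 \<or> z = 3 \<or> z = 4" by arith
  then show ?case by auto
qed

lemma UNIV_5: "(UNIV :: 5 set) = {0, 1, 2, 3, 4}"
  using exhaust_5 by auto

lemma sum_5: "sum f (UNIV :: 5 set) = f 0 + f 1 + f 2 + f 3 + f 4"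
  unfolding UNIV_5 by (simp add: ac_simps)

section \<open>Functions with two continuous derivatives\<close>

lemma has_vector_derivative_left_end_eq:
  fixes f :: "real \<Rightarrow> complex"
  assumes "a < b" "(f has_vector_derivative x) (at a within {a..b})"
    "(f has_vector_derivative y) (at a within {a..b})"
  shows "x = y"
  using vector_derivative_unique_within_closed_interval[of a b a f x y] assms by (simp add: less_imp_le)

text \<open>Integrating \<open>Ft s\<close> over t and differentiating at s = 0 under the integral
  sign makes \<open>Fts 0\<close> the derivative of \<open>Fs 0\<close>. One-sided derivatives on a
  square allow the point of interest to sit at a corner.\<close>

lemma mixed_partials_eq:
  fixes F Fs Ft Fst Fts :: "real \<Rightarrow> real \<Rightarrow> complex"
  assumes h: "h > 0"
    and Fs: "\<And>s t. s \<in> {0..h} \<Longrightarrow> t \<in> {0..h} \<Longrightarrow> ((\<lambda>s. F s t) has_vector_derivative Fs s t) (at s within {0..h})"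
    and Ft: "\<And>s t. s \<in> {0..h} \<Longrightarrow> t \<in> {0..h} \<Longrightarrow> ((\<lambda>t. F s t) has_vector_derivative Ft s t) (at t within {0..h})"
    and Fts: "\<And>s t. s \<in> {0..h} \<Longrightarrow> t \<in> {0..h} \<Longrightarrow> ((\<lambda>s. Ft s t) has_vector_derivative Fts s t) (at s within {0..h})"
    and Fst: "((\<lambda>t. Fs 0 t) has_vector_derivative Fst 0 0) (at 0 within {0..h})"
    and contFt: "\<And>s. s \<in> {0..h} \<Longrightarrow> continuous_on {0..h} (Ft s)"
    and contFts: "continuous_on ({0..h} \<times> {0..h}) (\<lambda>(s, t). Fts s t)"
  shows "Fst 0 0 = Fts 0 0"
proof -
  have 0: "0 \<in> {0..h}" using h by simp
  have eq: "Fs 0 t = Fs 0 0 + integral {0..t} (\<lambda>u. Fts 0 u)" if t: "t \<in> {0..h}" for t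
  proof -
    have sub: "{0..t} \<subseteq> {0..h}" using t by auto
    have I: "integral {0..t} (Ft s) = F s t - F s 0" if s: "s \<in> {0..h}" for s
    proof (rule integral_unique, rule fundamental_theorem_of_calculus)
      show "0 \<le> t" using t by simp
      show "(F s has_vector_derivative Ft s x) (at x within {0..t})" if "x \<in> {0..t}" for x
        using Ft[OF s] that sub has_vector_derivative_within_subset by blast
    qed
    have "((\<lambda>s. integral (cbox 0 t) (Ft s)) has_vector_derivative integral (cbox 0 t) (Fts 0)) (at 0 within {0..h})"
    proof (rule leibniz_rule_vector_derivative)
      show "((\<lambda>s. Ft s u) has_vector_derivative Fts s u) (at s within {0..h})" if "s \<in> {0..h}" "u \<in> cbox 0 t" for s u
        using Fts that sub by auto
      show "Ft s integrable_on cbox 0 t" if "s \<in> {0..h}" for s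
        by (rule integrable_continuous) (use continuous_on_subset[OF contFt[OF that] sub] in simp)
      show "continuous_on ({0..h} \<times> cbox 0 t) (\<lambda>(s, t). Fts s t)"
        by (rule continuous_on_subset[OF contFts]) (use sub in auto)
    qed (use 0 in auto)
    moreover have "((\<lambda>s. F s t - F s 0) has_vector_derivative Fs 0 t - Fs 0 0) (at 0 within {0..h})"
      by (intro has_vector_derivative_diff Fs) (use 0 t in auto)
    then have "((\<lambda>s. integral (cbox 0 t) (Ft s)) has_vector_derivative Fs 0 t - Fs 0 0) (at 0 within {0..h})"
      by (rule has_vector_derivative_transform[rotated 2]) (use 0 I in auto)
    ultimately have "Fs 0 t - Fs 0 0 = integral (cbox 0 t) (Fts 0)"
      using has_vector_derivative_left_end_eq[OF h] by blast
    then show ?thesis by (simp add: algebra_simps)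
  qed
  have cont0: "continuous_on {0..h} (Fts 0)"
  proof -
    have "continuous_on {0..h} ((\<lambda>(s, t). Fts s t) \<circ> (\<lambda>t. (0, t)))"
      by (rule continuous_on_compose)
        (auto intro!: continuous_intros intro: continuous_on_subset[OF contFts] simp: h less_imp_le)
    then show ?thesis by (simp add: o_def)
  qed
  have "((\<lambda>t. integral {0..t} (Fts 0)) has_vector_derivative Fts 0 0) (at 0 within {0..h})"
    by (rule integral_has_vector_derivative[OF cont0 0])
  from has_vector_derivative_add[OF has_vector_derivative_const this]
 have "((\<lambda>t. Fs 0 0 + integral {0..t} (Fts 0)) has_vector_derivative Fts 0 0) (at 0 within {0..h})"
    by simp
  then have "((\<lambda>t. Fs 0 t) has_vector_derivative Fts 0 0) (at 0 within {0..h})"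
    by (rule has_vector_derivative_transform[rotated 2]) (use 0 in \<open>simp_all add: eq[symmetric]\<close>)
  then show ?thesis using has_vector_derivative_left_end_eq[OF h Fst] by blast
qed

section \<open>The spacelike cone and derivatives along curves\<close>

definition cone :: "(real^5) set" where
  "cone = {X. mink X X > 0}"

lemma mink_5: "mink x y = - x$0 * y$0 + x$1 * y$1 + x$2 * y$2 + x$3 * y$3 + x$4 * y$4"
  by (simp add: mink_def sum_5 eta_def)

lemma continuous_on_mink[continuous_intros]:
  assumes "continuous_on S f" "continuous_on S g"
  shows "continuous_on S (\<lambda>x. mink (f x) (g x))"
  unfolding mink_5 by (intro continuous_intros assms)

lemma open_cone: "open cone"
  unfolding cone_def by (intro open_Collect_less continuous_intros)

text \<open>The partial derivatives are parameters, so that an instance can supply explicit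
  homogeneous functions for them. \<open>D1\<close> and \<open>D2\<close> are the differential and
  the Hessian as a bilinear form.\<close>

locale C2_fun =
  fixes C :: "(real^5) set" and H :: "real^5 \<Rightarrow> complex"
    and H1 :: "5 \<Rightarrow> real^5 \<Rightarrow> complex" and H2 :: "5 \<Rightarrow> 5 \<Rightarrow> real^5 \<Rightarrow> complex"
  assumes open_C: "open C"
    and H1: "\<And>X. X \<in> C \<Longrightarrow> (H has_derivative (\<lambda>v. \<Sum>a\<in>UNIV. v$a *\<^sub>R H1 a X)) (at X)"
    and H2: "\<And>X a. X \<in> C \<Longrightarrow> (H1 a has_derivative (\<lambda>v. \<Sum>b\<in>UNIV. v$b *\<^sub>R H2 a b X)) (at X)"
    and contH2: "\<And>a b. continuous_on C (H2 a b)"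
begin

definition "D1 X v = (\<Sum>a\<in>UNIV. v$a *\<^sub>R H1 a X)" for v :: "real^5"
definition "D2 X u v = (\<Sum>a\<in>UNIV. \<Sum>b\<in>UNIV. (u$a * v$b) *\<^sub>R H2 a b X)" for u v :: "real^5"

lemma D1_add: "D1 X (u + v) = D1 X u + D1 X v"
  and D1_scale: "D1 X (r *\<^sub>R v) = r *\<^sub>R D1 X v"
  and D1_minus: "D1 X (- v) = - D1 X v"
  and D1_diff: "D1 X (u - v) = D1 X u - D1 X v"
  by (simp_all add: D1_def sum_5 algebra_simps)

lemma D2_add_left: "D2 X (u + v) w = D2 X u w + D2 X v w"
  and D2_add_right: "D2 X w (u + v) = D2 X w u + D2 X w v"
  by (simp_all add: D2_def sum.distrib algebra_simps)

lemma D2_scale_left: "D2 X (r *\<^sub>R v) w = r *\<^sub>R D2 X v w"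
  and D2_scale_right: "D2 X w (r *\<^sub>R v) = r *\<^sub>R D2 X w v"
  by (simp_all add: D2_def scaleR_sum_right mult_ac)

lemma D2_minus_left: "D2 X (- v) w = - D2 X v w"
  and D2_minus_right: "D2 X w (- v) = - D2 X w v"
  by (simp_all add: D2_def sum_negf)

lemma D2_diff_left: "D2 X (u - v) w = D2 X u w - D2 X v w"
  and D2_diff_right: "D2 X w (u - v) = D2 X w u - D2 X w v"
  by (simp_all add: D2_def sum_subtractf algebra_simps)

lemmas D_linear = D1_add D1_scale D1_minus D1_diff D2_add_left D2_add_right D2_scale_left
  D2_scale_right D2_minus_left D2_minus_right D2_diff_left D2_diff_right

lemma contH1: "continuous_on C (H1 a)"
  using H2 has_derivative_continuous open_C continuous_on_eq_continuous_at by blast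

lemma contH: "continuous_on C H"
  using H1 has_derivative_continuous open_C continuous_on_eq_continuous_at by blast

lemma cont_D1:
  assumes "continuous_on S y" "continuous_on S v" "y ` S \<subseteq> C"
  shows "continuous_on S (\<lambda>t. D1 (y t) (v t))"
  unfolding D1_def
  by (intro continuous_intros assms(2) continuous_on_compose2[OF contH1 assms(1,3)])

lemma cont_D2:
  assumes "continuous_on S y" "continuous_on S u" "continuous_on S v" "y ` S \<subseteq> C"
  shows "continuous_on S (\<lambda>t. D2 (y t) (u t) (v t))"
  unfolding D2_def
  by (intro continuous_intros assms(2,3) continuous_on_compose2[OF contH2 assms(1,4)])

lemma cont_H:
  assumes "continuous_on S y" "y ` S \<subseteq> C"
  shows "continuous_on S (\<lambda>t. H (y t))"
  by (rule continuous_on_compose2[OF contH assms])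

lemma H_along_curve:
  assumes "(y has_vector_derivative y') (at t within S)" "y t \<in> C"
  shows "((\<lambda>t. H (y t)) has_vector_derivative D1 (y t) y') (at t within S)"
  using vector_derivative_diff_chain_within[of y y' t S H "D1 (y t)"]
    has_derivative_at_withinI[OF H1[OF assms(2)]] assms(1)
  by (simp add: o_def D1_def[abs_def])

lemma H1_along_curve:
  assumes "(y has_vector_derivative y') (at t within S)" "y t \<in> C"
  shows "((\<lambda>t. H1 a (y t)) has_vector_derivative (\<Sum>b\<in>UNIV. y'$b *\<^sub>R H2 a b (y t))) (at t within S)"
  using vector_derivative_diff_chain_within[of y y' t S "H1 a" "\<lambda>v. \<Sum>b\<in>UNIV. v$b *\<^sub>R H2 a b (y t)"]
    has_derivative_at_withinI[OF H2[OF assms(2)]] assms(1)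
  by (simp add: o_def)

lemma D1_along_curve:
  assumes "(y has_vector_derivative y') (at t within S)" "y t \<in> C"
    "(v has_vector_derivative v') (at t within S)"
  shows "((\<lambda>t. D1 (y t) (v t)) has_vector_derivative D2 (y t) (v t) y' + D1 (y t) v') (at t within S)"
proof -
  have "((\<lambda>t. v t $ a) has_vector_derivative v' $ a) (at t within S)" for a
    using bounded_linear.has_vector_derivative[OF bounded_linear_vec_nth assms(3)] .
  then have *: "((\<lambda>t. v t $ a *\<^sub>R H1 a (y t)) has_vector_derivative
     (v t $ a *\<^sub>R (\<Sum>b\<in>UNIV. y'$b *\<^sub>R H2 a b (y t)) + v' $ a *\<^sub>R H1 a (y t))) (at t within S)" for a
    by (intro has_vector_derivative_scaleR H1_along_curve assms(1,2))
       (simp add: has_real_derivative_iff_has_vector_derivative)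
  show ?thesis unfolding D1_def D2_def
    by (rule has_vector_derivative_eq_rhs[OF has_vector_derivative_sum[OF *]])
       (simp add: sum.distrib scaleR_sum_right)
qed

lemma H2_sym: assumes X: "X \<in> C" shows "H2 a b X = H2 b a X"
proof -
  define y where "y s t = X + s *\<^sub>R axis a 1 + t *\<^sub>R axis b (1::real)" for s t
  obtain e where e: "e > 0" "ball X e \<subseteq> C" using open_C X openE by blast
  \<comment> \<open>Two displacements of length at most \<open>e / 4\<close> each keep the whole
    square inside the ball, whatever the two axes are.\<close>
  define h where "h = e / 4"
  have h: "h > 0" using e by (simp add: h_def)
  have yC: "y s t \<in> C" if "s \<in> {0..h}" "t \<in> {0..h}" for s t
  proof -
    have "norm (s *\<^sub>R axis a (1::real) + t *\<^sub>R axis b (1::real)) \<le> \<bar>s\<bar> + \<bar>t\<bar>"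
      by (rule order_trans[OF norm_triangle_ineq]) simp
    also have "\<dots> < e" using that e by (simp add: h_def)
    also have "s *\<^sub>R axis a (1::real) + t *\<^sub>R axis b (1::real) = y s t - X" by (simp add: y_def)
    finally have "y s t \<in> ball X e" by (metis dist_commute dist_norm mem_ball)
    then show ?thesis using e by blast
  qed
  have ys: "((\<lambda>s. y s t) has_vector_derivative axis a 1) (at s within S)" for s t S
    unfolding y_def by (auto intro!: derivative_eq_intros simp: has_vector_derivative_def)
  have yt: "((\<lambda>t. y s t) has_vector_derivative axis b 1) (at t within S)" for s t S
    unfolding y_def by (auto intro!: derivative_eq_intros simp: has_vector_derivative_def)
  have D1ax: "D1 Z (axis c 1) = H1 c Z" for Z c
    unfolding D1_def by (subst sum.remove[of _ c]) (auto simp: axis_def intro!: sum.neutral)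
  have D2ax: "(\<Sum>d\<in>UNIV. axis c' (1::real) $ d *\<^sub>R H2 c d Z) = H2 c c' Z" for Z c c'
    by (subst sum.remove[of _ c']) (auto simp: axis_def intro!: sum.neutral)
  have cy: "continuous_on T (\<lambda>t. y s t)" for T s unfolding y_def by (intro continuous_intros)
  have cy2: "continuous_on T (\<lambda>p. y (fst p) (snd p))" for T unfolding y_def by (intro continuous_intros)
  have 0: "0 \<in> {0..h}" using h by simp
  have "H2 a b (y 0 0) = H2 b a (y 0 0)"
  proof (rule mixed_partials_eq[where F="\<lambda>s t. H (y s t)" and Fs="\<lambda>s t. H1 a (y s t)" and Ft="\<lambda>s t. H1 b (y s t)"
        and Fst="\<lambda>s t. H2 a b (y s t)" and Fts="\<lambda>s t. H2 b a (y s t)", OF h])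
    show "((\<lambda>s. H (y s t)) has_vector_derivative H1 a (y s t)) (at s within {0..h})" if "s \<in> {0..h}" "t \<in> {0..h}" for s t
      using H_along_curve[OF ys yC[OF that]] by (simp add: D1ax)
    show "((\<lambda>t. H (y s t)) has_vector_derivative H1 b (y s t)) (at t within {0..h})" if "s \<in> {0..h}" "t \<in> {0..h}" for s t
      using H_along_curve[OF yt yC[OF that]] by (simp add: D1ax)
    show "((\<lambda>s. H1 b (y s t)) has_vector_derivative H2 b a (y s t)) (at s within {0..h})" if "s \<in> {0..h}" "t \<in> {0..h}" for s t
      using H1_along_curve[OF ys yC[OF that]] by (simp add: D2ax)
    show "((\<lambda>t. H1 a (y 0 t)) has_vector_derivative H2 a b (y 0 0)) (at 0 within {0..h})"
      using H1_along_curve[OF yt yC[OF 0 0]] by (simp add: D2ax)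
    show "continuous_on {0..h} (\<lambda>t. H1 b (y s t))" if "s \<in> {0..h}" for s
      by (rule continuous_on_compose2[OF contH1 cy]) (use yC that in auto)
    show "continuous_on ({0..h} \<times> {0..h}) (\<lambda>(s, t). H2 b a (y s t))"
      unfolding split_beta by (rule continuous_on_compose2[OF contH2 cy2]) (use yC in auto)
  qed
  then show ?thesis by (simp add: y_def)
qed

lemma D2_sym: "X \<in> C \<Longrightarrow> D2 X u v = D2 X v u"
  unfolding D2_def by (subst sum.swap) (simp add: H2_sym mult.commute)

end

section \<open>Spherical means of conformally coupled waves\<close>

abbreviation e0 :: "real^5" where "e0 \<equiv> axis 0 1"

text \<open>The products of w with the three quaternion units: an orthonormal basis of the tangent space of the 3-sphere at w.\<close>

definition frame1 :: "real^5 \<Rightarrow> real^5" where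
  "frame1 w = (\<chi> i. if i = 1 then - w$2 else if i = 2 then w$1 else if i = 3 then - w$4 else if i = 4 then w$3 else 0)"

definition frame2 :: "real^5 \<Rightarrow> real^5" where
  "frame2 w = (\<chi> i. if i = 1 then - w$3 else if i = 2 then w$4 else if i = 3 then w$1 else if i = 4 then - w$2 else 0)"

definition frame3 :: "real^5 \<Rightarrow> real^5" where
  "frame3 w = (\<chi> i. if i = 1 then - w$4 else if i = 2 then - w$3 else if i = 3 then w$2 else if i = 4 then w$1 else 0)"

text \<open>Directions at w in spherical coordinates p = (theta, phi), with the unit vectors in the theta and phi directions.\<close>

definition nv :: "real^5 \<Rightarrow> real \<times> real \<Rightarrow> real^5" where
  "nv w p = (sin (fst p) * cos (snd p)) *\<^sub>R frame1 w + (sin (fst p) * sin (snd p)) *\<^sub>R frame2 w + cos (fst p) *\<^sub>R frame3 w"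

definition tv :: "real^5 \<Rightarrow> real \<times> real \<Rightarrow> real^5" where
  "tv w p = (cos (fst p) * cos (snd p)) *\<^sub>R frame1 w + (cos (fst p) * sin (snd p)) *\<^sub>R frame2 w - sin (fst p) *\<^sub>R frame3 w"

definition pv :: "real^5 \<Rightarrow> real \<times> real \<Rightarrow> real^5" where
  "pv w p = cos (snd p) *\<^sub>R frame2 w - sin (snd p) *\<^sub>R frame1 w"

text \<open>The great circle leaving \<open>w\<close> in the direction \<open>nv w p\<close>,
  parametrized by arc length; \<open>qv'\<close> is its velocity.\<close>

definition qv :: "real^5 \<Rightarrow> real \<Rightarrow> real \<times> real \<Rightarrow> real^5" where
  "qv w \<rho> p = cos \<rho> *\<^sub>R w + sin \<rho> *\<^sub>R nv w p"

definition qv' :: "real^5 \<Rightarrow> real \<Rightarrow> real \<times> real \<Rightarrow> real^5" where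
  "qv' w \<rho> p = cos \<rho> *\<^sub>R nv w p - sin \<rho> *\<^sub>R w"

text \<open>The point at conformal time eta that lies at distance rho from w in the direction p.\<close>

definition Yv :: "real^5 \<Rightarrow> real \<Rightarrow> real \<Rightarrow> real \<times> real \<Rightarrow> real^5" where
  "Yv w \<eta> \<rho> p = qv w \<rho> p - cos \<eta> *\<^sub>R e0"

abbreviation "sph \<equiv> cbox (0::real, 0::real) (pi, 2 * pi)"

section \<open>Minkowski products of the unit vectors on the 3-sphere\<close>

lemma mink_add_left: "mink (x + y) z = mink x z + mink y z"
  and mink_add_right: "mink z (x + y) = mink z x + mink z y"
  and mink_diff_left: "mink (x - y) z = mink x z - mink y z"
  and mink_diff_right: "mink z (x - y) = mink z x - mink z y"
  and mink_scale_left: "mink (r *\<^sub>R x) z = r * mink x z"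
  and mink_scale_right: "mink z (r *\<^sub>R x) = r * mink z x"
  and mink_minus_left: "mink (- x) z = - mink x z"
  and mink_minus_right: "mink z (- x) = - mink z x"
  and mink_commute: "mink x z = mink z x"
  by (simp_all add: mink_5 algebra_simps)

lemmas mink_linear = mink_add_left mink_add_right mink_diff_left mink_diff_right
  mink_scale_left mink_scale_right mink_minus_left mink_minus_right

lemma mink_e0: "mink e0 x = - x$0" "mink x e0 = - x$0" "e0 $ 0 = 1"
  by (simp_all add: mink_5 axis_def)

lemma frame_time [simp]: "frame1 w $ 0 = 0" "frame2 w $ 0 = 0" "frame3 w $ 0 = 0"
  by (simp_all add: frame1_def frame2_def frame3_def)

lemma frame_orthonormal:
  assumes "on_S3 w"
  shows "mink (frame1 w) (frame1 w) = 1" "mink (frame2 w) (frame2 w) = 1" "mink (frame3 w) (frame3 w) = 1"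
    "mink (frame1 w) (frame2 w) = 0" "mink (frame1 w) (frame3 w) = 0" "mink (frame2 w) (frame3 w) = 0"
    "mink w (frame1 w) = 0" "mink w (frame2 w) = 0" "mink w (frame3 w) = 0"
  using assms
  by (simp_all add: on_S3_def mink_5 frame1_def frame2_def frame3_def algebra_simps)

text \<open>Oriented rewrite rules that eliminate squares of sines; the second form applies inside
  products normalized by \<open>algebra_simps\<close>.\<close>

lemma sin_sin: "sin x * sin x = 1 - cos x * cos (x::real)"
  and sin_sin_left: "sin x * (sin x * y) = y - cos x * (cos x * y)"
proof -
  show *: "sin x * sin x = 1 - cos x * cos (x::real)"
    using sin_cos_squared_add[of x] by (simp add: power2_eq_square algebra_simps)
  have "sin x * (sin x * y) = (sin x * sin x) * y" by simp
  then show "sin x * (sin x * y) = y - cos x * (cos x * y)" by (simp only: *) (simp add: algebra_simps)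
qed

lemma nv_unit:
  assumes "on_S3 w"
  shows "mink (nv w p) (nv w p) = 1" "mink w (nv w p) = 0" "nv w p $ 0 = 0"
proof -
  note o = frame_orthonormal[OF assms]
  show "mink (nv w p) (nv w p) = 1"
    by (simp add: nv_def mink_linear o mink_commute[of "frame2 w" "frame1 w"] mink_commute[of "frame3 w" "frame1 w"]
        mink_commute[of "frame3 w" "frame2 w"] algebra_simps sin_sin sin_sin_left)
qed (simp_all add: nv_def mink_linear frame_orthonormal[OF assms])

lemma qv_unit:
  assumes "on_S3 w"
  shows "mink (qv w \<rho> p) (qv w \<rho> p) = 1" "qv w \<rho> p $ 0 = 0"
proof -
  note o = nv_unit[OF assms]
  show "mink (qv w \<rho> p) (qv w \<rho> p) = 1"
    using assms by (simp add: qv_def mink_linear o mink_commute[of "nv w p" w] on_S3_def algebra_simps sin_sin sin_sin_left)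
  show "qv w \<rho> p $ 0 = 0" using assms by (simp add: qv_def o on_S3_def)
qed

lemma on_S3_qv: "on_S3 w \<Longrightarrow> on_S3 (qv w \<rho> p)"
  by (simp add: on_S3_def[of "qv w \<rho> p"] qv_unit)

text \<open>The Minkowski square is 1 - c^2, which for c = - cos eta is sin^2 eta. These points
  represent rays of the cone on the Einstein cylinder; division by sin eta puts them on dS4.\<close>

lemma slice_in_cone:
  assumes "on_S3 w" "\<bar>c\<bar> < 1"
  shows "w + c *\<^sub>R e0 \<in> cone"
proof -
  have "mink (w + c *\<^sub>R e0) (w + c *\<^sub>R e0) = 1 - c\<^sup>2"
    using assms by (simp add: mink_linear mink_e0 on_S3_def power2_eq_square)
  moreover have "c\<^sup>2 < 1" using assms(2) by (simp add: abs_square_less_1)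
  ultimately show ?thesis by (simp add: cone_def)
qed

lemma abs_cos_less_1: "0 < \<eta> \<Longrightarrow> \<eta> < pi \<Longrightarrow> \<bar>cos \<eta>\<bar> < 1"
  using cos_monotone_0_pi[of 0 \<eta>] cos_monotone_0_pi[of \<eta> pi] by simp

lemma Yv_in_cone: "on_S3 w \<Longrightarrow> 0 < \<eta> \<Longrightarrow> \<eta> < pi \<Longrightarrow> Yv w \<eta> \<rho> p \<in> cone"
  using slice_in_cone[OF on_S3_qv, of w "- cos \<eta>" \<rho> p] abs_cos_less_1[of \<eta>] by (simp add: Yv_def)

section \<open>Continuity and derivatives in spherical coordinates\<close>

lemma cont_nv [continuous_intros]:
  fixes S :: "'a::t2_space set"
  assumes "continuous_on S f" shows "continuous_on S (\<lambda>x. nv w (f x))"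
  unfolding nv_def by (intro continuous_intros assms)

lemma cont_tv [continuous_intros]:
  fixes S :: "'a::t2_space set"
  assumes "continuous_on S f" shows "continuous_on S (\<lambda>x. tv w (f x))"
  unfolding tv_def by (intro continuous_intros assms)

lemma cont_pv [continuous_intros]:
  fixes S :: "'a::t2_space set"
  assumes "continuous_on S f" shows "continuous_on S (\<lambda>x. pv w (f x))"
  unfolding pv_def by (intro continuous_intros assms)

lemma cont_qv [continuous_intros]:
  fixes S :: "'a::t2_space set"
  assumes "continuous_on S f" "continuous_on S r"
  shows "continuous_on S (\<lambda>x. qv w (r x) (f x))" "continuous_on S (\<lambda>x. qv' w (r x) (f x))"
  unfolding qv_def qv'_def by (intro continuous_intros assms)+

lemma cont_Yv [continuous_intros]:
  fixes S :: "'a::t2_space set"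
  assumes "continuous_on S f" "continuous_on S r" "continuous_on S g"
  shows "continuous_on S (\<lambda>x. Yv w (g x) (r x) (f x))"
  unfolding Yv_def by (intro continuous_intros assms)

lemma vd_qv: "((\<lambda>\<rho>. qv w \<rho> p) has_vector_derivative qv' w \<rho> p) (at \<rho> within S)"
  unfolding qv_def qv'_def has_vector_derivative_def
  by (auto intro!: derivative_eq_intros simp: algebra_simps)

lemma vd_qv': "((\<lambda>\<rho>. qv' w \<rho> p) has_vector_derivative - qv w \<rho> p) (at \<rho> within S)"
  unfolding qv_def qv'_def has_vector_derivative_def
  by (auto intro!: derivative_eq_intros simp: algebra_simps)

lemma vd_nv_theta: "((\<lambda>\<theta>. nv w (\<theta>, \<phi>)) has_vector_derivative tv w (\<theta>, \<phi>)) (at \<theta> within S)"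
  and vd_tv_theta: "((\<lambda>\<theta>. tv w (\<theta>, \<phi>)) has_vector_derivative - nv w (\<theta>, \<phi>)) (at \<theta> within S)"
  and vd_nv_phi: "((\<lambda>\<phi>. nv w (\<theta>, \<phi>)) has_vector_derivative sin \<theta> *\<^sub>R pv w (\<theta>, \<phi>)) (at \<phi> within S)"
  unfolding nv_def tv_def pv_def has_vector_derivative_def
  by (auto intro!: derivative_eq_intros simp: algebra_simps)

text \<open>The unit vector along a circle of latitude turns towards the axis of that circle; the
  right-hand side is this horizontal vector in the moving frame \<open>nv\<close>,
  \<open>tv\<close>.\<close>

lemma vd_pv_phi: "((\<lambda>\<phi>. pv w (\<theta>, \<phi>)) has_vector_derivative - (sin \<theta> *\<^sub>R nv w (\<theta>, \<phi>) + cos \<theta> *\<^sub>R tv w (\<theta>, \<phi>))) (at \<phi> within S)"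
proof -
  have "((\<lambda>\<phi>. pv w (\<theta>, \<phi>)) has_vector_derivative - (sin \<phi> *\<^sub>R frame2 w + cos \<phi> *\<^sub>R frame1 w)) (at \<phi> within S)"
    unfolding pv_def has_vector_derivative_def by (auto intro!: derivative_eq_intros simp: algebra_simps)
  moreover have "sin \<theta> *\<^sub>R nv w (\<theta>, \<phi>) + cos \<theta> *\<^sub>R tv w (\<theta>, \<phi>) = sin \<phi> *\<^sub>R frame2 w + cos \<phi> *\<^sub>R frame1 w"
    by (simp add: nv_def tv_def algebra_simps sin_sin sin_sin_left)
  ultimately show ?thesis by simp
qed

lemma vd_Yv_theta: "((\<lambda>\<theta>. Yv w \<eta> \<rho> (\<theta>, \<phi>)) has_vector_derivative sin \<rho> *\<^sub>R tv w (\<theta>, \<phi>)) (at \<theta> within S)"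
proof -
  note a = bounded_linear.has_vector_derivative[OF bounded_linear_scaleR_right vd_nv_theta, of "sin \<rho>" w \<phi> \<theta> S]
  from has_vector_derivative_diff[OF has_vector_derivative_add[OF has_vector_derivative_const[of "cos \<rho> *\<^sub>R w"] a]
     has_vector_derivative_const[of "cos \<eta> *\<^sub>R e0"]]
  show ?thesis by (simp add: Yv_def qv_def)
qed

lemma vd_Yv_phi: "((\<lambda>\<phi>. Yv w \<eta> \<rho> (\<theta>, \<phi>)) has_vector_derivative (sin \<rho> * sin \<theta>) *\<^sub>R pv w (\<theta>, \<phi>)) (at \<phi> within S)"
proof -
  note a = bounded_linear.has_vector_derivative[OF bounded_linear_scaleR_right vd_nv_phi, of "sin \<rho>" w \<theta> \<phi> S]
  from has_vector_derivative_diff[OF has_vector_derivative_add[OF has_vector_derivative_const[of "cos \<rho> *\<^sub>R w"] a]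
     has_vector_derivative_const[of "cos \<eta> *\<^sub>R e0"]]
  show ?thesis by (simp add: Yv_def qv_def)
qed

section \<open>Harmonic functions of degree -1 on the cone\<close>

locale conformal_wave = C2_fun cone H H1 H2 for H H1 H2 +
  assumes box: "\<And>X. X \<in> cone \<Longrightarrow> (\<Sum>a\<in>UNIV. eta a *\<^sub>R H2 a a X) = 0"
    and hom: "\<And>X t. X \<in> cone \<Longrightarrow> t > 0 \<Longrightarrow> H (t *\<^sub>R X) = inverse t *\<^sub>R H X"
begin

lemma cone_scale: "X \<in> cone \<Longrightarrow> t > 0 \<Longrightarrow> t *\<^sub>R X \<in> cone"
  by (simp add: cone_def mink_linear)

lemma vd_scale: "((\<lambda>t. t *\<^sub>R X) has_vector_derivative X) (at t within S)" for X :: "real^5"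
  by (auto intro!: derivative_eq_intros simp: has_vector_derivative_def)

lemma euler: assumes X: "X \<in> cone" shows "D1 X X = - H X"
proof -
  have "((\<lambda>t. H (t *\<^sub>R X)) has_vector_derivative D1 (1 *\<^sub>R X) X) (at 1)"
    by (rule H_along_curve[OF vd_scale]) (use X in simp)
  moreover have "((\<lambda>t. inverse t *\<^sub>R H X) has_vector_derivative - H X) (at 1)"
    by (auto intro!: derivative_eq_intros simp: has_vector_derivative_def)
  then have "((\<lambda>t. H (t *\<^sub>R X)) has_vector_derivative - H X) (at 1)"
    by (rule has_vector_derivative_transform_within_open[of _ _ _ "{0<..}"]) (use hom X in auto)
  ultimately show ?thesis using vector_derivative_unique_at by fastforce
qed

lemma H1_hom: assumes X: "X \<in> cone" and t: "t > 0" shows "H1 a (t *\<^sub>R X) = inverse (t\<^sup>2) *\<^sub>R H1 a X"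
proof -
  have "((\<lambda>u. H (X + u *\<^sub>R axis a 1)) has_vector_derivative H1 a X) (at 0)"
  proof -
    have "((\<lambda>u. X + u *\<^sub>R axis a 1) has_vector_derivative axis a 1) (at 0)"
      by (auto intro!: derivative_eq_intros simp: has_vector_derivative_def)
    from H_along_curve[OF this] show ?thesis using X
      by (simp add: D1_def axis_def if_distrib[of "\<lambda>x. x *\<^sub>R _"] cong: if_cong)
  qed
  then have 1: "((\<lambda>u. inverse t *\<^sub>R H (X + u *\<^sub>R axis a 1)) has_vector_derivative inverse t *\<^sub>R H1 a X) (at 0)"
    by (rule bounded_linear.has_vector_derivative[OF bounded_linear_scaleR_right])
  have 2: "((\<lambda>u. H (t *\<^sub>R (X + u *\<^sub>R axis a 1))) has_vector_derivative t *\<^sub>R H1 a (t *\<^sub>R X)) (at 0)"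
  proof -
    have "((\<lambda>u. t *\<^sub>R (X + u *\<^sub>R axis a 1)) has_vector_derivative t *\<^sub>R axis a 1) (at 0)"
      by (auto intro!: derivative_eq_intros simp: has_vector_derivative_def)
    from H_along_curve[OF this] show ?thesis using cone_scale[OF X t]
      by (simp add: D1_scale) (simp add: D1_def axis_def if_distrib[of "\<lambda>x. x *\<^sub>R _"] cong: if_cong)
  qed
  have o: "open ((\<lambda>u. X + u *\<^sub>R axis a 1) -` cone)"
    by (rule continuous_open_vimage) (auto intro!: continuous_intros open_cone)
  have "((\<lambda>u. H (t *\<^sub>R (X + u *\<^sub>R axis a 1))) has_vector_derivative inverse t *\<^sub>R H1 a X) (at 0)"
    by (rule has_vector_derivative_transform_within_open[OF 1 o]) (use hom X t in auto)
  with 2 have "t *\<^sub>R H1 a (t *\<^sub>R X) = inverse t *\<^sub>R H1 a X" by (rule vector_derivative_unique_at)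
  then have "inverse t *\<^sub>R (t *\<^sub>R H1 a (t *\<^sub>R X)) = inverse t *\<^sub>R (inverse t *\<^sub>R H1 a X)" by simp
  then show ?thesis using t by (simp add: power2_eq_square)
qed

lemma euler1: assumes X: "X \<in> cone" shows "D2 X v X = - 2 *\<^sub>R D1 X v"
proof -
  have "(\<Sum>b\<in>UNIV. X$b *\<^sub>R H2 a b X) = - 2 *\<^sub>R H1 a X" for a
  proof -
    have "((\<lambda>t. H1 a (t *\<^sub>R X)) has_vector_derivative (\<Sum>b\<in>UNIV. X$b *\<^sub>R H2 a b (1 *\<^sub>R X))) (at 1)"
      by (rule H1_along_curve[OF vd_scale]) (use X in simp)
    moreover have "((\<lambda>t. inverse (t\<^sup>2) *\<^sub>R H1 a X) has_vector_derivative - 2 *\<^sub>R H1 a X) (at 1)"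
      by (auto intro!: derivative_eq_intros simp: has_vector_derivative_def)
    then have "((\<lambda>t. H1 a (t *\<^sub>R X)) has_vector_derivative - 2 *\<^sub>R H1 a X) (at 1)"
      by (rule has_vector_derivative_transform_within_open[of _ _ _ "{0<..}"]) (use H1_hom X in auto)
    ultimately show ?thesis using vector_derivative_unique_at by fastforce
  qed
  then show ?thesis
    by (simp add: D2_def D1_def scaleR_scaleR[symmetric] scaleR_sum_right[symmetric] sum_negf[symmetric] del: scaleR_scaleR)
       (simp add: scaleR_sum_right mult.commute sum_negf)
qed

text \<open>\<open>w\<close> and its three quaternion multiples form an orthonormal basis of the
  spatial R^4, and the trace of the Hessian does not depend on the basis. The wave equation then
  equates it with the second time derivative.\<close>

lemma trace_spatial:
  assumes X: "X \<in> cone" and w: "on_S3 w"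
  shows "D2 X e0 e0 = D2 X w w + D2 X (frame1 w) (frame1 w) + D2 X (frame2 w) (frame2 w) + D2 X (frame3 w) (frame3 w)"
proof -
  let ?r = "w$1 * w$1 + w$2 * w$2 + w$3 * w$3 + w$4 * w$4"
  have r: "?r = 1" "w$0 = 0" using w by (auto simp: on_S3_def mink_5)
  have "D2 X w w + D2 X (frame1 w) (frame1 w) + D2 X (frame2 w) (frame2 w) + D2 X (frame3 w) (frame3 w)
     = ?r *\<^sub>R (H2 1 1 X + H2 2 2 X + H2 3 3 X + H2 4 4 X)"
    by (simp add: D2_def sum_5 frame1_def frame2_def frame3_def r(2) algebra_simps)
  also have "\<dots> = H2 0 0 X" using box[OF X] r(1) by (simp add: sum_5 eta_def algebra_simps)
  also have "\<dots> = D2 X e0 e0" by (simp add: D2_def sum_5 axis_def)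
  finally show ?thesis by simp
qed

text \<open>The basis \<open>qv\<close>, \<open>qv'\<close>, \<open>tv\<close>, \<open>pv\<close>
  arises from that of \<open>trace_spatial\<close> by rotating the three frame vectors into
  \<open>nv\<close>, \<open>tv\<close>, \<open>pv\<close> and then turning by rho in the plane of
  \<open>w\<close> and \<open>nv\<close>.\<close>

lemma trace_sphere:
  assumes X: "X \<in> cone" and w: "on_S3 w"
  shows "D2 X e0 e0 = D2 X (qv w \<rho> p) (qv w \<rho> p) + D2 X (qv' w \<rho> p) (qv' w \<rho> p)
    + D2 X (tv w p) (tv w p) + D2 X (pv w p) (pv w p)"
proof -
  have "D2 X (nv w p) (nv w p) + D2 X (tv w p) (tv w p) + D2 X (pv w p) (pv w p) =
     D2 X (frame1 w) (frame1 w) + D2 X (frame2 w) (frame2 w) + D2 X (frame3 w) (frame3 w)"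
    by (simp add: nv_def tv_def pv_def D_linear)
       (simp add: algebra_simps sin_sin sin_sin_left)
  moreover have "D2 X (qv w \<rho> p) (qv w \<rho> p) + D2 X (qv' w \<rho> p) (qv' w \<rho> p) = D2 X w w + D2 X (nv w p) (nv w p)"
    by (simp add: qv_def qv'_def D_linear)
       (simp add: algebra_simps sin_sin sin_sin_left)
  ultimately show ?thesis using trace_spatial[OF X w] by (simp add: algebra_simps)
qed

end

section \<open>Kirchhoff's integrand along characteristics\<close>

context conformal_wave
begin

text \<open>The integrand of Kirchhoff's formula: the derivative in the direction (1, 1) of the (eta, rho)-plane of
  sin theta sin rho H(Yv).  Its derivative in the direction (-1, 1) is flux, which is a divergence on the 2-sphere.\<close>

definition kirch :: "real^5 \<Rightarrow> real \<Rightarrow> real \<Rightarrow> real \<times> real \<Rightarrow> complex" where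
  "kirch w \<eta> \<rho> p = sin (fst p) *\<^sub>R (D1 (Yv w \<eta> \<rho> p) (sin \<rho> *\<^sub>R (sin \<eta> *\<^sub>R e0 + qv' w \<rho> p)) + cos \<rho> *\<^sub>R H (Yv w \<eta> \<rho> p))"

definition flux :: "real^5 \<Rightarrow> real \<Rightarrow> real \<Rightarrow> real \<times> real \<Rightarrow> complex" where
  "flux w \<eta> \<rho> p = sin (fst p) *\<^sub>R (2 *\<^sub>R D1 (Yv w \<eta> \<rho> p) (nv w p)
     - sin \<rho> *\<^sub>R (D2 (Yv w \<eta> \<rho> p) (tv w p) (tv w p) + D2 (Yv w \<eta> \<rho> p) (pv w p) (pv w p)))"

definition flux_theta :: "real^5 \<Rightarrow> real \<Rightarrow> real \<Rightarrow> real \<times> real \<Rightarrow> complex" where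
  "flux_theta w \<eta> \<rho> p = - (sin (fst p) *\<^sub>R (sin \<rho> *\<^sub>R D2 (Yv w \<eta> \<rho> p) (tv w p) (tv w p) - D1 (Yv w \<eta> \<rho> p) (nv w p))
     + cos (fst p) *\<^sub>R D1 (Yv w \<eta> \<rho> p) (tv w p))"

definition flux_phi :: "real^5 \<Rightarrow> real \<Rightarrow> real \<Rightarrow> real \<times> real \<Rightarrow> complex" where
  "flux_phi w \<eta> \<rho> p = - ((sin \<rho> * sin (fst p)) *\<^sub>R D2 (Yv w \<eta> \<rho> p) (pv w p) (pv w p)
     - sin (fst p) *\<^sub>R D1 (Yv w \<eta> \<rho> p) (nv w p) - cos (fst p) *\<^sub>R D1 (Yv w \<eta> \<rho> p) (tv w p))"

text \<open>The two terms with cos theta, one from the area element and one from the turning of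
  \<open>pv\<close>, cancel.\<close>

lemma flux_split: "flux w \<eta> \<rho> p = flux_theta w \<eta> \<rho> p + flux_phi w \<eta> \<rho> p"
  by (simp add: flux_def flux_theta_def flux_phi_def algebra_simps scaleR_2)

text \<open>The abbreviations stand for derivatives of H at Yv: in it se, ce, sr, cr are the sines and cosines of eta and rho,
  h0, hq, a00, aqq, ... the first and second derivatives in the directions e0, qv, qv', tv, pv.\<close>

lemma characteristic_derivative_algebra:
  fixes h h0 hq hq' hn a00 aqq aq'q' aq0 att app :: complex and se ce sr cr :: real
  assumes box: "a00 = aqq + aq'q' + att + app"
    and e: "hq - ce *\<^sub>R h0 = - h" and eq: "aqq - ce *\<^sub>R aq0 = - 2 *\<^sub>R hq"
    and e0: "aq0 - ce *\<^sub>R a00 = - 2 *\<^sub>R h0"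
    and hn: "hn = sr *\<^sub>R hq + cr *\<^sub>R hq'"
    and s: "se * se = 1 - ce * ce"
  shows "sr *\<^sub>R (aq'q' - (se * se) *\<^sub>R a00 - ce *\<^sub>R h0 - hq - h) + (2 * cr) *\<^sub>R hq'
    = 2 *\<^sub>R hn - sr *\<^sub>R (att + app)"
proof -
  have "aqq = ce *\<^sub>R aq0 - 2 *\<^sub>R hq" using eq by (simp add: algebra_simps add_eq_0_iff)
  moreover have aq0: "aq0 = ce *\<^sub>R a00 - 2 *\<^sub>R h0" using e0 by (simp add: algebra_simps add_eq_0_iff)
  ultimately have aqq: "aqq = (ce * ce) *\<^sub>R a00 - (2 * ce) *\<^sub>R h0 - 2 *\<^sub>R hq" by (simp add: algebra_simps)
  have h: "h = ce *\<^sub>R h0 - hq" using e by (simp add: algebra_simps add_eq_0_iff)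
  have aq'q': "aq'q' = a00 - aqq - att - app" using box by simp
  show ?thesis
    unfolding aq'q' s h hn aqq by (simp add: scaleR_conv_of_real algebra_simps)
qed

text \<open>Along eta + rho = const the second derivatives in the directions \<open>e0\<close>,
  \<open>qv\<close> and \<open>qv'\<close> are removed by the wave equation and the Euler relations.
  What survives is, after multiplication by - sin rho, the Laplacian of H over the unit sphere of
  directions, with the weight sin theta.\<close>

lemma vd_kirch:
  assumes w: "on_S3 w" and h: "0 < \<eta>0 - \<tau>" "\<eta>0 - \<tau> < pi"
  shows "((\<lambda>\<tau>. kirch w (\<eta>0 - \<tau>) \<tau> p) has_vector_derivative flux w (\<eta>0 - \<tau>) \<tau> p) (at \<tau> within S)"
proof -
  define \<eta> where "\<eta> = \<eta>0 - \<tau>"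
  let ?Y = "Yv w \<eta> \<tau> p" and ?q = "qv w \<tau> p" and ?q' = "qv' w \<tau> p"
  have Y: "?Y \<in> cone" using Yv_in_cone[OF w h] by (simp add: \<eta>_def)
  have y: "((\<lambda>\<tau>. Yv w (\<eta>0 - \<tau>) \<tau> p) has_vector_derivative (?q' - sin \<eta> *\<^sub>R e0)) (at \<tau> within S)"
  proof -
    have "((\<lambda>\<tau>. - (cos (\<eta>0 - \<tau>) *\<^sub>R e0)) has_vector_derivative - (sin \<eta> *\<^sub>R e0)) (at \<tau> within S)"
      unfolding has_vector_derivative_def \<eta>_def by (auto intro!: derivative_eq_intros)
    from has_vector_derivative_add[OF vd_qv this] show ?thesis by (simp add: Yv_def)
  qed
  have v: "((\<lambda>\<tau>. sin \<tau> *\<^sub>R (sin (\<eta>0 - \<tau>) *\<^sub>R e0 + qv' w \<tau> p)) has_vector_derivative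
     (sin \<tau> *\<^sub>R (- cos \<eta> *\<^sub>R e0 - ?q) + cos \<tau> *\<^sub>R (sin \<eta> *\<^sub>R e0 + ?q'))) (at \<tau> within S)"
  proof -
    have "((\<lambda>\<tau>. sin (\<eta>0 - \<tau>) *\<^sub>R e0) has_vector_derivative - cos \<eta> *\<^sub>R e0) (at \<tau> within S)"
      unfolding has_vector_derivative_def \<eta>_def by (auto intro!: derivative_eq_intros)
    from has_vector_derivative_add[OF this vd_qv'[of w p \<tau> S]]
    have 1: "((\<lambda>\<tau>. sin (\<eta>0 - \<tau>) *\<^sub>R e0 + qv' w \<tau> p) has_vector_derivative - cos \<eta> *\<^sub>R e0 - ?q) (at \<tau> within S)"
      by simp
    have "(sin has_field_derivative cos \<tau>) (at \<tau> within S)" by (auto intro!: derivative_eq_intros)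
    from has_vector_derivative_scaleR[OF this 1] show ?thesis by (simp add: \<eta>_def)
  qed
  have "Yv w (\<eta>0 - \<tau>) \<tau> p \<in> cone" using Y by (simp add: \<eta>_def)
  note D = D1_along_curve[OF y this v]
  have c: "((\<lambda>\<tau>. cos \<tau> *\<^sub>R H (Yv w (\<eta>0 - \<tau>) \<tau> p)) has_vector_derivative
     (cos \<tau> *\<^sub>R D1 ?Y (?q' - sin \<eta> *\<^sub>R e0) + (- sin \<tau>) *\<^sub>R H ?Y)) (at \<tau> within S)"
    using H_along_curve[OF y] Y unfolding \<eta>_def
    by (intro has_vector_derivative_scaleR) (auto intro!: derivative_eq_intros)
  have YY: "?Y = ?q - cos \<eta> *\<^sub>R e0" by (simp add: Yv_def)
  have E: "D1 ?Y ?q - cos \<eta> *\<^sub>R D1 ?Y e0 = - H ?Y" using euler[OF Y] by (simp add: YY D_linear)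
  have E1: "D2 ?Y v ?q - cos \<eta> *\<^sub>R D2 ?Y v e0 = - 2 *\<^sub>R D1 ?Y v" for v
    using euler1[OF Y, of v] by (simp add: YY D_linear)
  \<comment> \<open>Undoing the rotation by the angle \<tau> in the plane of \<open>w\<close> and
    \<open>nv w p\<close>.\<close>
  have nn: "nv w p = sin \<tau> *\<^sub>R ?q + cos \<tau> *\<^sub>R ?q'"
    by (simp add: qv_def qv'_def algebra_simps sin_sin sin_sin_left)
  have alg: "sin \<tau> *\<^sub>R (D2 ?Y ?q' ?q' - (sin \<eta> * sin \<eta>) *\<^sub>R D2 ?Y e0 e0 - cos \<eta> *\<^sub>R D1 ?Y e0 - D1 ?Y ?q - H ?Y) + (2 * cos \<tau>) *\<^sub>R D1 ?Y ?q'
    = 2 *\<^sub>R D1 ?Y (nv w p) - sin \<tau> *\<^sub>R (D2 ?Y (tv w p) (tv w p) + D2 ?Y (pv w p) (pv w p))"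
    by (rule characteristic_derivative_algebra[OF trace_sphere[OF Y w] E])
       (use E1[of ?q] E1[of e0] D2_sym[OF Y, of ?q e0] in \<open>simp_all add: nn D_linear sin_sin\<close>)
  have "D2 ?Y (sin \<tau> *\<^sub>R (sin \<eta> *\<^sub>R e0 + ?q')) (?q' - sin \<eta> *\<^sub>R e0)
     + D1 ?Y (sin \<tau> *\<^sub>R (- cos \<eta> *\<^sub>R e0 - ?q) + cos \<tau> *\<^sub>R (sin \<eta> *\<^sub>R e0 + ?q'))
     + (cos \<tau> *\<^sub>R D1 ?Y (?q' - sin \<eta> *\<^sub>R e0) + (- sin \<tau>) *\<^sub>R H ?Y) =
     sin \<tau> *\<^sub>R (D2 ?Y ?q' ?q' - (sin \<eta> * sin \<eta>) *\<^sub>R D2 ?Y e0 e0 - cos \<eta> *\<^sub>R D1 ?Y e0 - D1 ?Y ?q - H ?Y) + (2 * cos \<tau>) *\<^sub>R D1 ?Y ?q'"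
    using D2_sym[OF Y, of ?q' e0] by (simp add: D_linear) (simp add: scaleR_conv_of_real algebra_simps)
  note alg' = this[unfolded alg]
  have "((\<lambda>\<tau>. sin (fst p) *\<^sub>R (D1 (Yv w (\<eta>0 - \<tau>) \<tau> p) (sin \<tau> *\<^sub>R (sin (\<eta>0 - \<tau>) *\<^sub>R e0 + qv' w \<tau> p)) + cos \<tau> *\<^sub>R H (Yv w (\<eta>0 - \<tau>) \<tau> p)))
     has_vector_derivative sin (fst p) *\<^sub>R (2 *\<^sub>R D1 ?Y (nv w p) - sin \<tau> *\<^sub>R (D2 ?Y (tv w p) (tv w p) + D2 ?Y (pv w p) (pv w p)))) (at \<tau> within S)"
    using bounded_linear.has_vector_derivative[OF bounded_linear_scaleR_right has_vector_derivative_add[OF D c]] alg'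
    unfolding \<eta>_def by simp
  then show ?thesis unfolding kirch_def flux_def \<eta>_def .
qed

lemma vd_flux_theta:
  assumes w: "on_S3 w" and h: "0 < \<eta>" "\<eta> < pi"
  shows "((\<lambda>\<theta>. - (sin \<theta> *\<^sub>R D1 (Yv w \<eta> \<rho> (\<theta>, \<phi>)) (tv w (\<theta>, \<phi>)))) has_vector_derivative flux_theta w \<eta> \<rho> (\<theta>, \<phi>)) (at \<theta> within S)"
  unfolding flux_theta_def
  using D1_along_curve[OF vd_Yv_theta Yv_in_cone[OF w h] vd_tv_theta]
  by (intro has_vector_derivative_minus, simp only: fst_conv, intro has_vector_derivative_scaleR)
     (auto intro!: derivative_eq_intros simp: D_linear)

lemma vd_flux_phi:
  assumes w: "on_S3 w" and h: "0 < \<eta>" "\<eta> < pi"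
  shows "((\<lambda>\<phi>. - D1 (Yv w \<eta> \<rho> (\<theta>, \<phi>)) (pv w (\<theta>, \<phi>))) has_vector_derivative flux_phi w \<eta> \<rho> (\<theta>, \<phi>)) (at \<phi> within S)"
  unfolding flux_phi_def
  using D1_along_curve[OF vd_Yv_phi Yv_in_cone[OF w h] vd_pv_phi]
  by (intro has_vector_derivative_minus) (simp add: D_linear algebra_simps)

lemma cont_flux:
  fixes S :: "'a::t2_space set"
  assumes w: "on_S3 w" and c: "continuous_on S e" "continuous_on S r" "continuous_on S f"
    and h: "\<And>x. x \<in> S \<Longrightarrow> 0 < e x \<and> e x < pi"
  shows "continuous_on S (\<lambda>x. kirch w (e x) (r x) (f x))" "continuous_on S (\<lambda>x. flux w (e x) (r x) (f x))"
    "continuous_on S (\<lambda>x. flux_theta w (e x) (r x) (f x))" "continuous_on S (\<lambda>x. flux_phi w (e x) (r x) (f x))"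
proof -
  have Y: "(\<lambda>x. Yv w (e x) (r x) (f x)) ` S \<subseteq> cone" using h by (auto intro!: Yv_in_cone[OF w])
  show "continuous_on S (\<lambda>x. kirch w (e x) (r x) (f x))" "continuous_on S (\<lambda>x. flux w (e x) (r x) (f x))"
    "continuous_on S (\<lambda>x. flux_theta w (e x) (r x) (f x))" "continuous_on S (\<lambda>x. flux_phi w (e x) (r x) (f x))"
    unfolding kirch_def flux_def flux_theta_def flux_phi_def
    by (intro continuous_intros c cont_D1 cont_D2 cont_H Y)+
qed

text \<open>The divergence theorem on the 2-sphere: the phi part integrates to zero by periodicity,
  the theta part because its primitive carries the factor sin theta, which vanishes at both
  poles.\<close>

lemma integral_flux:
  assumes w: "on_S3 w" and h: "0 < \<eta>" "\<eta> < pi"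
  shows "integral sph (flux w \<eta> \<rho>) = 0"
proof -
  have ct: "continuous_on sph (flux_theta w \<eta> \<rho>)" and cp: "continuous_on sph (flux_phi w \<eta> \<rho>)"
    using cont_flux(3,4)[OF w, of sph "\<lambda>_. \<eta>" "\<lambda>_. \<rho>" "\<lambda>p. p"] h by (auto simp: continuous_on_id)
  have "integral sph (flux_phi w \<eta> \<rho>) = integral (cbox 0 pi) (\<lambda>\<theta>. integral (cbox 0 (2*pi)) (\<lambda>\<phi>. flux_phi w \<eta> \<rho> (\<theta>, \<phi>)))"
    by (rule integral_prod_continuous[OF cp])
  also have "\<dots> = integral (cbox 0 pi) (\<lambda>\<theta>. 0)"
  proof (rule Henstock_Kurzweil_Integration.integral_cong)
    fix \<theta> :: real
    have "((\<lambda>\<phi>. flux_phi w \<eta> \<rho> (\<theta>, \<phi>)) has_integral (- D1 (Yv w \<eta> \<rho> (\<theta>, 2*pi)) (pv w (\<theta>, 2*pi)) - - D1 (Yv w \<eta> \<rho> (\<theta>, 0)) (pv w (\<theta>, 0)))) {0..2*pi}"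
      by (rule fundamental_theorem_of_calculus) (auto intro: vd_flux_phi[OF w h])
    then show "integral (cbox 0 (2*pi)) (\<lambda>\<phi>. flux_phi w \<eta> \<rho> (\<theta>, \<phi>)) = 0"
      by (simp add: integral_unique Yv_def qv_def nv_def pv_def)
  qed
  finally have p0: "integral sph (flux_phi w \<eta> \<rho>) = 0" by simp
  have "integral sph (flux_theta w \<eta> \<rho>) = integral (cbox 0 pi) (\<lambda>\<theta>. integral (cbox 0 (2*pi)) (\<lambda>\<phi>. flux_theta w \<eta> \<rho> (\<theta>, \<phi>)))"
    by (rule integral_prod_continuous[OF ct])
  \<comment> \<open>The primitive is one in theta, so the order of integration is exchanged.\<close>
  also have "\<dots> = integral (cbox 0 (2*pi)) (\<lambda>\<phi>. integral (cbox 0 pi) (\<lambda>\<theta>. flux_theta w \<eta> \<rho> (\<theta>, \<phi>)))"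
    by (rule integral_swap_continuous) (use ct in simp)
  also have "\<dots> = integral (cbox 0 (2*pi)) (\<lambda>\<phi>. 0)"
  proof (rule Henstock_Kurzweil_Integration.integral_cong)
    fix \<phi> :: real
    have "((\<lambda>\<theta>. flux_theta w \<eta> \<rho> (\<theta>, \<phi>)) has_integral (- (sin pi *\<^sub>R D1 (Yv w \<eta> \<rho> (pi, \<phi>)) (tv w (pi, \<phi>)))
         - - (sin 0 *\<^sub>R D1 (Yv w \<eta> \<rho> (0, \<phi>)) (tv w (0, \<phi>))))) {0..pi}"
      by (rule fundamental_theorem_of_calculus) (auto intro: vd_flux_theta[OF w h])
    then show "integral (cbox 0 pi) (\<lambda>\<theta>. flux_theta w \<eta> \<rho> (\<theta>, \<phi>)) = 0"
      by (simp add: integral_unique)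
  qed
  finally have t0: "integral sph (flux_theta w \<eta> \<rho>) = 0" by simp
  have "integral sph (flux w \<eta> \<rho>) = integral sph (\<lambda>p. flux_theta w \<eta> \<rho> p + flux_phi w \<eta> \<rho> p)"
    by (simp add: flux_split[abs_def])
  also have "\<dots> = 0"
    using t0 p0 integrable_continuous[OF ct] integrable_continuous[OF cp]
    by (simp add: Henstock_Kurzweil_Integration.integral_add)
  finally show ?thesis .
qed

definition kirchhoff :: "real^5 \<Rightarrow> real \<Rightarrow> real \<Rightarrow> complex" where
  "kirchhoff w \<eta> \<rho> = integral sph (kirch w \<eta> \<rho>)"

lemma kirchhoff_characteristic:
  assumes w: "on_S3 w" and h: "0 < \<eta>" "\<eta> < pi" "0 < \<eta>'" "\<eta>' < pi" and eq: "\<eta> + \<rho> = \<eta>' + \<rho>'"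
  shows "kirchhoff w \<eta> \<rho> = kirchhoff w \<eta>' \<rho>'"
proof -
  define s where "s = \<eta> + \<rho>"
  \<comment> \<open>The values of \<tau> for which the time \<open>s - \<tau>\<close> stays strictly
    between 0 and pi. This is an interval, so a zero derivative makes the integral constant on it;
    the radius itself may have any sign and size.\<close>
  let ?U = "{s - pi<..<s}"
  have "((\<lambda>\<tau>. integral sph (kirch w (s - \<tau>) \<tau>)) has_vector_derivative 0) (at \<tau>0 within ?U)" if t: "\<tau>0 \<in> ?U" for \<tau>0
  proof -
    have "((\<lambda>\<tau>. integral sph (kirch w (s - \<tau>) \<tau>)) has_vector_derivative integral sph (flux w (s - \<tau>0) \<tau>0)) (at \<tau>0 within ?U)"
    proof (rule leibniz_rule_vector_derivative)
      show "((\<lambda>\<tau>. kirch w (s - \<tau>) \<tau> p) has_vector_derivative flux w (s - \<tau>) \<tau> p) (at \<tau> within ?U)" if "\<tau> \<in> ?U" for \<tau> p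
        using that by (intro vd_kirch w) auto
      show "kirch w (s - \<tau>) \<tau> integrable_on sph" if "\<tau> \<in> ?U" for \<tau>
        by (rule integrable_continuous, rule cont_flux(1)[OF w]) (use that in \<open>auto intro!: continuous_intros\<close>)
      show "continuous_on (?U \<times> sph) (\<lambda>(\<tau>, p). flux w (s - \<tau>) \<tau> p)"
        unfolding split_beta by (rule cont_flux(2)[OF w]) (auto intro!: continuous_intros)
    qed (use t in auto)
    then show ?thesis using integral_flux[OF w, of "s - \<tau>0" \<tau>0] t by simp
  qed
  then obtain c where "\<And>\<tau>. \<tau> \<in> ?U \<Longrightarrow> integral sph (kirch w (s - \<tau>) \<tau>) = c"
    using has_vector_derivative_zero_constant[of ?U "\<lambda>\<tau>. integral sph (kirch w (s - \<tau>) \<tau>)"] by auto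
  from this[of \<rho>] this[of \<rho>'] have "integral sph (kirch w (s - \<rho>) \<rho>) = integral sph (kirch w (s - \<rho>') \<rho>')"
    using h eq by (simp add: s_def)
  moreover have "s - \<rho> = \<eta>" "s - \<rho>' = \<eta>'" using eq by (simp_all add: s_def)
  ultimately show ?thesis by (simp add: kirchhoff_def)
qed

end

section \<open>Boundary values on the Einstein cylinder\<close>

lemma qv'_eq: "qv' w \<rho> p = qv w (\<rho> + pi/2) p"
  by (simp add: qv_def qv'_def cos_add sin_add)

lemma norm_on_S3: "on_S3 w \<Longrightarrow> norm w = 1"
  by (auto simp: on_S3_def norm_eq_sqrt_inner inner_vec_def mink_5 sum_5)

lemma on_S3_minus: "on_S3 w \<Longrightarrow> on_S3 (- w)"
  by (simp add: on_S3_def mink_linear)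

lemma compact_S3: "compact (Collect on_S3)"
proof -
  have "closed (Collect on_S3)"
    unfolding on_S3_def mink_5 by (intro closed_Collect_conj closed_Collect_eq continuous_intros)
  moreover have "bounded (Collect on_S3)"
    by (rule boundedI[of _ 1]) (simp add: norm_on_S3)
  ultimately show ?thesis by (simp add: compact_eq_bounded_closed)
qed

lemma S3_subset_cone: "Collect on_S3 \<subseteq> cone"
  by (auto simp: on_S3_def cone_def)

context conformal_wave
begin

text \<open>Kirchhoff's integral depends only on t = eta + rho, so it is read off on the slice eta =
  pi/2. As the radius t - pi/2 is arbitrary, this gives a function on the whole line, which extends
  the wave beyond 0 < t < pi.\<close>

definition ucyl :: "real^5 \<Rightarrow> real \<Rightarrow> complex" where
  "ucyl w t = kirchhoff w (pi/2) (t - pi/2)"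

lemma kirchhoff_ucyl:
  assumes "on_S3 w" "0 < \<eta>" "\<eta> < pi"
  shows "kirchhoff w \<eta> \<rho> = ucyl w (\<eta> + \<rho>)"
  unfolding ucyl_def by (rule kirchhoff_characteristic[OF assms(1)]) (use assms in auto)

lemma integral_sin_sph: "integral sph (\<lambda>p. sin (fst p) *\<^sub>R c) = (4 * pi) *\<^sub>R (c :: complex)"
proof -
  have "integral sph (\<lambda>p. sin (fst p) *\<^sub>R c) = integral (cbox 0 pi) (\<lambda>\<theta>. integral (cbox 0 (2*pi)) (\<lambda>\<phi>. sin (fst (\<theta>, \<phi>)) *\<^sub>R c))"
    by (rule integral_prod_continuous) (intro continuous_intros)
  also have "\<dots> = integral {0..pi} (\<lambda>\<theta>. sin \<theta> *\<^sub>R (2 * pi) *\<^sub>R c)" by (simp add: mult.commute)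
  also have "\<dots> = (- cos pi - - cos 0) *\<^sub>R (2 * pi) *\<^sub>R c"
  proof -
    have "(sin has_integral (- cos pi - - cos 0)) {0..pi}"
      by (rule fundamental_theorem_of_calculus)
        (auto intro!: derivative_eq_intros simp flip: has_real_derivative_iff_has_vector_derivative)
    then show ?thesis by (intro integral_unique has_integral_scaleR_left)
  qed
  finally show ?thesis by simp
qed

lemma kirchhoff_0: "kirchhoff w \<eta> 0 = (4 * pi) *\<^sub>R H (w - cos \<eta> *\<^sub>R e0)"
  unfolding kirchhoff_def
  by (subst integral_sin_sph[symmetric]) (simp add: kirch_def[abs_def] Yv_def qv_def D_linear)

text \<open>At radius pi the sphere has shrunk to the antipode of \<open>w\<close>; the factor cos
  pi = -1 is the origin of the sign that relates future to past.\<close>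

lemma kirchhoff_pi: "kirchhoff w \<eta> pi = - ((4 * pi) *\<^sub>R H (- w - cos \<eta> *\<^sub>R e0))"
  unfolding kirchhoff_def
  by (subst integral_sin_sph[symmetric]) (simp add: kirch_def[abs_def] Yv_def qv_def D_linear)

lemma cont_ucyl: assumes "on_S3 w" shows "continuous_on S (ucyl w)"
proof -
  have "continuous_on UNIV (\<lambda>t. integral sph (kirch w (pi/2) (t - pi/2)))"
    by (rule integral_continuous_on_param, unfold split_beta, rule cont_flux(1)[OF assms])
       (auto intro!: continuous_intros)
  then show ?thesis unfolding ucyl_def kirchhoff_def by (rule continuous_on_subset) simp
qed

text \<open>All spheres used by \<open>ucyl\<close> lie in the slice eta = pi/2, which is the
  compact 3-sphere itself inside the cone. Uniformity in \<open>w\<close> and t supplies the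
  dominating constant in \<open>Wmean_tendsto_0\<close>.\<close>

lemma ucyl_bounded: "\<exists>M. \<forall>w t. on_S3 w \<longrightarrow> norm (ucyl w t) \<le> M"
proof -
  have "bounded (H ` Collect on_S3)" "\<And>a. bounded (H1 a ` Collect on_S3)"
    using contH contH1 compact_S3 S3_subset_cone
    by (meson compact_continuous_image compact_imp_bounded continuous_on_subset)+
  then have "\<exists>B0. \<forall>X. on_S3 X \<longrightarrow> norm (H X) \<le> B0" "\<forall>a. \<exists>B. \<forall>X. on_S3 X \<longrightarrow> norm (H1 a X) \<le> B"
    by (auto simp: bounded_iff)
  then obtain B0 B1 where "\<forall>X. on_S3 X \<longrightarrow> norm (H X) \<le> B0" "\<forall>a X. on_S3 X \<longrightarrow> norm (H1 a X) \<le> B1 a"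
    by (auto dest!: choice)
  then have B: "\<And>X. on_S3 X \<Longrightarrow> norm (H X) \<le> B0" "\<And>X a. on_S3 X \<Longrightarrow> norm (H1 a X) \<le> B1 a"
    by auto
  \<comment> \<open>The 2 bounds the norm of \<open>e0 + qv' w \<rho> p\<close>, a sum of two unit
    vectors.\<close>
  define B where "B = 2 * (\<Sum>a\<in>UNIV. B1 a) + B0"
  have "norm (kirch w (pi/2) \<rho> p) \<le> B" if w: "on_S3 w" for w \<rho> p
  proof -
    let ?Y = "qv w \<rho> p" and ?v = "sin \<rho> *\<^sub>R (e0 + qv' w \<rho> p)"
    have Y: "on_S3 ?Y" by (rule on_S3_qv[OF w])
    have "norm ?v \<le> 1 * norm (e0 + qv' w \<rho> p)" unfolding norm_scaleR by (intro mult_right_mono) auto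
    also have "\<dots> \<le> 1 + 1" using norm_triangle_ineq[of e0 "qv' w \<rho> p"] by (simp add: qv'_eq norm_on_S3 on_S3_qv w)
    finally have v: "norm ?v \<le> 2" by simp
    have "norm (D1 ?Y ?v) \<le> (\<Sum>a\<in>UNIV. norm (?v $ a *\<^sub>R H1 a ?Y))" unfolding D1_def by (rule norm_sum)
    also have "\<dots> \<le> (\<Sum>a\<in>UNIV. 2 * B1 a)"
      unfolding norm_scaleR by (intro sum_mono mult_mono B Y order_trans[OF _ v] component_le_norm_cart) auto
    finally have 1: "norm (D1 ?Y ?v) \<le> 2 * (\<Sum>a\<in>UNIV. B1 a)" by (simp add: sum_distrib_left)
    have 2: "norm (cos \<rho> *\<^sub>R H ?Y) \<le> B0"
      using mult_mono[of "\<bar>cos \<rho>\<bar>" 1 "norm (H ?Y)" B0] B(1)[OF Y] by simp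
    have "norm (kirch w (pi/2) \<rho> p) \<le> 1 * norm (D1 ?Y ?v + cos \<rho> *\<^sub>R H ?Y)"
      unfolding kirch_def Yv_def norm_scaleR by (intro mult_mono) auto
    also have "\<dots> \<le> B" using norm_triangle_ineq[of "D1 ?Y ?v" "cos \<rho> *\<^sub>R H ?Y"] 1 2 by (simp add: B_def)
    finally show ?thesis .
  qed
  note k = this
  have "norm (ucyl w t) \<le> B * measure lborel sph" if w: "on_S3 w" for w t
    unfolding ucyl_def kirchhoff_def
  proof (rule has_integral_bound)
    show "(kirch w (pi/2) (t - pi/2) has_integral integral sph (kirch w (pi/2) (t - pi/2))) sph"
      by (intro integrable_integral integrable_continuous cont_flux(1)[OF w]) (auto intro!: continuous_intros)
    show "norm (kirch w (pi/2) (t - pi/2) x) \<le> B" for x by (rule k[OF w])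
    show "0 \<le> B" using k[OF w] norm_ge_zero order_trans by blast
  qed
  then show ?thesis by blast
qed

definition past :: "real^5 \<Rightarrow> complex" where "past w = inverse (4 * pi) *\<^sub>R ucyl w 0"
definition future :: "real^5 \<Rightarrow> complex" where "future w = inverse (4 * pi) *\<^sub>R ucyl w pi"

lemma H_ucyl:
  assumes "on_S3 w" "0 < \<eta>" "\<eta> < pi"
  shows "H (w - cos \<eta> *\<^sub>R e0) = inverse (4 * pi) *\<^sub>R ucyl w \<eta>"
proof -
  have "ucyl w \<eta> = (4 * pi) *\<^sub>R H (w - cos \<eta> *\<^sub>R e0)"
    using kirchhoff_ucyl[OF assms, of 0] by (simp add: kirchhoff_0)
  then show ?thesis by (simp del: scaleR_scaleR inverse_mult_distrib) (simp add: field_simps)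
qed

lemma H_slice:
  assumes "on_S3 w" "-1 < c" "c < 1"
  shows "H (w + c *\<^sub>R e0) = inverse (4 * pi) *\<^sub>R ucyl w (arccos (- c))"
  using H_ucyl[OF assms(1), of "arccos (- c)"] arccos_lt_bounded[of "- c"] assms by simp

lemma cont_slice:
  assumes "on_S3 w"
  shows "continuous_on {-1..1} (\<lambda>c. inverse (4 * pi) *\<^sub>R ucyl w (arccos (- c)))"
  by (intro continuous_intros continuous_on_compose2[OF cont_ucyl[OF assms, of UNIV]] continuous_on_arccos) auto

lemma tendsto_past:
  assumes "on_S3 w"
  shows "((\<lambda>c. H (w + c *\<^sub>R e0)) \<longlongrightarrow> past w) (at_right (-1))"
proof -
  have "((\<lambda>c. inverse (4 * pi) *\<^sub>R ucyl w (arccos (- c))) \<longlongrightarrow> inverse (4 * pi) *\<^sub>R ucyl w (arccos (- (-1)))) (at (-1) within {-1..1})"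
    using cont_slice[OF assms] unfolding continuous_on_def by (auto dest: bspec[of _ _ "-1"])
  then have "((\<lambda>c. inverse (4 * pi) *\<^sub>R ucyl w (arccos (- c))) \<longlongrightarrow> past w) (at_right (-1))"
    by (simp add: past_def at_within_Icc_at_right)
  then show ?thesis
  proof (rule tendsto_cong[THEN iffD1, rotated])
    show "\<forall>\<^sub>F c in at_right (-1). inverse (4 * pi) *\<^sub>R ucyl w (arccos (- c)) = H (w + c *\<^sub>R e0)"
      unfolding eventually_at_right_field by (rule exI[of _ 0]) (simp add: H_slice[OF assms])
  qed
qed

lemma tendsto_future:
  assumes "on_S3 w"
  shows "((\<lambda>c. H (w + c *\<^sub>R e0)) \<longlongrightarrow> future w) (at_left 1)"
proof -
  have "((\<lambda>c. inverse (4 * pi) *\<^sub>R ucyl w (arccos (- c))) \<longlongrightarrow> inverse (4 * pi) *\<^sub>R ucyl w (arccos (- 1))) (at 1 within {-1..1})"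
    using cont_slice[OF assms] unfolding continuous_on_def by (auto dest: bspec[of _ _ 1])
  then have "((\<lambda>c. inverse (4 * pi) *\<^sub>R ucyl w (arccos (- c))) \<longlongrightarrow> future w) (at_left 1)"
    by (simp add: future_def at_within_Icc_at_left)
  then show ?thesis
  proof (rule tendsto_cong[THEN iffD1, rotated])
    show "\<forall>\<^sub>F c in at_left 1. inverse (4 * pi) *\<^sub>R ucyl w (arccos (- c)) = H (w + c *\<^sub>R e0)"
      unfolding eventually_at_left_field by (rule exI[of _ 0]) (simp add: H_slice[OF assms])
  qed
qed

text \<open>Kirchhoff's integral at rho = pi: the wave emitted at \<open>w\<close> refocuses at the
  antipode with reversed sign.\<close>

lemma ucyl_antiperiodic:
  assumes "on_S3 w" "0 < \<eta>" "\<eta> < pi"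
  shows "ucyl w (\<eta> + pi) = - ucyl (- w) \<eta>"
  using kirchhoff_ucyl[OF assms, of pi] H_ucyl[OF on_S3_minus[OF assms(1)] assms(2,3)]
  by (simp add: kirchhoff_pi)

text \<open>The limit eta to 0 of \<open>ucyl_antiperiodic\<close>, which itself holds only strictly
  between 0 and pi; \<open>ucyl\<close> is continuous on the whole line.\<close>

lemma future_eq_minus_past_antipode:
  assumes w: "on_S3 w"
  shows "future w = - past (- w)"
proof -
  have lim: "((\<lambda>\<eta>. ucyl w (\<eta> + pi)) \<longlongrightarrow> ucyl w (0 + pi)) (at_right 0)"
    by (intro isCont_tendsto_compose[of _ "ucyl w"] tendsto_intros)
       (use cont_ucyl[OF w, of UNIV] in \<open>simp add: continuous_on_eq_continuous_at\<close>)
  have "((\<lambda>\<eta>. - ucyl (- w) \<eta>) \<longlongrightarrow> - ucyl (- w) 0) (at_right 0)"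
    by (intro isCont_tendsto_compose[of _ "ucyl (- w)"] tendsto_intros)
       (use cont_ucyl[OF on_S3_minus[OF w], of UNIV] in \<open>simp add: continuous_on_eq_continuous_at\<close>)
  moreover have "\<forall>\<^sub>F \<eta> in at_right 0. - ucyl (- w) \<eta> = ucyl w (\<eta> + pi)"
    unfolding eventually_at_right_field by (rule exI[of _ pi]) (simp add: ucyl_antiperiodic[OF w])
  ultimately have "((\<lambda>\<eta>. ucyl w (\<eta> + pi)) \<longlongrightarrow> - ucyl (- w) 0) (at_right 0)"
    by (simp add: tendsto_cong)
  with lim have "ucyl w (0 + pi) = - ucyl (- w) 0"
    by (intro tendsto_unique[OF trivial_limit_at_right_real])
  then show ?thesis by (simp add: past_def future_def)
qed

text \<open>By d'Alembert's formula Wmean is half the difference of a primitive of ucyl at eta + rho and eta - rho.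
  If the waves vanish at eta = pi, so does Wmean, which makes ucyl odd about pi.\<close>

definition Wmean :: "real^5 \<Rightarrow> real \<Rightarrow> real \<Rightarrow> complex" where
  "Wmean w \<eta> \<rho> = integral sph (\<lambda>p. sin (fst p) *\<^sub>R sin \<rho> *\<^sub>R H (Yv w \<eta> \<rho> p))"

text \<open>With eta - rho fixed the derivative is in the direction (1, 1), in which the integrand
  of \<open>Wmean\<close> has derivative \<open>kirch\<close> by construction.\<close>

lemma vd_Wmean:
  assumes w: "on_S3 w" and t: "\<tau>0 \<in> {0..\<rho>}" and \<eta>0: "0 < \<eta>0" "\<eta>0 + \<rho> < pi"
  shows "((\<lambda>\<tau>. Wmean w (\<eta>0 + \<tau>) \<tau>) has_vector_derivative ucyl w (\<eta>0 + 2 * \<tau>0)) (at \<tau>0 within {0..\<rho>})"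
proof -
  have "((\<lambda>\<tau>. integral sph (\<lambda>p. sin (fst p) *\<^sub>R sin \<tau> *\<^sub>R H (Yv w (\<eta>0 + \<tau>) \<tau> p))) has_vector_derivative
      integral sph (kirch w (\<eta>0 + \<tau>0) \<tau>0)) (at \<tau>0 within {0..\<rho>})"
  proof (rule leibniz_rule_vector_derivative)
    fix \<tau> p assume t: "\<tau> \<in> {0..\<rho>}"
    have C: "Yv w (\<eta>0 + \<tau>) \<tau> p \<in> cone" using t \<eta>0 by (intro Yv_in_cone w) auto
    have "((\<lambda>\<tau>. - (cos (\<eta>0 + \<tau>) *\<^sub>R e0)) has_vector_derivative sin (\<eta>0 + \<tau>) *\<^sub>R e0) (at \<tau> within {0..\<rho>})"
      unfolding has_vector_derivative_def by (auto intro!: derivative_eq_intros)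
    from has_vector_derivative_add[OF vd_qv this]
    have y: "((\<lambda>\<tau>. Yv w (\<eta>0 + \<tau>) \<tau> p) has_vector_derivative qv' w \<tau> p + sin (\<eta>0 + \<tau>) *\<^sub>R e0) (at \<tau> within {0..\<rho>})"
      by (simp add: Yv_def)
    have "(sin has_field_derivative cos \<tau>) (at \<tau> within {0..\<rho>})" by (auto intro!: derivative_eq_intros)
    note has_vector_derivative_scaleR[OF this H_along_curve[OF y C]]
    from bounded_linear.has_vector_derivative[OF bounded_linear_scaleR_right[of "sin (fst p)"] this]
    show "((\<lambda>\<tau>. sin (fst p) *\<^sub>R sin \<tau> *\<^sub>R H (Yv w (\<eta>0 + \<tau>) \<tau> p)) has_vector_derivative kirch w (\<eta>0 + \<tau>) \<tau> p) (at \<tau> within {0..\<rho>})"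
      by (simp add: kirch_def D_linear add_ac)
  next
    fix \<tau> assume t: "\<tau> \<in> {0..\<rho>}"
    have "(\<lambda>p. Yv w (\<eta>0 + \<tau>) \<tau> p) ` sph \<subseteq> cone" using t \<eta>0 by (auto intro!: Yv_in_cone w)
    then show "(\<lambda>p. sin (fst p) *\<^sub>R sin \<tau> *\<^sub>R H (Yv w (\<eta>0 + \<tau>) \<tau> p)) integrable_on sph"
      by (intro integrable_continuous continuous_intros cont_H)
  next
    show "continuous_on ({0..\<rho>} \<times> sph) (\<lambda>(\<tau>, p). kirch w (\<eta>0 + \<tau>) \<tau> p)"
      unfolding split_beta by (rule cont_flux(1)[OF w]) (use \<eta>0 in \<open>auto intro!: continuous_intros\<close>)
  qed (use t in auto)
  then show ?thesis
    using kirchhoff_ucyl[OF w, of "\<eta>0 + \<tau>0" \<tau>0] t \<eta>0 by (simp add: Wmean_def kirchhoff_def add.assoc)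
qed

text \<open>The argument of \<open>ucyl\<close> in \<open>vd_Wmean\<close> moves twice as fast as
  the radius, whence the factor 2. The constant of integration is fixed at radius 0, where
  \<open>Wmean\<close> vanishes.\<close>

lemma Wmean_eq_integral:
  assumes w: "on_S3 w" and \<eta>0: "0 < \<eta>0" "0 \<le> \<rho>" "\<eta>0 + \<rho> < pi"
  shows "2 *\<^sub>R Wmean w (\<eta>0 + \<rho>) \<rho> = integral {0..\<eta>0 + 2 * \<rho>} (ucyl w) - integral {0..\<eta>0} (ucyl w)"
proof -
  define Q where "Q x = integral {0..x} (ucyl w)" for x
  have Q: "(Q has_vector_derivative ucyl w x) (at x within {0..2*pi})" if "x \<in> {0..2*pi}" for x
    unfolding Q_def using integral_has_vector_derivative[OF cont_ucyl[OF w] that] .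
  have "((\<lambda>\<tau>. Q (\<eta>0 + 2 * \<tau>) - 2 *\<^sub>R Wmean w (\<eta>0 + \<tau>) \<tau>) has_vector_derivative 0) (at \<tau> within {0..\<rho>})"
    if t: "\<tau> \<in> {0..\<rho>}" for \<tau>
  proof -
    have "((\<lambda>\<tau>. \<eta>0 + 2 * \<tau>) has_vector_derivative 2) (at \<tau> within {0..\<rho>})"
      by (auto intro!: derivative_eq_intros simp: has_vector_derivative_def)
    moreover have "(Q has_vector_derivative ucyl w (\<eta>0 + 2 * \<tau>)) (at (\<eta>0 + 2 * \<tau>) within (\<lambda>\<tau>. \<eta>0 + 2 * \<tau>) ` {0..\<rho>})"
      by (rule has_vector_derivative_within_subset[OF Q]) (use t \<eta>0 in auto)
    ultimately have "((\<lambda>\<tau>. Q (\<eta>0 + 2 * \<tau>)) has_vector_derivative 2 *\<^sub>R ucyl w (\<eta>0 + 2 * \<tau>)) (at \<tau> within {0..\<rho>})"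
      using vector_diff_chain_within[of "\<lambda>\<tau>. \<eta>0 + 2 * \<tau>"] by (fastforce simp: o_def)
    from has_vector_derivative_diff[OF this
       bounded_linear.has_vector_derivative[OF bounded_linear_scaleR_right vd_Wmean[OF w t \<eta>0(1,3)], of 2]]
    show ?thesis by simp
  qed
  then obtain c where c: "\<And>\<tau>. \<tau> \<in> {0..\<rho>} \<Longrightarrow> Q (\<eta>0 + 2 * \<tau>) - 2 *\<^sub>R Wmean w (\<eta>0 + \<tau>) \<tau> = c"
    using has_vector_derivative_zero_constant[of "{0..\<rho>}" "\<lambda>\<tau>. Q (\<eta>0 + 2 * \<tau>) - 2 *\<^sub>R Wmean w (\<eta>0 + \<tau>) \<tau>"] by auto
  have "Wmean w (\<eta>0 + 0) 0 = 0" by (simp add: Wmean_def)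
  then have "Q (\<eta>0 + 2 * \<rho>) - 2 *\<^sub>R Wmean w (\<eta>0 + \<rho>) \<rho> = Q \<eta>0"
    using c[of 0] c[of \<rho>] \<eta>0 by simp
  then show ?thesis by (simp add: Q_def algebra_simps)
qed

text \<open>The waves are known to tend to zero only pointwise in the direction p, so the limit is
  taken by dominated convergence, along a sequence of times and with the bound from
  \<open>ucyl_bounded\<close>.\<close>

lemma Wmean_tendsto_0:
  assumes w: "on_S3 w" and fut: "\<And>w. on_S3 w \<Longrightarrow> future w = 0"
    and e: "e \<longlonglongrightarrow> pi" "\<And>k. 0 < e k" "\<And>k. e k < pi"
  shows "(\<lambda>k. Wmean w (e k) \<rho>) \<longlonglongrightarrow> 0"
proof -
  obtain M where M: "\<And>w t. on_S3 w \<Longrightarrow> norm (ucyl w t) \<le> M" using ucyl_bounded by blast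
  have HY: "H (Yv w (e k) \<rho> p) = inverse (4 * pi) *\<^sub>R ucyl (qv w \<rho> p) (e k)" for k p
    unfolding Yv_def by (rule H_ucyl[OF on_S3_qv[OF w] e(2,3)])
  have "(\<lambda>k. integral sph (\<lambda>p. sin (fst p) *\<^sub>R sin \<rho> *\<^sub>R H (Yv w (e k) \<rho> p))) \<longlonglongrightarrow> integral sph (\<lambda>p. 0)"
  proof (rule dominated_convergence(2))
    fix k
    have "(\<lambda>p. Yv w (e k) \<rho> p) ` sph \<subseteq> cone" using e by (auto intro!: Yv_in_cone w)
    then show "(\<lambda>p. sin (fst p) *\<^sub>R sin \<rho> *\<^sub>R H (Yv w (e k) \<rho> p)) integrable_on sph"
      by (intro integrable_continuous continuous_intros cont_H)
  next
    show "(\<lambda>p. M) integrable_on sph" by (intro integrable_continuous continuous_intros)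
  next
    fix k p
    have 1: "norm (H (Yv w (e k) \<rho> p)) \<le> norm (ucyl (qv w \<rho> p) (e k))"
      unfolding HY norm_scaleR
      by (rule order_trans[OF mult_right_mono[of _ 1]]) (use pi_gt3 in \<open>auto simp: field_simps\<close>)
    have "norm (sin (fst p) *\<^sub>R sin \<rho> *\<^sub>R H (Yv w (e k) \<rho> p)) \<le> 1 * (1 * norm (H (Yv w (e k) \<rho> p)))"
      unfolding norm_scaleR by (intro mult_mono) auto
    then show "norm (sin (fst p) *\<^sub>R sin \<rho> *\<^sub>R H (Yv w (e k) \<rho> p)) \<le> M"
      using 1 M[OF on_S3_qv[OF w], of \<rho> p "e k"] by linarith
  next
    fix p
    have "(\<lambda>k. ucyl (qv w \<rho> p) (e k)) \<longlonglongrightarrow> ucyl (qv w \<rho> p) pi"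
      using cont_ucyl[OF on_S3_qv[OF w], of UNIV] e(1)
      by (intro isCont_tendsto_compose[of _ "ucyl _"]) (auto simp: continuous_on_eq_continuous_at)
    moreover have "ucyl (qv w \<rho> p) pi = 0" using fut[OF on_S3_qv[OF w]] by (simp add: future_def)
    ultimately have "(\<lambda>k. sin (fst p) *\<^sub>R sin \<rho> *\<^sub>R inverse (4 * pi) *\<^sub>R ucyl (qv w \<rho> p) (e k)) \<longlonglongrightarrow> sin (fst p) *\<^sub>R sin \<rho> *\<^sub>R inverse (4 * pi) *\<^sub>R 0"
      by (intro tendsto_intros) simp
    then show "(\<lambda>k. sin (fst p) *\<^sub>R sin \<rho> *\<^sub>R H (Yv w (e k) \<rho> p)) \<longlonglongrightarrow> 0" by (simp add: HY)
  qed
  then show ?thesis by (simp add: Wmean_def)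
qed

theorem antipodal_of_past_zero:
  assumes past: "\<And>w. on_S3 w \<Longrightarrow> past w = 0" and w: "on_S3 w" and c: "\<bar>c\<bar> < 1"
  shows "H (- (w + c *\<^sub>R e0)) = H (w + c *\<^sub>R e0)"
proof -
  have fut: "future w = 0" if "on_S3 w" for w
    using future_eq_minus_past_antipode[OF that] past[OF on_S3_minus[OF that]] by simp
  define Q where "Q x = integral {0..x} (ucyl w)" for x
  have Q: "(Q has_vector_derivative ucyl w x) (at x)" if "x \<in> {0<..<2*pi}" for x
    using integral_has_vector_derivative[OF cont_ucyl[OF w], of x 0 "2*pi"] that
    unfolding Q_def by (simp add: at_within_Icc_at)
  have sym: "Q (pi + \<rho>) = Q (pi - \<rho>)" if r: "0 < \<rho>" "\<rho> < pi" for \<rho>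
  proof -
    \<comment> \<open>The times \<open>e k\<close> tend to pi from below while exceeding \<rho>, so
      that the characteristic through radius \<rho> starts at the positive time
      \<open>e k - \<rho>\<close>, as \<open>Wmean_eq_integral\<close> demands.\<close>
    define d where "d k = (pi - \<rho>) / (2 * (real k + 1))" for k :: nat
    define e where "e k = pi - d k" for k
    have d0': "filterlim (\<lambda>k. 2 * (real k + 1)) at_top sequentially"
      by (rule filterlim_tendsto_pos_mult_at_top[OF tendsto_const], simp,
          rule filterlim_at_top_mono[OF filterlim_real_sequentially]) simp
    have d0: "d \<longlonglongrightarrow> 0"
      unfolding d_def by (rule real_tendsto_divide_at_top) (rule tendsto_const, rule d0')
    have d: "0 < d k \<and> d k < pi - \<rho>" for k
    proof -
      have "pi - \<rho> < (pi - \<rho>) * (2 * (real k + 1))" using r mult_strict_left_mono[of 1 "2 * (real k + 1)" "pi - \<rho>"] by simp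
      then show ?thesis using r by (simp add: d_def pos_divide_less_eq)
    qed
    have e: "e \<longlonglongrightarrow> pi" unfolding e_def using tendsto_diff[OF tendsto_const d0, of pi] by simp
    have e1: "\<rho> < e k" "e k < pi" for k using d[of k] by (auto simp: e_def)
    have W: "2 *\<^sub>R Wmean w (e k) \<rho> = Q (e k + \<rho>) - Q (e k - \<rho>)" for k
    proof -
      have "e k - \<rho> + 2 * \<rho> = e k + \<rho>" by simp
      with Wmean_eq_integral[OF w, of "e k - \<rho>" \<rho>] e1[of k] r show ?thesis by (simp add: Q_def)
    qed
    have "(\<lambda>k. 2 *\<^sub>R Wmean w (e k) \<rho>) \<longlonglongrightarrow> 2 *\<^sub>R 0"
      using e1 r by (intro tendsto_intros Wmean_tendsto_0 w fut e) (auto intro: less_trans)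
    then have "(\<lambda>k. Q (e k + \<rho>) - Q (e k - \<rho>)) \<longlonglongrightarrow> 0"
      unfolding W by simp
    moreover have "(\<lambda>k. Q (e k + \<rho>) - Q (e k - \<rho>)) \<longlonglongrightarrow> Q (pi + \<rho>) - Q (pi - \<rho>)"
      using r by (intro tendsto_diff isCont_tendsto_compose[of _ Q] tendsto_intros e
         has_vector_derivative_continuous[OF Q]) auto
    ultimately have "Q (pi + \<rho>) - Q (pi - \<rho>) = 0" by (rule LIMSEQ_unique[symmetric])
    then show ?thesis by simp
  qed
  \<comment> \<open>Differentiation in \<rho>: a primitive symmetric about pi has a derivative odd
    about pi.\<close>
  have neg: "ucyl w (pi + \<rho>) = - ucyl w (pi - \<rho>)" if r: "0 < \<rho>" "\<rho> < pi" for \<rho>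
  proof -
    have 1: "((\<lambda>\<rho>. Q (pi + \<rho>)) has_vector_derivative 1 *\<^sub>R ucyl w (pi + \<rho>)) (at \<rho>)"
    proof -
      have "((\<lambda>\<rho>. pi + \<rho>) has_vector_derivative 1) (at \<rho>)"
        by (auto simp: has_vector_derivative_def intro!: derivative_eq_intros)
      from vector_diff_chain_at[OF this Q[of "pi + \<rho>"]] r show ?thesis by (simp add: o_def)
    qed
    have 2: "((\<lambda>\<rho>. Q (pi - \<rho>)) has_vector_derivative (-1) *\<^sub>R ucyl w (pi - \<rho>)) (at \<rho>)"
    proof -
      have "((\<lambda>\<rho>. pi - \<rho>) has_vector_derivative -1) (at \<rho>)"
        by (auto simp: has_vector_derivative_def intro!: derivative_eq_intros)
      from vector_diff_chain_at[OF this Q[of "pi - \<rho>"]] r show ?thesis by (simp add: o_def)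
    qed
    have "((\<lambda>\<rho>. Q (pi + \<rho>)) has_vector_derivative (-1) *\<^sub>R ucyl w (pi - \<rho>)) (at \<rho>)"
      by (rule has_vector_derivative_transform_within_open[OF 2, of "{0<..<pi}"]) (use sym r in auto)
    from vector_derivative_unique_at[OF 1 this] show ?thesis by simp
  qed
  \<comment> \<open>With cos rho = c, the antipode of \<open>w + c *\<^sub>R e0\<close> lies over -
    w at time rho and the point itself over w at time pi - rho. Both values are minus that of
    \<open>ucyl w\<close> at pi + rho, by antiperiodicity and by oddness.\<close>
  define \<rho> where "\<rho> = arccos c"
  have r: "0 < \<rho>" "\<rho> < pi" "cos \<rho> = c" using arccos_lt_bounded[of c] c by (auto simp: \<rho>_def)
  have "- ucyl (- w) \<rho> = - ucyl w (pi - \<rho>)"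
    using ucyl_antiperiodic[OF w r(1,2)] neg[OF r(1,2)] by (simp add: add.commute)
  then show ?thesis
    using H_ucyl[OF on_S3_minus[OF w] r(1,2)] H_ucyl[OF w, of "pi - \<rho>"] r by simp
qed

end

section \<open>Homogeneous extensions from dS4\<close>

lemma has_derivative_pd:
  assumes "F differentiable (at x)"
  shows "(F has_derivative (\<lambda>v. \<Sum>a\<in>UNIV. v$a *\<^sub>R pd a F x)) (at x)"
proof -
  have F: "(F has_derivative frechet_derivative F (at x)) (at x)"
    using assms by (simp add: frechet_derivative_works)
  have lin: "linear (frechet_derivative F (at x))" using assms by (rule linear_frechet_derivative)
  have "frechet_derivative F (at x) v = (\<Sum>a\<in>UNIV. v$a *\<^sub>R pd a F x)" for v
  proof -
    have "v = (\<Sum>a\<in>UNIV. v$a *\<^sub>R axis a 1)" using basis_expansion[of v] by (simp add: scalar_mult_eq_scaleR)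
    then have "frechet_derivative F (at x) v = frechet_derivative F (at x) (\<Sum>a\<in>UNIV. v$a *\<^sub>R axis a 1)" by simp
    also have "\<dots> = (\<Sum>a\<in>UNIV. v$a *\<^sub>R pd a F x)" by (simp add: linear_sum[OF lin] linear_scale[OF lin] pd_def)
    finally show ?thesis .
  qed
  then have "frechet_derivative F (at x) = (\<lambda>v. \<Sum>a\<in>UNIV. v$a *\<^sub>R pd a F x)" by (rule ext)
  with F show ?thesis by simp
qed

lemma pd_eqI:
  assumes "(F has_derivative F') (at x)" shows "pd a F x = F' (axis a 1)"
  using frechet_derivative_at[OF assms] by (simp add: pd_def)

text \<open>Derivative formulas hold only at points of U, whereas \<open>frechet_derivative\<close>
  is a total function; this congruence lets such formulas be used inside \<open>Ck\<close>.\<close>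

lemma Ck_cong:
  assumes "open U" "\<And>x. x \<in> U \<Longrightarrow> f x = g x" "Ck k U f"
  shows "Ck k U g"
  using assms(2,3)
proof (induction k arbitrary: f g)
  case 0
  then show ?case by (simp cong: continuous_on_cong)
next
  case (Suc k)
  have d: "g differentiable (at x)" if "x \<in> U" for x
  proof -
    have "f differentiable (at x)" using Suc.prems that by simp
    then obtain f' where "(f has_derivative f') (at x)" by (auto simp: differentiable_def)
    from has_derivative_transform_within_open[OF this assms(1) that Suc.prems(1)]
    show ?thesis by (auto simp: differentiable_def)
  qed
  have "frechet_derivative f (at x) v = frechet_derivative g (at x) v" if "x \<in> U" for x v
    using frechet_derivative_transform_within_open[of f x U g] Suc.prems assms(1) that by auto
  then show ?case using d Suc.IH[of "\<lambda>x. frechet_derivative f (at x) _"] Suc.prems by auto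
qed

lemma Ck_Suc_imp: "Ck (Suc k) U f \<Longrightarrow> Ck k U f"
proof (induction k arbitrary: f)
  case 0
  then show ?case
    by (simp add: continuous_at_imp_continuous_on differentiable_imp_continuous_within)
next
  case (Suc k)
  have d: "\<forall>x\<in>U. f differentiable (at x)" "\<And>v. Ck (Suc k) U (\<lambda>x. frechet_derivative f (at x) v)"
    using Suc.prems Ck.simps(2)[of "Suc k" U f] by blast+
  have "Ck k U (\<lambda>x. frechet_derivative f (at x) v)" for v by (rule Suc.IH[OF d(2)])
  with d(1) show ?case by simp
qed

lemma frechet_derivative_add:
  assumes "f differentiable (at x)" "g differentiable (at x)"
  shows "frechet_derivative (\<lambda>x. f x + g x) (at x) = (\<lambda>v. frechet_derivative f (at x) v + frechet_derivative g (at x) v)"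
  using assms by (intro frechet_derivative_at[symmetric] has_derivative_add) (simp_all add: frechet_derivative_works[symmetric])

lemma Ck_add:
  assumes "open U" shows "Ck k U f \<Longrightarrow> Ck k U g \<Longrightarrow> Ck k U (\<lambda>x. f x + g x)"
proof (induction k arbitrary: f g)
  case 0 then show ?case by (simp add: continuous_on_add)
next
  case (Suc k)
  have "Ck k U (\<lambda>x. frechet_derivative (\<lambda>x. f x + g x) (at x) v)" for v
    by (rule Ck_cong[OF assms(1) _ Suc.IH[of "\<lambda>x. frechet_derivative f (at x) v" "\<lambda>x. frechet_derivative g (at x) v"]])
       (use Suc.prems in \<open>auto simp: frechet_derivative_add\<close>)
  then show ?case using Suc.prems by auto
qed

lemma Ck_cmult:
  assumes "open U" shows "Ck k U f \<Longrightarrow> Ck k U (\<lambda>x. c * f x)"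
proof (induction k arbitrary: f)
  case 0 then show ?case by (simp add: continuous_on_mult_left)
next
  case (Suc k)
  have d: "((\<lambda>x. c * f x) has_derivative (\<lambda>v. c * frechet_derivative f (at x) v)) (at x)" if "x \<in> U" for x
    using Suc.prems that by (auto intro!: has_derivative_mult_right simp: frechet_derivative_works[symmetric])
  have "Ck k U (\<lambda>x. frechet_derivative (\<lambda>x. c * f x) (at x) v)" for v
    by (rule Ck_cong[OF assms(1) _ Suc.IH[of "\<lambda>x. frechet_derivative f (at x) v"]])
       (use Suc.prems frechet_derivative_at[OF d] in \<open>auto dest: fun_cong\<close>)
  then show ?case using d by (auto simp: differentiable_def)
qed

lemma has_derivative_coord_mult:
  fixes f :: "real^5 \<Rightarrow> complex"
  assumes "(f has_derivative f') (at x)"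
  shows "((\<lambda>x. of_real (x$i) * f x) has_derivative (\<lambda>v. of_real (x$i) * f' v + of_real (v$i) * f x)) (at x)"
proof -
  have "((\<lambda>x. complex_of_real (x$i)) has_derivative (\<lambda>v. of_real (v$i))) (at x)"
    by (intro bounded_linear_imp_has_derivative bounded_linear_compose[OF bounded_linear_of_real bounded_linear_vec_nth])
  from has_derivative_mult[OF this assms] show ?thesis .
qed

text \<open>The class of products is restricted to coordinates: the product rule then returns a
  coordinate times a derivative of \<open>f\<close> and a constant times \<open>f\<close>, both
  within reach of the induction.\<close>

lemma Ck_coord_mult:
  assumes "open U" shows "Ck k U f \<Longrightarrow> Ck k U (\<lambda>x. of_real (x$i) * f x)"
proof (induction k arbitrary: f)
  case 0 then show ?case by (auto intro!: continuous_intros)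
next
  case (Suc k)
  have d: "((\<lambda>x. of_real (x$i) * f x) has_derivative (\<lambda>v. of_real (x$i) * frechet_derivative f (at x) v + of_real (v$i) * f x)) (at x)" if "x \<in> U" for x
    using Suc.prems that by (intro has_derivative_coord_mult) (auto simp: frechet_derivative_works[symmetric])
  have "Ck k U (\<lambda>x. of_real (x$i) * frechet_derivative f (at x) v + of_real (v$i) * f x)" for v
    using Suc.prems Ck_Suc_imp[OF Suc.prems] by (intro Ck_add assms Suc.IH Ck_cmult) simp_all
  then have "Ck k U (\<lambda>x. frechet_derivative (\<lambda>x. of_real (x$i) * f x) (at x) v)" for v
    by (rule Ck_cong[OF assms(1), rotated])
       (use frechet_derivative_at[OF d] in \<open>auto dest: fun_cong\<close>)
  then show ?case using d by (auto simp: differentiable_def)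
qed

lemma smooth_on_add: "open U \<Longrightarrow> smooth_on U f \<Longrightarrow> smooth_on U g \<Longrightarrow> smooth_on U (\<lambda>x. f x + g x)"
  and smooth_on_cmult: "open U \<Longrightarrow> smooth_on U f \<Longrightarrow> smooth_on U (\<lambda>x. c * f x)"
  and smooth_on_coord_mult: "open U \<Longrightarrow> smooth_on U f \<Longrightarrow> smooth_on U (\<lambda>x. of_real (x$i) * f x)"
  by (auto simp: smooth_on_def intro: Ck_add Ck_cmult Ck_coord_mult)

lemma smooth_on_zero: "smooth_on U (\<lambda>x. 0)"
proof -
  have "Ck k U (\<lambda>x. 0)" for k by (induction k) auto
  then show ?thesis by (simp add: smooth_on_def)
qed

lemma smooth_on_diff:
  assumes "open U" "smooth_on U f" "smooth_on U g" shows "smooth_on U (\<lambda>x. f x - g x)"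
  using smooth_on_add[OF assms(1,2) smooth_on_cmult[OF assms(1,3), of "-1"]] by simp

lemma smooth_on_sum:
  assumes "open U" "\<And>i. i \<in> I \<Longrightarrow> smooth_on U (f i)"
  shows "smooth_on U (\<lambda>x. \<Sum>i\<in>I. f i x)"
  using assms(2)
  by (induction I rule: infinite_finite_induct) (auto intro: smooth_on_zero smooth_on_add[OF assms(1)])

lemma smooth_on_differentiable: "smooth_on U f \<Longrightarrow> x \<in> U \<Longrightarrow> f differentiable (at x)"
  unfolding smooth_on_def by (drule spec[of _ "Suc 0"]) simp

lemma smooth_on_continuous: "smooth_on U f \<Longrightarrow> continuous_on U f"
  unfolding smooth_on_def by (drule spec[of _ 0]) simp

lemma smooth_on_pd:
  assumes "smooth_on U f" shows "smooth_on U (pd a f)"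
proof -
  have "Ck k U (pd a f)" for k
    using assms[unfolded smooth_on_def, rule_format, of "Suc k"] by (simp add: pd_def[abs_def])
  then show ?thesis by (simp add: smooth_on_def)
qed

text \<open>For a function F near dS4, hext k F is the extension of F restricted to dS4 that is
  homogeneous of degree -k, and tder a k F is the restriction to dS4 of its a-th partial derivative.\<close>

definition hext :: "nat \<Rightarrow> (real^5 \<Rightarrow> complex) \<Rightarrow> real^5 \<Rightarrow> complex" where
  "hext k F X = inverse (sqrt (mink X X)) ^ k *\<^sub>R F (inverse (sqrt (mink X X)) *\<^sub>R X)"

definition tder :: "5 \<Rightarrow> nat \<Rightarrow> (real^5 \<Rightarrow> complex) \<Rightarrow> real^5 \<Rightarrow> complex" where
  "tder a k F x = pd a F x - of_real (lower x a) * ((\<Sum>b\<in>UNIV. of_real (x$b) * pd b F x) + of_nat k * F x)"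

section \<open>Homogeneous extensions and their derivatives\<close>

lemma smooth_on_lower_mult: "open U \<Longrightarrow> smooth_on U f \<Longrightarrow> smooth_on U (\<lambda>x. of_real (lower x a) * f x)"
  using smooth_on_cmult[OF _ smooth_on_coord_mult, of U f "of_real (eta a)" a]
  by (simp add: lower_def mult.assoc)

lemma smooth_on_tder: "open U \<Longrightarrow> smooth_on U F \<Longrightarrow> smooth_on U (tder a k F)"
  unfolding tder_def
  by (intro smooth_on_diff smooth_on_pd smooth_on_lower_mult smooth_on_add smooth_on_sum smooth_on_coord_mult smooth_on_cmult)

lemma normalize_dS4: "X \<in> cone \<Longrightarrow> inverse (sqrt (mink X X)) *\<^sub>R X \<in> dS4"
  by (simp add: dS4_def cone_def mink_linear field_simps)

lemma dS4_subset_cone: "dS4 \<subseteq> cone"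
  by (auto simp: dS4_def cone_def)

lemma hext_dS4: "x \<in> dS4 \<Longrightarrow> hext k F x = F x"
  by (simp add: hext_def dS4_def)

lemma hext_cong: "(\<And>x. x \<in> dS4 \<Longrightarrow> F x = G x) \<Longrightarrow> X \<in> cone \<Longrightarrow> hext k F X = hext k G X"
  by (simp add: hext_def normalize_dS4)

lemma hext_hom:
  assumes "t > 0" shows "hext k F (t *\<^sub>R X) = inverse (t ^ k) *\<^sub>R hext k F X"
proof -
  have "sqrt (mink (t *\<^sub>R X) (t *\<^sub>R X)) = t * sqrt (mink X X)"
    using assms by (simp add: mink_linear real_sqrt_mult mult.assoc[symmetric])
  note s = this
  have N: "inverse (sqrt (mink (t *\<^sub>R X) (t *\<^sub>R X))) *\<^sub>R (t *\<^sub>R X) = inverse (sqrt (mink X X)) *\<^sub>R X"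
    unfolding s using assms by (simp add: field_simps)
  show ?thesis unfolding hext_def N unfolding s by (simp add: power_mult_distrib power_inverse)
qed

lemma lower_sum: "(\<Sum>a\<in>UNIV. v$a * lower X a) = mink X v"
  by (simp add: mink_def lower_def mult_ac)

text \<open>The chain rule through the normalization X / sqrt (X.X). The radial part of the
  derivative of F is projected away and replaced by the value that Euler's relation dictates in
  degree -k.\<close>

lemma has_derivative_hext:
  assumes X: "X \<in> cone" and F: "\<And>x. x \<in> dS4 \<Longrightarrow> F differentiable (at x)"
  shows "(hext k F has_derivative (\<lambda>v. \<Sum>a\<in>UNIV. v$a *\<^sub>R hext (Suc k) (tder a k F) X)) (at X)"
proof -
  define q where "q Y = inverse (sqrt (mink Y Y))" for Y
  have pos: "mink X X > 0" using X by (simp add: cone_def)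
  have nth: "((\<lambda>Y::real^5. Y $ i) has_derivative (\<lambda>v. v $ i)) (at X)" for i
    by (rule bounded_linear_imp_has_derivative[OF bounded_linear_vec_nth])
  have mm: "((\<lambda>Y. mink Y Y) has_derivative (\<lambda>v. 2 * mink X v)) (at X)"
    unfolding mink_5 by (auto intro!: derivative_eq_intros nth simp: fun_eq_iff algebra_simps)
  have dq: "(q has_derivative (\<lambda>v. - (q X ^ 3 * mink X v))) (at X)"
    unfolding q_def using pos
    by (auto intro!: derivative_eq_intros mm simp: fun_eq_iff field_simps power3_eq_cube)
  have dN: "((\<lambda>Y. q Y *\<^sub>R Y) has_derivative (\<lambda>v. q X *\<^sub>R v - (q X ^ 3 * mink X v) *\<^sub>R X)) (at X)"
    by (auto intro!: derivative_eq_intros dq simp: fun_eq_iff)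
  let ?N = "q X *\<^sub>R X"
  have N: "?N \<in> dS4" using normalize_dS4[OF X] by (simp add: q_def)
  have dF: "((\<lambda>Y. F (q Y *\<^sub>R Y)) has_derivative (\<lambda>v. \<Sum>a\<in>UNIV. (q X *\<^sub>R v - (q X ^ 3 * mink X v) *\<^sub>R X)$a *\<^sub>R pd a F ?N)) (at X)"
    using has_derivative_compose[OF dN has_derivative_pd[OF F[OF N]]] by simp
  have dp: "((\<lambda>Y. q Y ^ k) has_derivative (\<lambda>v. - (real k * q X ^ (k + 2) * mink X v))) (at X)"
  proof (rule has_derivative_eq_rhs[OF has_derivative_power[OF dq]], rule ext)
    \<comment> \<open>The exponent \<open>k - 1\<close> is truncated at k = 0, where the factor
      \<open>of_nat k\<close> vanishes; hence the case distinction.\<close>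
    show "of_nat k * - (q X ^ 3 * mink X v) * q X ^ (k - 1) = - (real k * q X ^ (k + 2) * mink X v)" for v
      by (cases k) (simp_all add: power_add power3_eq_cube power2_eq_square)
  qed
  have "(hext k F has_derivative (\<lambda>v. q X ^ k *\<^sub>R (\<Sum>a\<in>UNIV. (q X *\<^sub>R v - (q X ^ 3 * mink X v) *\<^sub>R X)$a *\<^sub>R pd a F ?N)
     + (- (real k * q X ^ (k + 2) * mink X v)) *\<^sub>R F ?N)) (at X)"
    using has_derivative_scaleR[OF dp dF] unfolding hext_def[abs_def] q_def by simp
  moreover have "q X ^ k *\<^sub>R (\<Sum>a\<in>UNIV. (q X *\<^sub>R v - (q X ^ 3 * mink X v) *\<^sub>R X)$a *\<^sub>R pd a F ?N)
     + (- (real k * q X ^ (k + 2) * mink X v)) *\<^sub>R F ?N = (\<Sum>a\<in>UNIV. v$a *\<^sub>R hext (Suc k) (tder a k F) X)" for v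
  proof -
    define S where "S = (\<Sum>b\<in>UNIV. X$b *\<^sub>R pd b F ?N)"
    have t: "tder a k F ?N = pd a F ?N - (q X * lower X a) *\<^sub>R (q X *\<^sub>R S + real k *\<^sub>R F ?N)" for a
      by (simp add: tder_def S_def lower_def scaleR_conv_of_real[where 'a=complex] sum_distrib_left algebra_simps)
    have "(\<Sum>a\<in>UNIV. v$a *\<^sub>R hext (Suc k) (tder a k F) X) =
      (\<Sum>a\<in>UNIV. q X ^ Suc k *\<^sub>R (v$a *\<^sub>R pd a F ?N) - (v$a * lower X a) *\<^sub>R (q X ^ Suc k * q X) *\<^sub>R (q X *\<^sub>R S + real k *\<^sub>R F ?N))"
      unfolding hext_def q_def[symmetric] t by (simp add: scaleR_conv_of_real[where 'a=complex] algebra_simps)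
    also have "\<dots> = q X ^ Suc k *\<^sub>R (\<Sum>a\<in>UNIV. v$a *\<^sub>R pd a F ?N) - mink X v *\<^sub>R (q X ^ Suc k * q X) *\<^sub>R (q X *\<^sub>R S + real k *\<^sub>R F ?N)"
      unfolding sum_subtractf scaleR_sum_right lower_sum[symmetric] scaleR_sum_left by (rule refl)
    also have "\<dots> = q X ^ k *\<^sub>R (q X *\<^sub>R (\<Sum>a\<in>UNIV. v$a *\<^sub>R pd a F ?N) - (q X ^ 3 * mink X v) *\<^sub>R S) + (- (real k * q X ^ (k + 2) * mink X v)) *\<^sub>R F ?N"
      by (simp add: scaleR_conv_of_real[where 'a=complex] power3_eq_cube algebra_simps)
    also have "q X *\<^sub>R (\<Sum>a\<in>UNIV. v$a *\<^sub>R pd a F ?N) - (q X ^ 3 * mink X v) *\<^sub>R S =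
       (\<Sum>a\<in>UNIV. (q X *\<^sub>R v - (q X ^ 3 * mink X v) *\<^sub>R X)$a *\<^sub>R pd a F ?N)"
      by (simp add: S_def scaleR_sum_right sum_subtractf algebra_simps)
    finally show ?thesis by simp
  qed
  ultimately show ?thesis by simp
qed

lemma cont_hext:
  assumes "continuous_on U F" "dS4 \<subseteq> U" shows "continuous_on cone (hext k F)"
proof -
  have "continuous_on cone (\<lambda>X. inverse (sqrt (mink X X)))"
    by (intro continuous_intros) (auto simp: cone_def)
  moreover have "continuous_on cone (\<lambda>X. F (inverse (sqrt (mink X X)) *\<^sub>R X))"
    by (rule continuous_on_compose2[OF assms(1) continuous_on_scaleR[OF calculation continuous_on_id]])
       (use normalize_dS4 assms(2) in auto)
  ultimately show ?thesis unfolding hext_def[abs_def] by (rule continuous_on_scaleR[OF continuous_on_power])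
qed

lemma C2_hext:
  assumes U: "open U" "dS4 \<subseteq> U" and F: "smooth_on U F"
  shows "C2_fun cone (hext k F) (\<lambda>a. hext (Suc k) (tder a k F)) (\<lambda>a b. hext (Suc (Suc k)) (tder b (Suc k) (tder a k F)))"
proof
  show "open cone" by (rule open_cone)
next
  fix X assume "X \<in> cone"
  then show "(hext k F has_derivative (\<lambda>v. \<Sum>a\<in>UNIV. v$a *\<^sub>R hext (Suc k) (tder a k F) X)) (at X)"
    using smooth_on_differentiable[OF F] U by (intro has_derivative_hext) auto
next
  fix X a assume "X \<in> cone"
  then show "(hext (Suc k) (tder a k F) has_derivative (\<lambda>v. \<Sum>b\<in>UNIV. v$b *\<^sub>R hext (Suc (Suc k)) (tder b (Suc k) (tder a k F)) X)) (at X)"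
    using smooth_on_differentiable[OF smooth_on_tder[OF U(1) F]] U by (intro has_derivative_hext) auto
next
  fix a b
  show "continuous_on cone (hext (Suc (Suc k)) (tder b (Suc k) (tder a k F)))"
    by (intro cont_hext[of U] smooth_on_continuous smooth_on_tder U F)
qed

text \<open>Flat second derivatives of the extension commute. Each derivative lowers the degree by
  one, so the outer \<open>tder\<close> has the weight \<open>Suc k\<close>.\<close>

lemma tder_commute:
  assumes U: "open U" "dS4 \<subseteq> U" and F: "smooth_on U F" and x: "x \<in> dS4"
  shows "tder b (Suc k) (tder a k F) x = tder a (Suc k) (tder b k F) x"
  using C2_fun.H2_sym[OF C2_hext[OF U F, of k], of x a b] x dS4_subset_cone hext_dS4[OF x] by auto

text \<open>The extension depends only on the values on dS4, and so do its derivatives. Through this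
  every algebraic identity between field components on dS4 can be differentiated.\<close>

lemma tder_zero:
  assumes U: "open U" "dS4 \<subseteq> U" and F: "smooth_on U F" and 0: "\<And>x. x \<in> dS4 \<Longrightarrow> F x = 0" and x: "x \<in> dS4"
  shows "tder a k F x = 0"
proof -
  have xc: "x \<in> cone" using x dS4_subset_cone by blast
  have "(hext k F has_derivative (\<lambda>v. \<Sum>a\<in>UNIV. v$a *\<^sub>R hext (Suc k) (tder a k F) x)) (at x)"
    using smooth_on_differentiable[OF F] U xc by (intro has_derivative_hext) auto
  moreover have "(hext k F has_derivative (\<lambda>v. 0)) (at x)"
    by (rule has_derivative_transform_within_open[OF has_derivative_const[of 0] open_cone xc])
       (simp add: hext_def 0 normalize_dS4)
  ultimately have "(\<lambda>v. \<Sum>a\<in>UNIV. v$a *\<^sub>R hext (Suc k) (tder a k F) x) = (\<lambda>v. 0)"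
    by (rule has_derivative_unique)
  from fun_cong[OF this, of "axis a 1"] show ?thesis
    by (simp add: axis_def hext_dS4[OF x] if_distrib[of "\<lambda>x. x *\<^sub>R _"] cong: if_cong)
qed

lemma tder_Suc: "tder a k F x = tder a (Suc k) F x + of_real (lower x a) * F x"
  by (simp add: tder_def algebra_simps)

lemma tder_cmult:
  assumes "F differentiable (at x)"
  shows "tder a k (\<lambda>x. c * F x) x = c * tder a k F x"
proof -
  have "pd b (\<lambda>x. c * F x) x = c * pd b F x" for b
    using pd_eqI[OF has_derivative_mult_right[OF has_derivative_pd[OF assms], of c], of b] pd_eqI[OF has_derivative_pd[OF assms], of b] by simp
  then show ?thesis by (simp add: tder_def sum_distrib_left algebra_simps)
qed

lemma tder_add:
  assumes "F differentiable (at x)" "G differentiable (at x)"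
  shows "tder a k (\<lambda>x. F x + G x) x = tder a k F x + tder a k G x"
proof -
  have "pd b (\<lambda>x. F x + G x) x = pd b F x + pd b G x" for b
    using frechet_derivative_add[OF assms] by (simp add: pd_def)
  then show ?thesis by (simp add: tder_def sum.distrib algebra_simps)
qed

lemma tder_const0: "tder a k (\<lambda>x. 0) x = 0"
  by (simp add: tder_def pd_def)

lemma tder_sum:
  assumes "\<And>i. i \<in> I \<Longrightarrow> F i differentiable (at x)"
  shows "tder a k (\<lambda>x. \<Sum>i\<in>I. F i x) x = (\<Sum>i\<in>I. tder a k (F i) x)"
  using assms
proof (induction I rule: infinite_finite_induct)
  case (insert i I)
  then have "(\<lambda>x. \<Sum>i\<in>I. F i x) differentiable (at x)" by (intro differentiable_sum) auto
  with insert show ?case by (simp add: tder_add)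
qed (simp_all add: tder_const0)

text \<open>A coordinate has degree 1, so in a product of degree -k the other factor has degree -(k
  + 1) and is differentiated with the weight \<open>Suc k\<close>.\<close>

lemma tder_coord_mult:
  assumes "F differentiable (at x)"
  shows "tder a k (\<lambda>x. of_real (x$l) * F x) x = (if a = l then F x else 0) + of_real (x$l) * tder a (Suc k) F x"
proof -
  have "pd b (\<lambda>x. of_real (x$l) * F x) x = of_real (x$l) * pd b F x + (if b = l then F x else 0)" for b
    using pd_eqI[OF has_derivative_coord_mult[OF has_derivative_pd[OF assms], of l], of b] pd_eqI[OF has_derivative_pd[OF assms], of b]
    by (auto simp: axis_def)
  then show ?thesis
    by (simp add: tder_def sum.distrib sum_distrib_left algebra_simps if_distrib[of "\<lambda>z. _ * z"] cong: if_cong)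
qed

lemma tder_euler:
  assumes "x \<in> dS4"
  shows "(\<Sum>a\<in>UNIV. of_real (x$a) * tder a k F x) = - of_nat k * F x"
proof -
  define S where "S = (\<Sum>b\<in>UNIV. of_real (x$b) * pd b F x) + of_nat k * F x"
  have "(\<Sum>a\<in>UNIV. x$a * lower x a) = 1" using assms by (simp add: lower_sum dS4_def)
  then have "(\<Sum>a\<in>UNIV. complex_of_real (x$a) * (of_real (lower x a) * S)) = S"
    by (simp flip: mult.assoc sum_distrib_right of_real_mult of_real_sum)
  then show ?thesis
    unfolding tder_def S_def[symmetric] by (simp add: right_diff_distrib sum_subtractf) (simp add: S_def)
qed

section \<open>The wave operator in degrees -1 and -2\<close>

lemma eta_sq_complex: "complex_of_real (eta a) * of_real (eta a) = 1"
  "complex_of_real (eta a) * (of_real (eta a) * z) = z"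
  by (simp_all add: eta_def)

text \<open>The flat wave operator on the extension of degree -2, whose gradient has degree
  -3.\<close>

definition boxd :: "(real^5 \<Rightarrow> complex) \<Rightarrow> real^5 \<Rightarrow> complex" where
  "boxd F x = (\<Sum>a\<in>UNIV. of_real (eta a) * tder a 3 (tder a 2 F) x)"

lemma conformal_wave_hext:
  assumes U: "open U" "dS4 \<subseteq> U" and F: "smooth_on U F"
    and box: "\<And>x. x \<in> dS4 \<Longrightarrow> (\<Sum>a\<in>UNIV. of_real (eta a) * tder a 2 (tder a 1 F) x) = 0"
  shows "conformal_wave (hext 1 F) (\<lambda>a. hext 2 (tder a 1 F)) (\<lambda>a b. hext 3 (tder b 2 (tder a 1 F)))"
proof -
  interpret C2_fun cone "hext 1 F" "\<lambda>a. hext 2 (tder a 1 F)" "\<lambda>a b. hext 3 (tder b 2 (tder a 1 F))"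
    using C2_hext[OF U F, of 1] by (simp add: numeral_2_eq_2 numeral_3_eq_3)
  show ?thesis
  proof
    fix X assume X: "X \<in> cone"
    have "(\<Sum>a\<in>UNIV. eta a *\<^sub>R hext 3 (tder a 2 (tder a 1 F)) X) =
      inverse (sqrt (mink X X)) ^ 3 *\<^sub>R (\<Sum>a\<in>UNIV. of_real (eta a) * tder a 2 (tder a 1 F) (inverse (sqrt (mink X X)) *\<^sub>R X))"
      by (simp add: hext_def sum_distrib_left scaleR_conv_of_real[where 'a=complex] mult_ac)
    then show "(\<Sum>a\<in>UNIV. eta a *\<^sub>R hext 3 (tder a 2 (tder a 1 F)) X) = 0"
      using box[OF normalize_dS4[OF X]] by simp
  qed (simp add: hext_hom)
qed

text \<open>The change of degree multiplies the extension by the Minkowski length. The extra terms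
  are -2 F and -3 F from Euler's relation and 5 F from the trace over the five directions, and they
  cancel.\<close>

lemma box_weight_shift:
  assumes U: "open U" "dS4 \<subseteq> U" and F: "smooth_on U F" and x: "x \<in> dS4"
  shows "(\<Sum>a\<in>UNIV. of_real (eta a) * tder a 2 (tder a 1 F) x) = boxd F x"
proof -
  have dF: "F differentiable (at x)" "tder a k F differentiable (at x)" for a k
    using smooth_on_differentiable[OF F] smooth_on_differentiable[OF smooth_on_tder[OF U(1) F]] U x by auto
  have t1: "tder a 1 F = (\<lambda>x. tder a 2 F x + of_real (eta a) * (of_real (x$a) * F x))" for a
    using tder_Suc[of a 1 F] by (auto simp: lower_def numeral_2_eq_2 mult.assoc)
  have d: "(\<lambda>x. of_real (x$a) * F x) differentiable (at x)" for a
    using has_derivative_coord_mult[OF has_derivative_pd[OF dF(1)], of a] by (auto simp: differentiable_def)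
  have t2: "tder a 2 (tder a 1 F) x = tder a 2 (tder a 2 F) x + of_real (eta a) * (F x + of_real (x$a) * tder a 3 F x)" for a
    unfolding t1 using d differentiable_mult[OF differentiable_const d]
    by (subst tder_add[OF dF(2)]) (simp_all add: tder_cmult tder_coord_mult dF numeral_3_eq_3 numeral_2_eq_2)
  have t3: "tder a 2 (tder a 2 F) x = tder a 3 (tder a 2 F) x + of_real (eta a) * (of_real (x$a) * tder a 2 F x)" for a
    using tder_Suc[of a 2 "tder a 2 F" x] by (simp add: lower_def numeral_3_eq_3 numeral_2_eq_2 mult.assoc)
  have "(\<Sum>a\<in>UNIV. of_real (eta a) * tder a 2 (tder a 1 F) x) =
     (\<Sum>a\<in>UNIV. of_real (eta a) * tder a 3 (tder a 2 F) x + of_real (x$a) * tder a 2 F x + (F x + of_real (x$a) * tder a 3 F x))"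
    by (rule sum.cong[OF refl], unfold t2 t3) (simp add: algebra_simps eta_sq_complex)
  also have "\<dots> = boxd F x"
    by (simp add: sum.distrib tder_euler[OF x] boxd_def)
  finally show ?thesis .
qed

lemma tder_cong:
  assumes U: "open U" "x \<in> U" and eq: "\<And>y. y \<in> U \<Longrightarrow> F y = G y" and d: "F differentiable (at x)"
  shows "tder a k F x = tder a k G x"
proof -
  have "pd b F x = pd b G x" for b
    using frechet_derivative_transform_within_open[OF d U, of G] eq by (simp add: pd_def)
  then show ?thesis by (simp add: tder_def eq U(2))
qed

text \<open>Leibniz' rule for the flat wave operator, with \<open>G\<close> extended in degree -2
  and the product therefore in degree -1. The components of the dual field are sums of such
  products.\<close>

lemma box_coord_mult:
  assumes U: "open U" "dS4 \<subseteq> U" and G: "smooth_on U G" and x: "x \<in> dS4"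
  shows "(\<Sum>a\<in>UNIV. of_real (eta a) * tder a 2 (tder a 1 (\<lambda>x. of_real (x$l) * G x)) x)
    = 2 * of_real (eta l) * tder l 2 G x + of_real (x$l) * boxd G x"
proof -
  have dG: "G differentiable (at y)" "tder a k G differentiable (at y)" if "y \<in> U" for a k y
    using smooth_on_differentiable[OF G] smooth_on_differentiable[OF smooth_on_tder[OF U(1) G]] U that by auto
  have xU: "x \<in> U" using x U by auto
  have t1: "tder a 1 (\<lambda>x. of_real (x$l) * G x) y = (if a = l then 1 else 0) * G y + of_real (y$l) * tder a 2 G y" if "y \<in> U" for a y
    using tder_coord_mult[OF dG(1)[OF that], of a 1 l] by (simp add: numeral_2_eq_2)
  have t2: "tder a 2 (tder a 1 (\<lambda>x. of_real (x$l) * G x)) x =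
     2 * (if a = l then tder a 2 G x else 0) + of_real (x$l) * tder a 3 (tder a 2 G) x" for a
  proof -
    have d1: "(\<lambda>y. (if a = l then 1 else 0) * G y) differentiable (at x)" using dG[OF xU] by auto
    have d2: "(\<lambda>y. of_real (y$l) * tder a 2 G y) differentiable (at x)"
      using has_derivative_coord_mult[OF has_derivative_pd[OF dG(2)[OF xU]], of l] by (auto simp: differentiable_def)
    have "tder a 2 (tder a 1 (\<lambda>x. of_real (x$l) * G x)) x = tder a 2 (\<lambda>y. (if a = l then 1 else 0) * G y + of_real (y$l) * tder a 2 G y) x"
      by (rule tder_cong[OF U(1) xU, symmetric]) (use t1 d1 d2 in auto)
    also have "\<dots> = 2 * (if a = l then tder a 2 G x else 0) + of_real (x$l) * tder a 3 (tder a 2 G) x"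
      by (subst tder_add[OF d1 d2]) (simp add: tder_cmult tder_coord_mult dG[OF xU] numeral_3_eq_3 numeral_2_eq_2)
    finally show ?thesis .
  qed
  show ?thesis
    unfolding t2 boxd_def distrib_left sum.distrib sum_distrib_left
    by (simp add: mult_ac if_distrib[of "\<lambda>z. _ * z"] cong: if_cong)
qed

text \<open>The function G is a smooth extension of the restriction of F to dS4.\<close>

definition wave_on_dS4 :: "(real^5 \<Rightarrow> complex) \<Rightarrow> bool" where
  "wave_on_dS4 F \<longleftrightarrow> (\<exists>G H1 H2. conformal_wave (hext 1 G) H1 H2 \<and> (\<forall>x\<in>dS4. G x = F x))"

section \<open>Limits of waves at past and future infinity\<close>

definition past_limit :: "(real^5 \<Rightarrow> complex) \<Rightarrow> real^5 \<Rightarrow> complex" where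
  "past_limit F w = Lim (at_right (-1)) (\<lambda>c. hext 1 F (w + c *\<^sub>R e0))"

lemma eventually_slice_right: "\<forall>\<^sub>F c in at_right (-1). \<bar>c::real\<bar> < 1"
  unfolding eventually_at_right_field by (rule exI[of _ 0]) auto

lemma eventually_slice_left: "\<forall>\<^sub>F c in at_left 1. \<bar>c::real\<bar> < 1"
  unfolding eventually_at_left_field by (rule exI[of _ 0]) auto

text \<open>The future limit is expressed through the past limit at the antipode, so that
  \<open>past_limit\<close> is the only boundary value to be carried along.\<close>

lemma wave_limits:
  assumes F: "wave_on_dS4 F" and w: "on_S3 w"
  shows "((\<lambda>c. hext 1 F (w + c *\<^sub>R e0)) \<longlongrightarrow> past_limit F w) (at_right (-1))"
    and "((\<lambda>c. hext 1 F (w + c *\<^sub>R e0)) \<longlongrightarrow> - past_limit F (- w)) (at_left 1)"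
proof -
  obtain G H1 H2 where "conformal_wave (hext 1 G) H1 H2" and GF: "\<And>x. x \<in> dS4 \<Longrightarrow> G x = F x"
    using F by (auto simp: wave_on_dS4_def)
  then interpret conformal_wave "hext 1 G" H1 H2 by simp
  have eq: "hext 1 G X = hext 1 F X" if "X \<in> cone" for X by (rule hext_cong[OF GF that])
  have P: "((\<lambda>c. hext 1 F (w + c *\<^sub>R e0)) \<longlongrightarrow> past w) (at_right (-1))" if "on_S3 w" for w
    by (rule Lim_transform_eventually[OF tendsto_past[OF that]])
       (rule eventually_mono[OF eventually_slice_right], intro eq slice_in_cone that)
  have L: "past_limit F w = past w" if "on_S3 w" for w
    unfolding past_limit_def by (rule tendsto_Lim[OF trivial_limit_at_right_real P[OF that]])
  show "((\<lambda>c. hext 1 F (w + c *\<^sub>R e0)) \<longlongrightarrow> past_limit F w) (at_right (-1))"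
    using P[OF w] L[OF w] by simp
  have "((\<lambda>c. hext 1 F (w + c *\<^sub>R e0)) \<longlongrightarrow> future w) (at_left 1)"
    by (rule Lim_transform_eventually[OF tendsto_future[OF w]])
       (rule eventually_mono[OF eventually_slice_left], intro eq slice_in_cone w)
  then show "((\<lambda>c. hext 1 F (w + c *\<^sub>R e0)) \<longlongrightarrow> - past_limit F (- w)) (at_left 1)"
    using L[OF on_S3_minus[OF w]] future_eq_minus_past_antipode[OF w] by simp
qed

lemma dS4_slice:
  assumes "x \<in> dS4"
  obtains w c t where "on_S3 w" "\<bar>c\<bar> < 1" "t > 0" "x = t *\<^sub>R (w + c *\<^sub>R e0)"
proof -
  define t where "t = sqrt (1 + (x$0)\<^sup>2)"
  have t: "t > 0" "t\<^sup>2 = 1 + (x$0)\<^sup>2" by (simp_all add: t_def add_pos_nonneg)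
  define w where "w = inverse t *\<^sub>R (x - (x$0) *\<^sub>R e0)"
  define c where "c = x$0 / t"
  have "mink x x = 1" using assms by (simp add: dS4_def)
  then have "mink (x - (x$0) *\<^sub>R e0) (x - (x$0) *\<^sub>R e0) = t\<^sup>2"
    using t(2) by (simp add: mink_linear mink_e0 power2_eq_square)
  then have "on_S3 w" using t(1) by (simp add: on_S3_def w_def mink_linear mink_e0 power2_eq_square field_simps)
  moreover have "(x$0)\<^sup>2 < t\<^sup>2" using t by simp
  then have "\<bar>c\<bar> < 1" using t(1) power2_less_imp_less[of "\<bar>x$0\<bar>" t] by (simp add: c_def)
  moreover have "x = t *\<^sub>R (w + c *\<^sub>R e0)" using t(1) by (simp add: w_def c_def algebra_simps)
  ultimately show thesis using that t(1) by blast
qed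

lemma even_of_past_limit_zero:
  assumes F: "wave_on_dS4 F" and 0: "\<And>w. on_S3 w \<Longrightarrow> past_limit F w = 0" and x: "x \<in> dS4"
  shows "F (- x) = F x"
proof -
  obtain G H1 H2 where "conformal_wave (hext 1 G) H1 H2" and GF: "\<And>x. x \<in> dS4 \<Longrightarrow> G x = F x"
    using F by (auto simp: wave_on_dS4_def)
  then interpret conformal_wave "hext 1 G" H1 H2 by simp
  have eq: "hext 1 F X = hext 1 G X" if "X \<in> cone" for X by (rule hext_cong[OF GF[symmetric] that])
  have P0: "past w = 0" if "on_S3 w" for w
  proof -
    have "((\<lambda>c. hext 1 F (w + c *\<^sub>R e0)) \<longlongrightarrow> past w) (at_right (-1))"
      by (rule Lim_transform_eventually[OF tendsto_past[OF that]])
         (rule eventually_mono[OF eventually_slice_right], intro eq[symmetric] slice_in_cone that)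
    from tendsto_unique[OF trivial_limit_at_right_real this wave_limits(1)[OF F that]] 0[OF that] show ?thesis by simp
  qed
  obtain w c t where w: "on_S3 w" and c: "\<bar>c\<bar> < 1" and t: "t > 0" and xe: "x = t *\<^sub>R (w + c *\<^sub>R e0)"
    using dS4_slice[OF x] by blast
  have mx: "- x \<in> dS4" using x by (simp add: dS4_def mink_linear)
  have "hext 1 G (- (w + c *\<^sub>R e0)) = hext 1 G (w + c *\<^sub>R e0)"
    by (rule antipodal_of_past_zero[OF P0 w c])
  then have "hext 1 G (t *\<^sub>R (- (w + c *\<^sub>R e0))) = hext 1 G (t *\<^sub>R (w + c *\<^sub>R e0))"
    using hext_hom[OF t] by metis
  moreover have "t *\<^sub>R (- (w + c *\<^sub>R e0)) = - x" unfolding xe by (simp only: scaleR_minus_right)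
  ultimately have "hext 1 G (- x) = hext 1 G x" using xe by simp
  then show ?thesis using hext_dS4[OF x] hext_dS4[OF mx] GF x mx by simp
qed

section \<open>The Levi-Civita symbol and duality\<close>

text \<open>The factor that one pair of positions contributes to \<open>perm_sign\<close>;
  antisymmetry of \<open>levi\<close> then becomes the oddness of \<open>sg5\<close>.\<close>

definition sg5 :: "5 \<Rightarrow> 5 \<Rightarrow> real" where
  "sg5 a b = (if a < b then 1 else if a = b then 0 else - 1)"

lemma sg5_self [simp]: "sg5 a a = 0" and sg5_swap: "sg5 b a = - sg5 a b"
  by (auto simp: sg5_def)

lemma levi_sg5:
  "levi a b c d e = sg5 a b * sg5 a c * sg5 a d * sg5 a e * sg5 b c * sg5 b d * sg5 b e * sg5 c d * sg5 c e * sg5 d e"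
proof -
  have [simp]: "{..<length [a, b, c, d, e]} = {0, 1, 2, 3, 4}" by auto
  show ?thesis unfolding levi_def perm_sign_def by (simp add: sg5_def)
qed

lemma levi_swap:
  "levi b a c d e = - levi a b c d e" "levi a c b d e = - levi a b c d e"
  "levi a b d c e = - levi a b c d e" "levi a b c e d = - levi a b c d e"
  unfolding levi_sg5
  by (simp_all add: sg5_swap[of b a] sg5_swap[of c b] sg5_swap[of d c] sg5_swap[of e d])

lemma levi_swap_far:
  "levi c b a d e = - levi a b c d e" "levi d b c a e = - levi a b c d e" "levi e b c d a = - levi a b c d e"
  "levi a d c b e = - levi a b c d e" "levi a e c d b = - levi a b c d e" "levi a b e d c = - levi a b c d e"
  unfolding levi_sg5
  by (simp_all add: sg5_swap[of b a] sg5_swap[of c a] sg5_swap[of d a] sg5_swap[of e a] sg5_swap[of c b]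
      sg5_swap[of d b] sg5_swap[of e b] sg5_swap[of d c] sg5_swap[of e c] sg5_swap[of e d])

lemma levi_repeat [simp]:
  "levi a a c d e = 0" "levi a b a d e = 0" "levi a b c a e = 0" "levi a b c d a = 0" "levi a b b d e = 0"
  "levi a b c b e = 0" "levi a b c d b = 0" "levi a b c c e = 0" "levi a b c d c = 0" "levi a b c d d = 0"
  unfolding levi_sg5 by simp_all

lemma levi_nonzero: "distinct [a, b, c, d, e] \<Longrightarrow> levi a b c d e \<noteq> 0"
  unfolding levi_sg5 by (auto simp: sg5_def)

lemma distinct5_UNIV:
  fixes a :: 5
  assumes "distinct [a, b, c, d, e]"
  shows "UNIV = {a, b, c, d, e}"
proof -
  have "card {a, b, c, d, e} = CARD(5)" using distinct_card[OF assms] by simp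
  then show ?thesis using card_eq_UNIV_imp_eq_UNIV[of "{a, b, c, d, e}"] by simp
qed

definition kd :: "5 \<Rightarrow> 5 \<Rightarrow> real" where "kd a b = (if a = b then 1 else 0)"

text \<open>There are only five index values, so antisymmetrizing over the six upper indices of levi and kd gives zero.\<close>

lemma levi_exchange:
  "levi a b c d e * kd p \<alpha> = levi p b c d e * kd a \<alpha> + levi a p c d e * kd b \<alpha> + levi a b p d e * kd c \<alpha>
    + levi a b c p e * kd d \<alpha> + levi a b c d p * kd e \<alpha>"
proof (cases "distinct [a, b, c, d, e]")
  case True
  have "p \<in> {a, b, c, d, e}" "\<alpha> \<in> {a, b, c, d, e}" using distinct5_UNIV[OF True] by blast+
  then show ?thesis using True by (auto simp: kd_def)
next
  case False
  then consider "a = b" | "a = c" | "a = d" | "a = e" | "b = c" | "b = d" | "b = e" | "c = d" | "c = e" | "d = e"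
    by auto
  then show ?thesis
    by cases
      (simp_all add: kd_def levi_swap(1)[where b=p and a=\<alpha>] levi_swap_far(1)[where c=p and a=\<alpha>]
        levi_swap_far(2)[where d=p and a=\<alpha>] levi_swap_far(3)[where e=p and a=\<alpha>] levi_swap(2)[where c=p and b=\<alpha>]
        levi_swap_far(4)[where d=p and b=\<alpha>] levi_swap_far(5)[where e=p and b=\<alpha>] levi_swap(3)[where d=p and c=\<alpha>]
        levi_swap_far(6)[where e=p and c=\<alpha>] levi_swap(4)[where e=p and d=\<alpha>])
qed

section \<open>Contractions with the Levi-Civita symbol\<close>

definition lev3 :: "5 \<Rightarrow> 5 \<Rightarrow> (5 \<Rightarrow> 5 \<Rightarrow> 5 \<Rightarrow> complex) \<Rightarrow> complex" where
  "lev3 m n A = (\<Sum>\<rho>\<in>UNIV. \<Sum>\<sigma>\<in>UNIV. \<Sum>l\<in>UNIV. of_real (levi m n \<rho> \<sigma> l) * A \<rho> \<sigma> l)"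

lemma lev3_swap: "lev3 n m A = - lev3 m n A"
  by (simp add: lev3_def levi_swap(1)[of n m] sum_negf)

lemma lev3_cmult: "lev3 m n (\<lambda>\<rho> \<sigma> l. c * A \<rho> \<sigma> l) = c * lev3 m n A"
  by (simp add: lev3_def sum_distrib_left mult_ac)

text \<open>\<open>levi_exchange\<close> contracted with B. Moving p into one of the three summed
  positions produces a trace of B with its last index; the third trace stays in the formula because
  in \<open>star_wedge\<close> it is the norm of the normal times the field.\<close>

lemma lev3_exchange:
  assumes t1: "\<And>\<sigma> l. (\<Sum>\<rho>\<in>UNIV. B \<rho> \<sigma> l \<rho>) = 0" and t2: "\<And>\<rho> l. (\<Sum>\<sigma>\<in>UNIV. B \<rho> \<sigma> l \<sigma>) = 0"
  shows "lev3 m n (\<lambda>\<rho> \<sigma> l. B \<rho> \<sigma> l p) = lev3 p n (\<lambda>\<rho> \<sigma> l. B \<rho> \<sigma> l m) + lev3 m p (\<lambda>\<rho> \<sigma> l. B \<rho> \<sigma> l n)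
    + (\<Sum>\<rho>\<in>UNIV. \<Sum>\<sigma>\<in>UNIV. of_real (levi m n \<rho> \<sigma> p) * (\<Sum>l\<in>UNIV. B \<rho> \<sigma> l l))"
proof -
  have kd: "(\<Sum>\<alpha>\<in>UNIV. of_real (kd q \<alpha>) * f \<alpha>) = f q" for q and f :: "5 \<Rightarrow> complex"
    by (simp add: kd_def of_real_def if_distrib[of "\<lambda>x. x *\<^sub>R _"] if_distrib[of "\<lambda>x. x * _"] cong: if_cong)
  have "of_real (levi m n \<rho> \<sigma> l) * B \<rho> \<sigma> l p = of_real (levi p n \<rho> \<sigma> l) * B \<rho> \<sigma> l m + of_real (levi m p \<rho> \<sigma> l) * B \<rho> \<sigma> l n
     + of_real (levi m n p \<sigma> l) * B \<rho> \<sigma> l \<rho> + of_real (levi m n \<rho> p l) * B \<rho> \<sigma> l \<sigma> + of_real (levi m n \<rho> \<sigma> p) * B \<rho> \<sigma> l l" for \<rho> \<sigma> l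
  proof -
    have "(\<Sum>\<alpha>\<in>UNIV. of_real (levi m n \<rho> \<sigma> l * kd p \<alpha>) * B \<rho> \<sigma> l \<alpha>) =
      (\<Sum>\<alpha>\<in>UNIV. of_real (levi p n \<rho> \<sigma> l) * (of_real (kd m \<alpha>) * B \<rho> \<sigma> l \<alpha>) + of_real (levi m p \<rho> \<sigma> l) * (of_real (kd n \<alpha>) * B \<rho> \<sigma> l \<alpha>)
       + of_real (levi m n p \<sigma> l) * (of_real (kd \<rho> \<alpha>) * B \<rho> \<sigma> l \<alpha>) + of_real (levi m n \<rho> p l) * (of_real (kd \<sigma> \<alpha>) * B \<rho> \<sigma> l \<alpha>)
       + of_real (levi m n \<rho> \<sigma> p) * (of_real (kd l \<alpha>) * B \<rho> \<sigma> l \<alpha>))"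
      unfolding levi_exchange[of m n \<rho> \<sigma> l p] by (simp add: algebra_simps)
    then show ?thesis unfolding of_real_mult mult.assoc sum.distrib sum_distrib_left[symmetric] kd .
  qed
  note pt = this
  have 3: "(\<Sum>\<rho>\<in>UNIV. \<Sum>\<sigma>\<in>UNIV. \<Sum>l\<in>UNIV. of_real (levi m n p \<sigma> l) * B \<rho> \<sigma> l \<rho>) = 0"
  proof -
    have "(\<Sum>\<rho>\<in>UNIV. \<Sum>\<sigma>\<in>UNIV. \<Sum>l\<in>UNIV. of_real (levi m n p \<sigma> l) * B \<rho> \<sigma> l \<rho>)
      = (\<Sum>\<sigma>\<in>UNIV. \<Sum>\<rho>\<in>UNIV. \<Sum>l\<in>UNIV. of_real (levi m n p \<sigma> l) * B \<rho> \<sigma> l \<rho>)" by (rule sum.swap)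
    also have "\<dots> = (\<Sum>\<sigma>\<in>UNIV. \<Sum>l\<in>UNIV. \<Sum>\<rho>\<in>UNIV. of_real (levi m n p \<sigma> l) * B \<rho> \<sigma> l \<rho>)"
      by (rule sum.cong[OF refl]) (rule sum.swap)
    finally show ?thesis by (simp add: sum_distrib_left[symmetric] t1)
  qed
  have 4: "(\<Sum>\<rho>\<in>UNIV. \<Sum>\<sigma>\<in>UNIV. \<Sum>l\<in>UNIV. of_real (levi m n \<rho> p l) * B \<rho> \<sigma> l \<sigma>) = 0"
  proof -
    have "(\<Sum>\<rho>\<in>UNIV. \<Sum>\<sigma>\<in>UNIV. \<Sum>l\<in>UNIV. of_real (levi m n \<rho> p l) * B \<rho> \<sigma> l \<sigma>)
      = (\<Sum>\<rho>\<in>UNIV. \<Sum>l\<in>UNIV. \<Sum>\<sigma>\<in>UNIV. of_real (levi m n \<rho> p l) * B \<rho> \<sigma> l \<sigma>)"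
      by (rule sum.cong[OF refl]) (rule sum.swap)
    then show ?thesis by (simp add: sum_distrib_left[symmetric] t2)
  qed
  show ?thesis unfolding lev3_def pt sum.distrib 3 4 by (simp add: sum_distrib_left)
qed

text \<open>If m and n are the two index values different from a, b, c, only the six permutations of
  a, b, c contribute to \<open>lev3 m n A\<close>.\<close>

lemma lev3_zero_imp_alternating_zero:
  assumes A: "\<And>m n. lev3 m n A = 0"
  shows "A a b c - A b a c - A a c b - A c b a + A b c a + A c a b = 0"
proof (cases "distinct [a, b, c]")
  case False
  then show ?thesis by auto
next
  case True
  have "\<exists>m n. distinct [m, n, a, b, c]"
  proof -
    have c: "card {a, b, c} = 3" using distinct_card[OF True] by simp
    then have "{a, b, c} \<noteq> UNIV" by auto
    then obtain m where m: "m \<notin> {a, b, c}" by blast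
    then have "card {m, a, b, c} = 4" using c by (subst card_insert_disjoint) auto
    then have "{m, a, b, c} \<noteq> UNIV" by auto
    then obtain n where "n \<notin> {m, a, b, c}" by blast
    with m True show ?thesis by (intro exI[of _ m] exI[of _ n]) auto
  qed
  then obtain m n where d: "distinct [m, n, a, b, c]" by blast
  have sumU: "sum f UNIV = f m + f n + f a + f b + f c" for f :: "5 \<Rightarrow> complex"
    unfolding distinct5_UNIV[OF d] using d by (simp add: add.assoc)
  have "lev3 m n A = of_real (levi m n a b c) * (A a b c - A b a c - A a c b - A c b a + A b c a + A c a b)"
    unfolding lev3_def sumU
    by (simp add: levi_swap(3)[of m n b a] levi_swap(4)[of m n a c b] levi_swap_far(6)[of m n c b a]
        levi_swap(3)[of m n b c a] levi_swap(4)[of m n c a b] levi_swap(4)[of m n b c a] algebra_simps)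
  then show ?thesis using A[of m n] levi_nonzero[OF d] by simp
qed

text \<open>The argument that gives the Riemann tensor its pair symmetry: the cyclic identities for
  the four cyclic shifts of m, n, p, q are added with suitable signs.\<close>

lemma antisym_cyclic_imp_pair_symmetric:
  fixes U :: "'a \<Rightarrow> 'a \<Rightarrow> 'a \<Rightarrow> 'a \<Rightarrow> complex"
  assumes a1: "\<And>m n p q. U n m p q = - U m n p q" and a2: "\<And>m n p q. U m n q p = - U m n p q"
    and c: "\<And>m n p q. U m n p q + U n p m q + U p m n q = 0"
  shows "U m n p q = U p q m n"
proof -
  have "U n p m q + U p q m n + U n q p m = - (U n p q m + U p q n m + U q n p m)"
    by (simp add: a2[of n p m q] a2[of p q m n] a1[of n q p m])
  then have 2: "U n p m q + U p q m n + U n q p m = 0" using c[of n p q m] by simp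
  have "U p q m n + U m q n p + U p m n q = U p q m n + U q m p n + U m p q n"
    by (simp add: a1[of m q p n] a2[of m q n p] a1[of p m q n] a2[of p m n q])
  then have 3: "U p q m n + U m q n p + U p m n q = 0" using c[of p q m n] by simp
  have "U m q n p + U m n p q + U n q p m = - (U q m n p + U m n q p + U n q m p)"
    by (simp add: a1[of m q n p] a2[of m n p q] a2[of n q p m])
  then have 4: "U m q n p + U m n p q + U n q p m = 0" using c[of q m n p] by simp
  have "2 * (U m n p q - U p q m n) = (U m n p q + U n p m q + U p m n q) + (U m q n p + U m n p q + U n q p m)
     - (U n p m q + U p q m n + U n q p m) - (U p q m n + U m q n p + U p m n q)"
    by (simp add: algebra_simps)
  then show ?thesis using 2 3 4 c[of m n p q] by simp
qed

text \<open>Twice the Hodge dual in the tangent space with normal x, with upper indices m and n;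
  \<open>dual\<close> lowers them and restores the factor 1/2.\<close>

definition star :: "real^5 \<Rightarrow> (5 \<Rightarrow> 5 \<Rightarrow> complex) \<Rightarrow> 5 \<Rightarrow> 5 \<Rightarrow> complex" where
  "star x F m n = lev3 m n (\<lambda>\<rho> \<sigma> l. of_real (lower x l) * F \<rho> \<sigma>)"

lemma star_swap: "star x F n m = - star x F m n"
  by (simp add: star_def lev3_swap[of n m])

text \<open>Exchanging p with the indices of the symbol produces only traces of T and contractions
  with x, which vanish. So the trace condition on T turns into the cyclic identity for its left
  dual, and the cyclic identity implies pair symmetry.\<close>

lemma star_pair_symmetric:
  fixes T :: "5 \<Rightarrow> 5 \<Rightarrow> 5 \<Rightarrow> 5 \<Rightarrow> complex"
  assumes anti: "\<And>m n p q. T n m p q = - T m n p q" and pair: "\<And>m n p q. T m n p q = T p q m n"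
    and trace: "\<And>n q. (\<Sum>\<alpha>\<in>UNIV. of_real (eta \<alpha>) * T \<alpha> n \<alpha> q) = 0"
    and tan: "\<And>n p q. (\<Sum>\<alpha>\<in>UNIV. of_real (x$\<alpha>) * T \<alpha> n p q) = 0"
  shows "of_real (eta m * eta n) * star x (\<lambda>\<rho> \<sigma>. T \<rho> \<sigma> p q) m n = of_real (eta p * eta q) * star x (\<lambda>\<rho> \<sigma>. T \<rho> \<sigma> m n) p q"
proof -
  define U where "U m n p q = of_real (eta m * eta n) * star x (\<lambda>\<rho> \<sigma>. T \<rho> \<sigma> p q) m n" for m n p q
  have tr2: "(\<Sum>\<alpha>\<in>UNIV. of_real (eta \<alpha>) * T n \<alpha> \<alpha> q) = 0" for n q
    using trace[of n q] by (simp add: anti[of n] sum_negf)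
  have tan3: "(\<Sum>\<alpha>\<in>UNIV. of_real (x$\<alpha>) * T m n \<alpha> q) = 0" for m n q
    using tan[of q m n] by (simp add: pair[of m n])
  have ex: "of_real (eta p) * star x (\<lambda>\<rho> \<sigma>. T \<rho> \<sigma> p q) m n = of_real (eta m) * star x (\<lambda>\<rho> \<sigma>. T \<rho> \<sigma> m q) p n
     + of_real (eta n) * star x (\<lambda>\<rho> \<sigma>. T \<rho> \<sigma> n q) m p" for m n p q
  proof -
    let ?B = "\<lambda>\<rho> \<sigma> l \<alpha>. of_real (eta \<alpha>) * (of_real (lower x l) * T \<rho> \<sigma> \<alpha> q)"
    have "(\<Sum>\<rho>\<in>UNIV. ?B \<rho> \<sigma> l \<rho>) = of_real (lower x l) * (\<Sum>\<rho>\<in>UNIV. of_real (eta \<rho>) * T \<rho> \<sigma> \<rho> q)" for \<sigma> l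
      by (simp add: sum_distrib_left mult_ac)
    moreover have "(\<Sum>\<sigma>\<in>UNIV. ?B \<rho> \<sigma> l \<sigma>) = of_real (lower x l) * (\<Sum>\<sigma>\<in>UNIV. of_real (eta \<sigma>) * T \<rho> \<sigma> \<sigma> q)" for \<rho> l
      by (simp add: sum_distrib_left mult_ac)
    moreover have "(\<Sum>l\<in>UNIV. ?B \<rho> \<sigma> l l) = 0" for \<rho> \<sigma>
      using tan3[of \<rho> \<sigma> q] by (simp add: lower_def mult.assoc eta_sq_complex)
    ultimately have "lev3 m n (\<lambda>\<rho> \<sigma> l. ?B \<rho> \<sigma> l p) = lev3 p n (\<lambda>\<rho> \<sigma> l. ?B \<rho> \<sigma> l m) + lev3 m p (\<lambda>\<rho> \<sigma> l. ?B \<rho> \<sigma> l n)"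
      using lev3_exchange[of ?B m n p] by (simp add: trace tr2)
    then show ?thesis unfolding star_def lev3_cmult .
  qed
  have U3: "U m n p q = U p n m q + U m p n q" for m n p q
  proof -
    have "U m n p q = of_real (eta m) * of_real (eta n) * of_real (eta p) * (of_real (eta p) * star x (\<lambda>\<rho> \<sigma>. T \<rho> \<sigma> p q) m n)"
      by (simp add: U_def eta_sq_complex mult.assoc)
    also have "\<dots> = U p n m q + U m p n q"
      unfolding ex[where m=m and n=n and p=p and q=q] by (simp add: U_def algebra_simps eta_sq_complex)
    finally show ?thesis .
  qed
  have a1: "U n m p q = - U m n p q" for m n p q by (simp add: U_def star_swap[of x _ n m] mult.commute)
  have a2: "U m n q p = - U m n p q" for m n p q
  proof -
    have "T \<rho> \<sigma> q p = - T \<rho> \<sigma> p q" for \<rho> \<sigma> using pair[of \<rho> \<sigma> q p] anti[of q p \<rho> \<sigma>] pair[of p q \<rho> \<sigma>] by simp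
    then show ?thesis by (simp add: U_def star_def lev3_def sum_negf)
  qed
  have "U m n p q = U p q m n"
  proof (rule antisym_cyclic_imp_pair_symmetric[OF a1 a2])
    show "U m n p q + U n p m q + U p m n q = 0" for m n p q
      using U3[of m n p q] by (simp only: a1[of n p m q] a1[of p m n q]) simp
  qed
  then show ?thesis by (simp add: U_def)
qed

text \<open>As the left dual is the right dual, its divergence vanishes too; this says that the
  dual of the antisymmetrized derivative is annihilated by x, and tangentiality then makes it zero.\<close>

lemma bianchi_of_divergence_free:
  fixes R :: "5 \<Rightarrow> 5 \<Rightarrow> 5 \<Rightarrow> 5 \<Rightarrow> 5 \<Rightarrow> complex"
  assumes x: "mink x x = 1"
    and anti: "\<And>a m n p q. R a n m p q = - R a m n p q" and pair: "\<And>a m n p q. R a m n p q = R a p q m n"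
    and trace: "\<And>a n q. (\<Sum>\<alpha>\<in>UNIV. of_real (eta \<alpha>) * R a \<alpha> n \<alpha> q) = 0"
    and tan: "\<And>a n p q. (\<Sum>\<alpha>\<in>UNIV. of_real (x$\<alpha>) * R a \<alpha> n p q) = 0"
    and tan0: "\<And>m n p q. (\<Sum>\<alpha>\<in>UNIV. of_real (x$\<alpha>) * R \<alpha> m n p q) = 0"
    and div: "\<And>n p q. (\<Sum>\<alpha>\<in>UNIV. of_real (eta \<alpha>) * R \<alpha> \<alpha> n p q) = 0"
  shows "R a m n p q + R m n a p q + R n a m p q = 0"
proof -
  have x': "(\<Sum>l\<in>UNIV. complex_of_real (x$l) * of_real (lower x l)) = 1"
    using x lower_sum[of x x] by (simp flip: of_real_mult of_real_sum)
  define A where "A a \<rho> \<sigma> = R a \<rho> \<sigma> p q" for a \<rho> \<sigma>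
  have tan2: "(\<Sum>\<alpha>\<in>UNIV. of_real (x$\<alpha>) * R a n \<alpha> p q) = 0" for a n p q
    using tan[of a n p q] by (simp add: anti[of a n] sum_negf)
  \<comment> \<open>The pair symmetry shifts the dual to the pair p, q; the sum over a then
    contracts the derivative with an undualized pair, where it is a divergence.\<close>
  have Z: "(\<Sum>a\<in>UNIV. star x (\<lambda>\<rho> \<sigma>. R a \<rho> \<sigma> p q) a n) = 0" for n
  proof -
    have sym: "of_real (eta a * eta n) * star x (\<lambda>\<rho> \<sigma>. R a \<rho> \<sigma> p q) a n = of_real (eta p * eta q) * star x (\<lambda>\<rho> \<sigma>. R a \<rho> \<sigma> a n) p q" for a
      by (rule star_pair_symmetric[where T="R a"]) (fact anti pair trace tan)+
    have "of_real (eta n) * (\<Sum>a\<in>UNIV. star x (\<lambda>\<rho> \<sigma>. R a \<rho> \<sigma> p q) a n) =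
      (\<Sum>a\<in>UNIV. of_real (eta a) * (of_real (eta a * eta n) * star x (\<lambda>\<rho> \<sigma>. R a \<rho> \<sigma> p q) a n))"
      by (simp add: sum_distrib_left eta_sq_complex mult.assoc)
    also have "\<dots> = of_real (eta p * eta q) * (\<Sum>a\<in>UNIV. star x (\<lambda>\<rho> \<sigma>. of_real (eta a) * R a a n \<rho> \<sigma>) p q)"
      unfolding sym unfolding star_def by (simp add: sum_distrib_left lev3_def mult_ac pair[of _ _ _ _ n])
    also have "(\<Sum>a\<in>UNIV. star x (\<lambda>\<rho> \<sigma>. of_real (eta a) * R a a n \<rho> \<sigma>) p q) =
      (\<Sum>\<rho>\<in>UNIV. \<Sum>\<sigma>\<in>UNIV. \<Sum>l\<in>UNIV. of_real (levi p q \<rho> \<sigma> l) * (of_real (lower x l) * (\<Sum>a\<in>UNIV. of_real (eta a) * R a a n \<rho> \<sigma>)))"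
      unfolding star_def lev3_def sum_distrib_left
      by (subst sum.swap, rule sum.cong[OF refl], subst sum.swap, rule sum.cong[OF refl], rule sum.swap)
    finally show ?thesis using eta_sq_complex(1)[of n] by (auto simp: div)
  qed
  have V0: "(\<Sum>l\<in>UNIV. of_real (lower x l) * lev3 n l A) = 0" for n
  proof -
    have lev: "levi n l a \<rho> \<sigma> = levi a n \<rho> \<sigma> l" for l a \<rho> \<sigma>
      using levi_swap(1)[of a n \<rho> \<sigma> l] levi_swap(2)[of n a l \<rho> \<sigma>] levi_swap(3)[of n a \<rho> l \<sigma>] levi_swap(4)[of n a \<rho> \<sigma> l] by simp
    have "(\<Sum>l\<in>UNIV. of_real (lower x l) * lev3 n l A) =
      (\<Sum>l\<in>UNIV. \<Sum>a\<in>UNIV. \<Sum>\<rho>\<in>UNIV. \<Sum>\<sigma>\<in>UNIV. of_real (levi a n \<rho> \<sigma> l) * (of_real (lower x l) * A a \<rho> \<sigma>))"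
      unfolding lev3_def lev by (simp add: sum_distrib_left mult_ac)
    also have "\<dots> = (\<Sum>a\<in>UNIV. \<Sum>\<rho>\<in>UNIV. \<Sum>\<sigma>\<in>UNIV. \<Sum>l\<in>UNIV. of_real (levi a n \<rho> \<sigma> l) * (of_real (lower x l) * A a \<rho> \<sigma>))"
      by (subst sum.swap, rule sum.cong[OF refl], subst sum.swap, rule sum.cong[OF refl], rule sum.swap)
    also have "\<dots> = 0" using Z[of n] by (simp add: star_def lev3_def A_def)
    finally show ?thesis .
  qed
  \<comment> \<open>Exchanging p against the normal leaves only terms with free index p, n or l;
    contracted with x in the index l, the first two vanish by \<open>V0\<close> and the last gives
    \<open>lev3 n p A\<close> because x has norm 1.\<close>
  have V: "lev3 n p A = 0" for n p
  proof -
    have "of_real (x$p) * lev3 n l A = of_real (x$n) * lev3 p l A + of_real (x$l) * lev3 n p A" for l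
      using lev3_exchange[of "\<lambda>a \<rho> \<sigma> \<alpha>. of_real (x$\<alpha>) * A a \<rho> \<sigma>" n l p]
      by (simp add: A_def[abs_def] tan tan0 tan2 lev3_cmult)
    then have "(\<Sum>l\<in>UNIV. of_real (lower x l) * (of_real (x$p) * lev3 n l A)) =
      (\<Sum>l\<in>UNIV. of_real (lower x l) * (of_real (x$n) * lev3 p l A + of_real (x$l) * lev3 n p A))" by simp
    also have "\<dots> = of_real (x$n) * (\<Sum>l\<in>UNIV. of_real (lower x l) * lev3 p l A)
       + (\<Sum>l\<in>UNIV. of_real (x$l) * of_real (lower x l)) * lev3 n p A"
      by (simp add: distrib_left sum.distrib sum_distrib_left sum_distrib_right mult_ac)
    also have "\<dots> = lev3 n p A" by (simp add: V0 x')
    also have "(\<Sum>l\<in>UNIV. of_real (lower x l) * (of_real (x$p) * lev3 n l A)) = of_real (x$p) * (\<Sum>l\<in>UNIV. of_real (lower x l) * lev3 n l A)"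
      by (simp add: sum_distrib_left mult_ac)
    finally show ?thesis by (simp add: V0)
  qed
  have "2 * (A a m n + A m n a + A n a m) = 0"
    using lev3_zero_imp_alternating_zero[OF V, of a m n]
    by (simp add: A_def anti[of a n m p q] anti[of m a n p q] anti[of n m a p q] algebra_simps)
  from this[unfolded mult_eq_0_iff] show ?thesis by (simp add: A_def)
qed

text \<open>\<open>lev3_exchange\<close> with the normal as the exchanged vector. The remaining
  trace is that of x with itself, so on dS4 the wedge of x with the dual returns the field; on
  slices near infinity this term becomes small, see \<open>wedge_dual\<close>.\<close>

lemma star_wedge:
  assumes tan: "\<And>\<sigma>. (\<Sum>\<alpha>\<in>UNIV. of_real (x$\<alpha>) * F \<alpha> \<sigma>) = 0" and anti: "\<And>m n. F n m = - F m n"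
  shows "of_real (x$p) * star x F m n = of_real (x$m) * star x F p n + of_real (x$n) * star x F m p
    + of_real (mink x x) * (\<Sum>\<rho>\<in>UNIV. \<Sum>\<sigma>\<in>UNIV. of_real (levi m n \<rho> \<sigma> p) * F \<rho> \<sigma>)"
proof -
  let ?B = "\<lambda>\<rho> \<sigma> l \<alpha>. of_real (x$\<alpha>) * (of_real (lower x l) * F \<rho> \<sigma>)"
  have "(\<Sum>\<rho>\<in>UNIV. ?B \<rho> \<sigma> l \<rho>) = of_real (lower x l) * (\<Sum>\<rho>\<in>UNIV. of_real (x$\<rho>) * F \<rho> \<sigma>)" for \<sigma> l
    by (simp add: sum_distrib_left mult_ac)
  moreover have "(\<Sum>\<sigma>\<in>UNIV. ?B \<rho> \<sigma> l \<sigma>) = - (of_real (lower x l) * (\<Sum>\<sigma>\<in>UNIV. of_real (x$\<sigma>) * F \<sigma> \<rho>))" for \<rho> l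
    by (simp add: sum_distrib_left mult_ac anti[of \<rho>] sum_negf)
  moreover have "(\<Sum>l\<in>UNIV. ?B \<rho> \<sigma> l l) = of_real (mink x x) * F \<rho> \<sigma>" for \<rho> \<sigma>
    unfolding lower_sum[of x x, symmetric] by (simp add: sum_distrib_right mult.assoc)
  ultimately have "lev3 m n (\<lambda>\<rho> \<sigma> l. ?B \<rho> \<sigma> l p) = lev3 p n (\<lambda>\<rho> \<sigma> l. ?B \<rho> \<sigma> l m) + lev3 m p (\<lambda>\<rho> \<sigma> l. ?B \<rho> \<sigma> l n)
    + (\<Sum>\<rho>\<in>UNIV. \<Sum>\<sigma>\<in>UNIV. of_real (levi m n \<rho> \<sigma> p) * (of_real (mink x x) * F \<rho> \<sigma>))"
    using lev3_exchange[of ?B m n p] by (simp add: tan)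
  then show ?thesis unfolding star_def lev3_cmult by (simp add: sum_distrib_left mult_ac)
qed

lemma star_zero_imp_wedge_zero:
  assumes "\<And>m n. star x F m n = 0" and anti: "\<And>m n. F n m = - F m n"
  shows "of_real (lower x a) * F b c + of_real (lower x b) * F c a + of_real (lower x c) * F a b = 0"
proof -
  have "2 * (of_real (lower x a) * F b c + of_real (lower x b) * F c a + of_real (lower x c) * F a b) = 0"
    using lev3_zero_imp_alternating_zero[OF assms(1)[unfolded star_def], of a b c]
    by (simp add: anti[of c b] anti[of c a] anti[of b a] algebra_simps)
  from this[unfolded mult_eq_0_iff] show ?thesis by simp
qed

section \<open>The field equations on the ambient cone\<close>

lemma lists_len_0: "lists_len 0 = {[]}"
  by (auto simp: lists_len_def)

lemma lists_len_Suc: "lists_len (Suc n) = (\<lambda>(b, \<beta>s). b # \<beta>s) ` (UNIV \<times> lists_len n)"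
  by (auto simp: lists_len_def image_iff length_Suc_conv)

lemma sum_lists_len_Suc: "(\<Sum>\<beta>s\<in>lists_len (Suc n). f \<beta>s) = (\<Sum>b\<in>UNIV. \<Sum>\<beta>s\<in>lists_len n. f (b # \<beta>s))"
proof -
  have "(\<Sum>\<beta>s\<in>lists_len (Suc n). f \<beta>s) = (\<Sum>p\<in>UNIV \<times> lists_len n. f (fst p # snd p))"
    unfolding lists_len_Suc by (subst sum.reindex) (auto simp: inj_on_def split_beta)
  then show ?thesis by (simp add: sum.cartesian_product split_beta)
qed

lemma proj_tensor_Nil: "proj_tensor x T [] = T []"
  by (simp add: proj_tensor_def lists_len_0)

lemma proj_tensor_Cons:
  "proj_tensor x T (m # ms) = (\<Sum>b\<in>UNIV. of_real (Proj x m b) * proj_tensor x (\<lambda>\<beta>s. T (b # \<beta>s)) ms)"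
  by (simp add: proj_tensor_def sum_lists_len_Suc prod.lessThan_Suc_shift sum_distrib_left mult.assoc del: prod.lessThan_Suc)

lemma sum_Proj: "(\<Sum>b\<in>UNIV. of_real (Proj x m b) * (f b :: complex)) = f m - of_real (lower x m) * (\<Sum>b\<in>UNIV. of_real (x$b) * f b)"
proof -
  have "of_real (Proj x m b) * f b = (if m = b then f b else 0) - of_real (lower x m) * (of_real (x$b) * f b)" for b
    by (simp add: Proj_def algebra_simps)
  then show ?thesis by (simp add: sum_subtractf sum_distrib_left)
qed

lemma proj_tensor_sum:
  "proj_tensor x (\<lambda>\<beta>s. \<Sum>b\<in>B. c b * T b \<beta>s) ms = (\<Sum>b\<in>B. c b * proj_tensor x (T b) ms)"
  unfolding proj_tensor_def sum_distrib_left by (subst sum.swap) (simp add: mult_ac)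

text \<open>The correction by which the covariant derivative differs from the tangential ambient
  derivative: in each slot the normal component is replaced through the second fundamental form of
  dS4.\<close>

definition slot_sum :: "real^5 \<Rightarrow> 5 \<Rightarrow> (5 list \<Rightarrow> complex) \<Rightarrow> 5 list \<Rightarrow> complex" where
  "slot_sum x a T ms = (\<Sum>i<length ms. of_real (lower x (ms!i)) * T (ms[i := a]))"

lemma slot_sum_Nil [simp]: "slot_sum x a T [] = 0"
  by (simp add: slot_sum_def)

lemma slot_sum_Cons [simp]:
  "slot_sum x a T (m # ms) = of_real (lower x m) * T (a # ms) + slot_sum x a (\<lambda>l. T (m # l)) ms"
  by (simp add: slot_sum_def sum.lessThan_Suc_shift del: sum.lessThan_Suc)

text \<open>Expanding the product of projectors 1 - (normal part), every term with two or more
  normal contractions drops out, and only the terms linear in the normal remain.\<close>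

lemma proj_tensor_expand:
  assumes "\<And>ms' i j. length ms' = length ms \<Longrightarrow> i < length ms \<Longrightarrow> j < length ms \<Longrightarrow> i \<noteq> j \<Longrightarrow>
     (\<Sum>b\<in>UNIV. of_real (x$b) * (\<Sum>c\<in>UNIV. of_real (x$c) * T (ms'[i := b, j := c]))) = 0"
  shows "proj_tensor x T ms = T ms - (\<Sum>i<length ms. of_real (lower x (ms!i)) * (\<Sum>c\<in>UNIV. of_real (x$c) * T (ms[i := c])))"
  using assms
proof (induction ms arbitrary: T)
  case Nil
  then show ?case by (simp add: proj_tensor_Nil)
next
  case (Cons m ms)
  let ?K = "\<lambda>b. \<Sum>i<length ms. of_real (lower x (ms!i)) * (\<Sum>c\<in>UNIV. of_real (x$c) * T (b # ms[i := c]))"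
  have IH: "proj_tensor x (\<lambda>\<beta>s. T (b # \<beta>s)) ms = T (b # ms) - ?K b" for b
  proof (rule Cons.IH)
    fix ms' :: "5 list" and i j :: nat assume "length ms' = length ms" "i < length ms" "j < length ms" "i \<noteq> j"
    then show "(\<Sum>b'\<in>UNIV. of_real (x$b') * (\<Sum>c\<in>UNIV. of_real (x$c) * T (b # ms'[i := b', j := c]))) = 0"
      using Cons.prems[of "b # ms'" "Suc i" "Suc j"] by simp
  qed
  have z: "(\<Sum>b\<in>UNIV. of_real (x$b) * ?K b) = 0"
  proof -
    have "(\<Sum>b\<in>UNIV. of_real (x$b) * ?K b) = (\<Sum>i<length ms. of_real (lower x (ms!i)) * (\<Sum>b\<in>UNIV. of_real (x$b) * (\<Sum>c\<in>UNIV. of_real (x$c) * T (b # ms[i := c]))))"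
      unfolding sum_distrib_left by (subst sum.swap) (simp add: mult_ac)
    also have "\<dots> = 0"
      using Cons.prems[of "m # ms" 0 "Suc _"] by (intro sum.neutral) auto
    finally show ?thesis .
  qed
  have "proj_tensor x T (m # ms) = (T (m # ms) - ?K m) - of_real (lower x m) * ((\<Sum>b\<in>UNIV. of_real (x$b) * T (b # ms)) - (\<Sum>b\<in>UNIV. of_real (x$b) * ?K b))"
    unfolding proj_tensor_Cons IH sum_Proj by (simp add: right_diff_distrib sum_subtractf)
  then show ?case unfolding z by (simp add: sum.lessThan_Suc_shift del: sum.lessThan_Suc)
qed

section \<open>Algebraic identities and covariant derivative of a solution\<close>

locale spin_field =
  fixes s :: nat and U :: "(real^5) set" and \<Phi> :: "real^5 \<Rightarrow> 5 list \<Rightarrow> complex"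
  assumes s1: "s \<ge> 1" and U: "open U" "dS4 \<subseteq> U"
    and smooth: "\<And>ms. length ms = 2 * s \<Longrightarrow> smooth_on U (\<lambda>y. \<Phi> y ms)"
    and field_strength: "\<And>x. x \<in> dS4 \<Longrightarrow> field_strength_at s x (\<Phi> x)"
    and field_eqs: "field_eqs s \<Phi>"
begin

lemma diffable: "length ms = 2 * s \<Longrightarrow> x \<in> dS4 \<Longrightarrow> (\<lambda>y. \<Phi> y ms) differentiable (at x)"
  using smooth_on_differentiable[OF smooth] U by blast

lemma tangent:
  assumes "x \<in> dS4" "length ms = 2 * s" "i < 2 * s"
  shows "(\<Sum>\<alpha>\<in>UNIV. of_real (x$\<alpha>) * \<Phi> x (ms[i := \<alpha>])) = 0"
  by (rule field_strength[OF assms(1), unfolded field_strength_at_def, THEN conjunct1, rule_format])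
     (use assms(2-) in \<open>simp_all add: lists_len_def\<close>)

lemma traceless:
  assumes "x \<in> dS4" "length ms = 2 * s" "i < 2 * s" "j < 2 * s" "i \<noteq> j"
  shows "(\<Sum>\<alpha>\<in>UNIV. of_real (eta \<alpha>) * \<Phi> x (ms[i := \<alpha>, j := \<alpha>])) = 0"
  by (rule field_strength[OF assms(1), unfolded field_strength_at_def, THEN conjunct2, THEN conjunct2, THEN conjunct2, THEN conjunct1, rule_format])
     (use assms(2-) in \<open>simp_all add: lists_len_def\<close>)

lemma antisym_pos:
  assumes "x \<in> dS4" "length ms = 2 * s" "k < s"
  shows "\<Phi> x (swap_pos (2 * k) (2 * k + 1) ms) = - \<Phi> x ms"
  by (rule field_strength[OF assms(1), unfolded field_strength_at_def, THEN conjunct2, THEN conjunct1, rule_format])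
     (use assms(2-) in \<open>simp_all add: lists_len_def\<close>)

lemma pairsym_pos:
  assumes "x \<in> dS4" "length ms = 2 * s" "k < s" "l < s"
  shows "\<Phi> x (ms[2 * k := ms!(2 * l), 2 * k + 1 := ms!(2 * l + 1), 2 * l := ms!(2 * k), 2 * l + 1 := ms!(2 * k + 1)]) = \<Phi> x ms"
  by (rule field_strength[OF assms(1), unfolded field_strength_at_def, THEN conjunct2, THEN conjunct2, THEN conjunct1, rule_format])
     (use assms(2-) in \<open>simp_all add: lists_len_def\<close>)

lemma alt3_zero:
  assumes "x \<in> dS4" "length ms = 2 * s" "i < 2 * s" "j < 2 * s" "k < 2 * s" "i \<noteq> j" "j \<noteq> k" "i \<noteq> k"
  shows "alt3 (\<Phi> x) i j k ms = 0"
  by (rule field_strength[OF assms(1), unfolded field_strength_at_def, THEN conjunct2, THEN conjunct2, THEN conjunct2, THEN conjunct2, rule_format])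
     (use assms(2-) in \<open>simp_all add: lists_len_def\<close>)

lemma antisym: "x \<in> dS4 \<Longrightarrow> length r = 2 * s - 2 \<Longrightarrow> \<Phi> x (n # m # r) = - \<Phi> x (m # n # r)"
  using antisym_pos[of x "m # n # r" 0] s1 by (simp add: swap_pos_def)

lemma pairsym: "x \<in> dS4 \<Longrightarrow> s \<ge> 2 \<Longrightarrow> length r = 2 * s - 4 \<Longrightarrow> \<Phi> x (m # n # p # q # r) = \<Phi> x (p # q # m # n # r)"
  using pairsym_pos[of x "m # n # p # q # r" 0 1] by (simp add: numeral_2_eq_2 numeral_3_eq_3)

lemma cyclic:
  assumes "x \<in> dS4" "length r = 2 * s - 2" "j < length r"
  shows "\<Phi> x (b # c # r[j := a]) + \<Phi> x (c # a # r[j := b]) + \<Phi> x (a # b # r[j := c]) = 0"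
proof -
  have "2 * (\<Phi> x (b # c # r[j := a]) + \<Phi> x (c # a # r[j := b]) + \<Phi> x (a # b # r[j := c])) = 0"
    using alt3_zero[of x "b # c # r[j := a]" 0 1 "Suc (Suc j)"] assms s1
      antisym[of x "r[j := a]" c b] antisym[of x "r[j := b]" a c] antisym[of x "r[j := c]" b a]
    by (simp add: alt3_def Let_def algebra_simps)
  from this[unfolded mult_eq_0_iff] show ?thesis by simp
qed

text \<open>The tangency condition is differentiated; by the product rule the derivative of the
  coordinate gives the field itself in the slot i.\<close>

lemma contract_tder:
  assumes x: "x \<in> dS4" and ms: "length ms = 2 * s" "i < 2 * s"
  shows "(\<Sum>c\<in>UNIV. of_real (x$c) * tder a 0 (\<lambda>y. \<Phi> y (ms[i := c])) x) = - \<Phi> x (ms[i := a])"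
proof -
  have d: "(\<lambda>y. \<Phi> y (ms[i := c])) differentiable (at x)" for c using diffable ms x by simp
  have "0 = tder a 0 (\<lambda>y. \<Sum>c\<in>UNIV. of_real (y$c) * \<Phi> y (ms[i := c])) x"
    by (rule tder_zero[OF U, symmetric])
       (use tangent ms x in \<open>auto intro!: smooth_on_sum smooth_on_coord_mult smooth U(1)\<close>)
  also have "\<dots> = (\<Sum>c\<in>UNIV. tder a 0 (\<lambda>y. of_real (y$c) * \<Phi> y (ms[i := c])) x)"
    by (rule tder_sum)
       (use has_derivative_coord_mult[OF has_derivative_pd[OF d]] in \<open>auto simp: differentiable_def\<close>)
  also have "\<dots> = (\<Sum>c\<in>UNIV. (if a = c then \<Phi> x (ms[i := c]) else 0) + of_real (x$c) * tder a 0 (\<lambda>y. \<Phi> y (ms[i := c])) x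
      - of_real (lower x a) * (of_real (x$c) * \<Phi> x (ms[i := c])))"
  proof (rule sum.cong[OF refl])
    fix c
    show "tder a 0 (\<lambda>y. of_real (y$c) * \<Phi> y (ms[i := c])) x = (if a = c then \<Phi> x (ms[i := c]) else 0) + of_real (x$c) * tder a 0 (\<lambda>y. \<Phi> y (ms[i := c])) x
      - of_real (lower x a) * (of_real (x$c) * \<Phi> x (ms[i := c]))"
      using tder_coord_mult[OF d, of a 0 c] tder_Suc[of a 0 "\<lambda>y. \<Phi> y (ms[i := c])" x] by (simp add: algebra_simps)
  qed
  also have "\<dots> = \<Phi> x (ms[i := a]) + (\<Sum>c\<in>UNIV. of_real (x$c) * tder a 0 (\<lambda>y. \<Phi> y (ms[i := c])) x)"
    using tangent[OF x ms] by (simp add: sum.distrib sum_subtractf sum_distrib_left[symmetric])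
  finally show ?thesis by (simp add: eq_neg_iff_add_eq_0 add.commute)
qed

text \<open>The Gauss formula. One contraction of the derivative with x gives a value of the field
  by \<open>contract_tder\<close>, and a second one vanishes by tangency, so that
  \<open>proj_tensor_expand\<close> applies.\<close>

lemma nabla_formula:
  assumes x: "x \<in> dS4" and ms: "length ms = 2 * s"
  shows "nabla \<Phi> x (a # ms) = tder a 0 (\<lambda>y. \<Phi> y ms) x + slot_sum x a (\<Phi> x) ms"
proof -
  have "(\<Sum>b\<in>UNIV. of_real (Proj x a b) * pd b (\<lambda>y. \<Phi> y \<beta>s) x) = tder a 0 (\<lambda>y. \<Phi> y \<beta>s) x" for \<beta>s
    unfolding sum_Proj by (simp add: tder_def)
  then have "nabla \<Phi> x (a # ms) = proj_tensor x (\<lambda>\<beta>s. tder a 0 (\<lambda>y. \<Phi> y \<beta>s) x) ms"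
    unfolding nabla_def proj_tensor_Cons by (simp flip: proj_tensor_sum)
  also have "\<dots> = tder a 0 (\<lambda>y. \<Phi> y ms) x - (\<Sum>i<length ms. of_real (lower x (ms!i)) * (\<Sum>c\<in>UNIV. of_real (x$c) * tder a 0 (\<lambda>y. \<Phi> y (ms[i := c])) x))"
  proof (rule proj_tensor_expand)
    fix ms' :: "5 list" and i j :: nat assume a: "length ms' = length ms" "i < length ms" "j < length ms" "i \<noteq> j"
    have "(\<Sum>c\<in>UNIV. of_real (x$c) * tder a 0 (\<lambda>y. \<Phi> y (ms'[i := b, j := c])) x) = - \<Phi> x (ms'[j := a, i := b])" for b
      using contract_tder[OF x, of "ms'[i := b]" j a] a ms by (simp add: list_update_swap)
    then show "(\<Sum>b\<in>UNIV. of_real (x$b) * (\<Sum>c\<in>UNIV. of_real (x$c) * tder a 0 (\<lambda>y. \<Phi> y (ms'[i := b, j := c])) x)) = 0"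
      using tangent[OF x, of "ms'[j := a]" i] a ms by (simp add: sum_negf)
  qed
  also have "\<dots> = tder a 0 (\<lambda>y. \<Phi> y ms) x + slot_sum x a (\<Phi> x) ms"
    unfolding slot_sum_def using contract_tder[OF x ms] ms by (simp add: sum_negf)
  finally show ?thesis .
qed

text \<open>The ambient derivative of the degree -2 extension of the field, restricted to dS4.\<close>

definition dP :: "real^5 \<Rightarrow> 5 \<Rightarrow> 5 list \<Rightarrow> complex" where
  "dP x a ms = tder a 2 (\<lambda>y. \<Phi> y ms) x"

lemma dP_nabla:
  assumes x: "x \<in> dS4" and ms: "length ms = 2 * s"
  shows "dP x a ms = nabla \<Phi> x (a # ms) - slot_sum x a (\<Phi> x) ms - 2 * of_real (lower x a) * \<Phi> x ms"
  unfolding nabla_formula[OF x ms]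
  using tder_Suc[of a 0 "\<lambda>y. \<Phi> y ms" x] tder_Suc[of a 1 "\<lambda>y. \<Phi> y ms" x]
  by (simp add: dP_def numeral_2_eq_2)

section \<open>Flat divergence and Bianchi identities\<close>

lemma tangent_Cons: "x \<in> dS4 \<Longrightarrow> length r = 2 * s - 1 \<Longrightarrow> (\<Sum>\<alpha>\<in>UNIV. of_real (x$\<alpha>) * \<Phi> x (\<alpha> # r)) = 0"
  using tangent[of x "0 # r" 0] s1 by simp

lemma tangent_third: "x \<in> dS4 \<Longrightarrow> s \<ge> 2 \<Longrightarrow> length r = 2 * s - 3 \<Longrightarrow> (\<Sum>\<alpha>\<in>UNIV. of_real (x$\<alpha>) * \<Phi> x (m # n # \<alpha> # r)) = 0"
  using tangent[of x "m # n # 0 # r" 2] by (simp add: numeral_2_eq_2)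

lemma trace_first_slot:
  "x \<in> dS4 \<Longrightarrow> length r = 2 * s - 1 \<Longrightarrow> i < length r \<Longrightarrow> (\<Sum>\<alpha>\<in>UNIV. of_real (eta \<alpha>) * \<Phi> x (\<alpha> # r[i := \<alpha>])) = 0"
  using traceless[of x "0 # r" 0 "Suc i"] s1 by simp

lemma trace_pairs: "x \<in> dS4 \<Longrightarrow> s \<ge> 2 \<Longrightarrow> length r = 2 * s - 3 \<Longrightarrow> (\<Sum>\<alpha>\<in>UNIV. of_real (eta \<alpha>) * \<Phi> x (\<alpha> # n # \<alpha> # r)) = 0"
  using trace_first_slot[of x "n # 0 # r" 1] by simp

lemma eta_lower: "complex_of_real (eta a) * (of_real (lower x a) * z) = of_real (x$a) * z"
  by (simp add: lower_def eta_sq_complex mult.assoc)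

lemma nabla_div:
  assumes x: "x \<in> dS4" and r: "length r = 2 * s - 1"
  shows "(\<Sum>\<mu>\<in>UNIV. of_real (eta \<mu>) * nabla \<Phi> x (\<mu> # \<mu> # r)) = 0"
proof (cases "s = 1")
  case True
  then obtain \<nu> where "r = [\<nu>]" using r by (cases r) auto
  then show ?thesis using field_eqs x True by (simp add: field_eqs_def)
next
  case False
  then show ?thesis using field_eqs x r by (simp add: field_eqs_def lists_len_def)
qed

lemma slot_sum_trace:
  assumes x: "x \<in> dS4" and r: "length r = 2 * s - 1"
  shows "(\<Sum>\<mu>\<in>UNIV. of_real (eta \<mu>) * slot_sum x \<mu> (\<lambda>l. \<Phi> x (\<mu> # l)) r) = 0"
proof -
  have "(\<Sum>\<mu>\<in>UNIV. of_real (eta \<mu>) * slot_sum x \<mu> (\<lambda>l. \<Phi> x (\<mu> # l)) r) =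
    (\<Sum>i<length r. of_real (lower x (r!i)) * (\<Sum>\<mu>\<in>UNIV. of_real (eta \<mu>) * \<Phi> x (\<mu> # r[i := \<mu>])))"
    unfolding slot_sum_def sum_distrib_left by (subst sum.swap) (simp add: mult_ac)
  also have "\<dots> = 0" using trace_first_slot[OF x r] by (intro sum.neutral) simp
  finally show ?thesis .
qed

text \<open>All corrections to the covariant divergence are contractions with x or traces of the
  field. The coefficient 3 collects 2 from the degree and 1 from the first slot.\<close>

lemma dP_div:
  assumes x: "x \<in> dS4" and r: "length r = 2 * s - 1"
  shows "(\<Sum>\<mu>\<in>UNIV. of_real (eta \<mu>) * dP x \<mu> (\<mu> # r)) = 0"
proof -
  have l: "length (\<mu> # r) = 2 * s" for \<mu> using r s1 by simp
  have "(\<Sum>\<mu>\<in>UNIV. of_real (eta \<mu>) * dP x \<mu> (\<mu> # r)) =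
     (\<Sum>\<mu>\<in>UNIV. of_real (eta \<mu>) * nabla \<Phi> x (\<mu> # \<mu> # r) - 3 * (of_real (x$\<mu>) * \<Phi> x (\<mu> # r))
        - of_real (eta \<mu>) * slot_sum x \<mu> (\<lambda>l. \<Phi> x (\<mu> # l)) r)"
  proof (rule sum.cong[OF refl])
    fix \<mu>
    have "of_real (eta \<mu>) * dP x \<mu> (\<mu> # r) = of_real (eta \<mu>) * nabla \<Phi> x (\<mu> # \<mu> # r) - 3 * (of_real (eta \<mu>) * (of_real (lower x \<mu>) * \<Phi> x (\<mu> # r)))
        - of_real (eta \<mu>) * slot_sum x \<mu> (\<lambda>l. \<Phi> x (\<mu> # l)) r"
      unfolding dP_nabla[OF x l] by (simp add: algebra_simps)
    then show "of_real (eta \<mu>) * dP x \<mu> (\<mu> # r) = of_real (eta \<mu>) * nabla \<Phi> x (\<mu> # \<mu> # r) - 3 * (of_real (x$\<mu>) * \<Phi> x (\<mu> # r))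
        - of_real (eta \<mu>) * slot_sum x \<mu> (\<lambda>l. \<Phi> x (\<mu> # l)) r"
      unfolding eta_lower .
  qed
  also have "\<dots> = 0"
    by (simp add: sum_subtractf sum_distrib_left[symmetric] nabla_div[OF x r] tangent_Cons[OF x r] slot_sum_trace[OF x r])
  finally show ?thesis .
qed

text \<open>Symmetries of the field hold only on dS4, not for its ambient extension off dS4;
  \<open>tder_zero\<close> transfers them to the derivatives nevertheless.\<close>

lemma tder_eq_cmult:
  assumes "length ms = 2 * s" "length ms' = 2 * s" "x \<in> dS4" "\<And>y. y \<in> dS4 \<Longrightarrow> \<Phi> y ms = c * \<Phi> y ms'"
  shows "tder a k (\<lambda>y. \<Phi> y ms) x = c * tder a k (\<lambda>y. \<Phi> y ms') x"
proof -
  have "tder a k (\<lambda>y. \<Phi> y ms + (- c) * \<Phi> y ms') x = 0"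
    by (rule tder_zero[OF U]) (use assms in \<open>auto intro!: smooth_on_diff smooth_on_cmult smooth U(1)\<close>)
  moreover have "tder a k (\<lambda>y. \<Phi> y ms + (- c) * \<Phi> y ms') x = tder a k (\<lambda>y. \<Phi> y ms) x + tder a k (\<lambda>y. (- c) * \<Phi> y ms') x"
    by (rule tder_add[OF diffable[OF assms(1,3)] differentiable_mult[OF differentiable_const diffable[OF assms(2,3)]]])
  moreover have "tder a k (\<lambda>y. (- c) * \<Phi> y ms') x = (- c) * tder a k (\<lambda>y. \<Phi> y ms') x"
    by (rule tder_cmult[OF diffable[OF assms(2,3)]])
  ultimately show ?thesis by simp
qed

lemma nabla_antisym:
  assumes x: "x \<in> dS4" and r: "length r = 2 * s - 2"
  shows "nabla \<Phi> x (a # n # m # r) = - nabla \<Phi> x (a # m # n # r)"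
proof -
  have l: "length (m # n # r) = 2 * s" for m n using r s1 by simp
  have "tder a 0 (\<lambda>y. \<Phi> y (n # m # r)) x = (-1) * tder a 0 (\<lambda>y. \<Phi> y (m # n # r)) x"
    by (rule tder_eq_cmult[OF l l x]) (simp add: antisym[OF _ r, of _ n m])
  moreover have "slot_sum x a (\<lambda>l. \<Phi> x (n # m # l)) r = - slot_sum x a (\<lambda>l. \<Phi> x (m # n # l)) r"
    unfolding slot_sum_def sum_negf[symmetric] using antisym[OF x, of _ n m] r by (intro sum.cong) auto
  ultimately show ?thesis
    unfolding nabla_formula[OF x l]
    by (simp add: antisym[OF x r, of a n] antisym[OF x r, of m a] algebra_simps)
qed

lemma nabla_bianchi_spin1:
  assumes "s = 1" "x \<in> dS4"
  shows "nabla \<Phi> x [a, b, c] + nabla \<Phi> x [b, c, a] + nabla \<Phi> x [c, a, b] = 0"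
proof -
  have "alt3 (nabla \<Phi> x) 0 1 2 [a, b, c] = 0"
    using field_eqs assms by (simp add: field_eqs_def lists_len_def)
  then have "2 * (nabla \<Phi> x [a, b, c] + nabla \<Phi> x [b, c, a] + nabla \<Phi> x [c, a, b]) = 0"
    using assms(1)
      nabla_antisym[OF assms(2), of "[]" a c b] nabla_antisym[OF assms(2), of "[]" b a c] nabla_antisym[OF assms(2), of "[]" c b a]
    by (simp add: alt3_def Let_def numeral_2_eq_2 algebra_simps del: mult_eq_0_iff)
  from this[unfolded mult_eq_0_iff] show ?thesis by simp
qed

text \<open>From spin 2 on there is a second pair against which the dual can be exchanged, so
  \<open>bianchi_of_divergence_free\<close> is available. The verification shows that antisymmetry,
  pair symmetry, tangency and trace condition pass from the field to its covariant
  derivative.\<close>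

lemma nabla_bianchi_higher:
  assumes s2: "s \<ge> 2" and x: "x \<in> dS4" and r: "length r = 2 * s - 4"
  shows "nabla \<Phi> x (a # m # n # p # q # r) + nabla \<Phi> x (m # n # a # p # q # r) + nabla \<Phi> x (n # a # m # p # q # r) = 0"
proof (rule bianchi_of_divergence_free[of x])
  have l: "length (m # n # p # q # r) = 2 * s" for m n p q using r s2 by simp
  show "mink x x = 1" using x by (simp add: dS4_def)
  fix a m n p q
  show "nabla \<Phi> x (a # n # m # p # q # r) = - nabla \<Phi> x (a # m # n # p # q # r)"
    using r s2 by (intro nabla_antisym[OF x]) simp
  have "tder a 0 (\<lambda>y. \<Phi> y (m # n # p # q # r)) x = 1 * tder a 0 (\<lambda>y. \<Phi> y (p # q # m # n # r)) x"
    by (rule tder_eq_cmult[OF l l x]) (simp add: pairsym[OF _ s2 r, of _ m n])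
  moreover have "slot_sum x a (\<lambda>l. \<Phi> x (m # n # p # q # l)) r = slot_sum x a (\<lambda>l. \<Phi> x (p # q # m # n # l)) r"
    unfolding slot_sum_def using pairsym[OF x s2, of _ m n p q] r by (intro sum.cong) auto
  ultimately show "nabla \<Phi> x (a # m # n # p # q # r) = nabla \<Phi> x (a # p # q # m # n # r)"
    unfolding nabla_formula[OF x l]
    by (simp add: pairsym[OF x s2 r, of a n p q] pairsym[OF x s2 r, of m a p q] pairsym[OF x s2 r, of m n a q]
        pairsym[OF x s2 r, of m n p a])
  show "(\<Sum>\<alpha>\<in>UNIV. of_real (eta \<alpha>) * nabla \<Phi> x (\<alpha> # \<alpha> # n # p # q # r)) = 0"
    using r s2 by (intro nabla_div[OF x]) simp
  show "(\<Sum>\<alpha>\<in>UNIV. of_real (x$\<alpha>) * nabla \<Phi> x (\<alpha> # m # n # p # q # r)) = 0"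
  proof -
    have "(\<Sum>\<alpha>\<in>UNIV. of_real (x$\<alpha>) * slot_sum x \<alpha> (\<Phi> x) (m # n # p # q # r)) =
      (\<Sum>i<length (m # n # p # q # r). of_real (lower x ((m # n # p # q # r)!i)) * (\<Sum>\<alpha>\<in>UNIV. of_real (x$\<alpha>) * \<Phi> x ((m # n # p # q # r)[i := \<alpha>])))"
      unfolding slot_sum_def sum_distrib_left by (subst sum.swap) (simp only: mult_ac)
    also have "\<dots> = 0"
    proof (intro sum.neutral ballI)
      fix i assume "i \<in> {..<length (m # n # p # q # r)}"
      then have "i < 2 * s" using l[of m n p q] by simp
      from tangent[OF x l this]
      show "of_real (lower x ((m # n # p # q # r)!i)) * (\<Sum>\<alpha>\<in>UNIV. of_real (x$\<alpha>) * \<Phi> x ((m # n # p # q # r)[i := \<alpha>])) = 0"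
        by (simp only: mult_zero_right)
    qed
    finally show ?thesis unfolding nabla_formula[OF x l] distrib_left sum.distrib
      using tder_euler[OF x, of 0] by simp
  qed
  show "(\<Sum>\<alpha>\<in>UNIV. of_real (x$\<alpha>) * nabla \<Phi> x (a # \<alpha> # n # p # q # r)) = 0"
  proof -
    have t: "(\<Sum>\<alpha>\<in>UNIV. of_real (x$\<alpha>) * tder a 0 (\<lambda>y. \<Phi> y (\<alpha> # n # p # q # r)) x) = - \<Phi> x (a # n # p # q # r)"
      using contract_tder[OF x l, of 0 a] s1 by simp
    have xx: "(\<Sum>\<alpha>\<in>UNIV. complex_of_real (x$\<alpha>) * (of_real (lower x \<alpha>) * z)) = z" for z
    proof -
      have "(\<Sum>\<alpha>\<in>UNIV. x$\<alpha> * lower x \<alpha>) = 1" using x by (simp add: lower_sum dS4_def)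
      then show ?thesis by (simp flip: mult.assoc sum_distrib_right of_real_mult of_real_sum)
    qed
    have "(\<Sum>\<alpha>\<in>UNIV. of_real (x$\<alpha>) * slot_sum x a (\<lambda>l. \<Phi> x (\<alpha> # l)) (n # p # q # r)) =
      (\<Sum>i<length (n # p # q # r). of_real (lower x ((n # p # q # r)!i)) * (\<Sum>\<alpha>\<in>UNIV. of_real (x$\<alpha>) * \<Phi> x (\<alpha> # (n # p # q # r)[i := a])))"
      unfolding slot_sum_def sum_distrib_left by (subst sum.swap) (simp only: mult_ac)
    also have "\<dots> = 0"
    proof (intro sum.neutral ballI)
      fix i
      have "length ((n # p # q # r)[i := a]) = 2 * s - 1" using r s2 by (simp only: length_list_update) simp
      from tangent_Cons[OF x this]
      show "of_real (lower x ((n # p # q # r)!i)) * (\<Sum>\<alpha>\<in>UNIV. of_real (x$\<alpha>) * \<Phi> x (\<alpha> # (n # p # q # r)[i := a])) = 0"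
        by (simp only: mult_zero_right)
    qed
    finally show ?thesis unfolding nabla_formula[OF x l] slot_sum_Cons[of x a _ _ "n # p # q # r"] distrib_left sum.distrib
      by (simp only: t xx) simp
  qed
  show "(\<Sum>\<alpha>\<in>UNIV. of_real (eta \<alpha>) * nabla \<Phi> x (a # \<alpha> # n # \<alpha> # q # r)) = 0"
  proof -
    have d: "(\<lambda>y. \<Phi> y (\<alpha> # n # \<alpha> # q # r)) differentiable (at x)" for \<alpha> by (rule diffable[OF l x])
    have tr: "(\<Sum>\<alpha>\<in>UNIV. of_real (eta \<alpha>) * \<Phi> y (\<alpha> # n # \<alpha> # q # r')) = 0" if "y \<in> dS4" "length r' = length r" for y n q r'
      using trace_pairs[OF that(1) s2, of "q # r'" n] r s2 that(2) by simp
    have "0 = tder a 0 (\<lambda>y. \<Sum>\<alpha>\<in>UNIV. of_real (eta \<alpha>) * \<Phi> y (\<alpha> # n # \<alpha> # q # r)) x"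
      by (rule tder_zero[OF U, symmetric]) (use tr x in \<open>auto intro!: smooth_on_sum smooth_on_cmult smooth U(1) l\<close>)
    also have "\<dots> = (\<Sum>\<alpha>\<in>UNIV. tder a 0 (\<lambda>y. of_real (eta \<alpha>) * \<Phi> y (\<alpha> # n # \<alpha> # q # r)) x)"
      by (rule tder_sum) (intro differentiable_mult differentiable_const d)
    also have "\<dots> = (\<Sum>\<alpha>\<in>UNIV. of_real (eta \<alpha>) * tder a 0 (\<lambda>y. \<Phi> y (\<alpha> # n # \<alpha> # q # r)) x)"
      by (simp add: tder_cmult d)
    finally have t: "(\<Sum>\<alpha>\<in>UNIV. of_real (eta \<alpha>) * tder a 0 (\<lambda>y. \<Phi> y (\<alpha> # n # \<alpha> # q # r)) x) = 0" by simp
    have "(\<Sum>\<alpha>\<in>UNIV. of_real (eta \<alpha>) * slot_sum x a (\<lambda>l. \<Phi> x (\<alpha> # n # \<alpha> # q # l)) r) =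
      (\<Sum>i<length r. of_real (lower x (r!i)) * (\<Sum>\<alpha>\<in>UNIV. of_real (eta \<alpha>) * \<Phi> x (\<alpha> # n # \<alpha> # q # r[i := a])))"
      unfolding slot_sum_def sum_distrib_left by (subst sum.swap) (simp only: mult_ac)
    also have "\<dots> = 0" using tr[OF x] by (intro sum.neutral) simp
    finally have ss: "(\<Sum>\<alpha>\<in>UNIV. of_real (eta \<alpha>) * slot_sum x a (\<lambda>l. \<Phi> x (\<alpha> # n # \<alpha> # q # l)) r) = 0" .
    have 1: "(\<Sum>\<alpha>\<in>UNIV. of_real (eta \<alpha>) * (of_real (lower x \<alpha>) * \<Phi> x (a # n # \<alpha> # q # r))) = 0"
      unfolding eta_lower using tangent_third[OF x s2, of "q # r" a n] r s2 by simp
    have 2: "(\<Sum>\<alpha>\<in>UNIV. of_real (eta \<alpha>) * (of_real (lower x \<alpha>) * \<Phi> x (\<alpha> # n # a # q # r))) = 0"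
      unfolding eta_lower using tangent_Cons[OF x, of "n # a # q # r"] r s2 by simp
    have 3: "(\<Sum>\<alpha>\<in>UNIV. of_real (eta \<alpha>) * (z * \<Phi> x (\<alpha> # a # \<alpha> # q # r))) = 0" for z
      using tr[OF x, of r a q] by (simp add: sum_distrib_left[symmetric] mult.left_commute[of _ z])
    have 4: "(\<Sum>\<alpha>\<in>UNIV. of_real (eta \<alpha>) * (z * \<Phi> x (\<alpha> # n # \<alpha> # a # r))) = 0" for z
      using tr[OF x, of r n a] by (simp add: sum_distrib_left[symmetric] mult.left_commute[of _ z])
    show ?thesis unfolding nabla_formula[OF x l] slot_sum_Cons distrib_left sum.distrib 1 2 3 4 t ss by simp
  qed
qed

lemma nabla_bianchi:
  assumes x: "x \<in> dS4" and r: "length r = 2 * s - 2"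
  shows "nabla \<Phi> x (a # b # c # r) + nabla \<Phi> x (b # c # a # r) + nabla \<Phi> x (c # a # b # r) = 0"
proof (cases "s = 1")
  case True
  then show ?thesis using nabla_bianchi_spin1[OF True x] r by simp
next
  case False
  then have s2: "s \<ge> 2" using s1 by simp
  then obtain p q r' where "r = p # q # r'" using r by (cases r; cases "tl r") auto
  then show ?thesis using nabla_bianchi_higher[OF s2 x, of r'] r by simp
qed

text \<open>In the cyclic sum each of the normals with index a, b, c occurs twice with a minus sign
  in the slot terms and once with the coefficient 2 from the degree, and these cancel. The slots of
  the remaining indices cancel by the algebraic cyclic identity.\<close>

lemma dP_bianchi:
  assumes x: "x \<in> dS4" and r: "length r = 2 * s - 2"
  shows "dP x a (b # c # r) + dP x b (c # a # r) + dP x c (a # b # r) = 0"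
proof -
  have l: "length (m # n # r) = 2 * s" for m n using r s1 by simp
  have ss: "slot_sum x a (\<lambda>l. \<Phi> x (b # c # l)) r + slot_sum x b (\<lambda>l. \<Phi> x (c # a # l)) r + slot_sum x c (\<lambda>l. \<Phi> x (a # b # l)) r = 0"
    unfolding slot_sum_def sum.distrib[symmetric] distrib_left[symmetric]
    using cyclic[OF x r] by (intro sum.neutral) simp
  have "dP x a (b # c # r) + dP x b (c # a # r) + dP x c (a # b # r) =
    (nabla \<Phi> x (a # b # c # r) + nabla \<Phi> x (b # c # a # r) + nabla \<Phi> x (c # a # b # r))
    - (slot_sum x a (\<lambda>l. \<Phi> x (b # c # l)) r + slot_sum x b (\<lambda>l. \<Phi> x (c # a # l)) r + slot_sum x c (\<lambda>l. \<Phi> x (a # b # l)) r)"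
    unfolding dP_nabla[OF x l]
    by (simp add: antisym[OF x r, of c a] antisym[OF x r, of b a] antisym[OF x r, of c b] algebra_simps)
  then show ?thesis using nabla_bianchi[OF x r] ss by simp
qed

end

section \<open>Boundary limits of tensors\<close>

fun flat :: "('a \<times> 'a) list \<Rightarrow> 'a list" where
  "flat [] = []"
| "flat ((a, b) # ps) = a # b # flat ps"

lemma length_flat [simp]: "length (flat ps) = 2 * length ps"
  by (induction ps rule: flat.induct) auto

lemma flat_surj:
  assumes "length ms = 2 * n" shows "\<exists>ps. length ps = n \<and> flat ps = ms"
  using assms
proof (induction n arbitrary: ms)
  case 0
  then show ?case by (intro exI[of _ "[]"]) simp
next
  case (Suc n)
  then obtain a b r where ms: "ms = a # b # r" by (cases ms; cases "tl ms") auto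
  then obtain ps where "length ps = n" "flat ps = r" using Suc by auto
  then show ?case using ms by (intro exI[of _ "(a, b) # ps"]) simp
qed

lemma flat_nth:
  "k < length ps \<Longrightarrow> flat ps ! (2 * k) = fst (ps!k) \<and> flat ps ! Suc (2 * k) = snd (ps!k)"
proof (induction ps arbitrary: k rule: flat.induct)
  case (2 a b ps)
  then show ?case by (cases k) auto
qed simp

lemma flat_update: "flat (ps[k := p]) = (flat ps)[2 * k := fst p, Suc (2 * k) := snd p]"
proof (induction ps arbitrary: k rule: flat.induct)
  case (2 a b ps)
  then show ?case by (cases k; cases p) auto
qed simp

lemma interleave_flat: "length as = length bs \<Longrightarrow> interleave as bs = flat (zip as bs)"
  by (induction as bs rule: interleave.induct) auto

lemma length_interleave: "length as = length bs \<Longrightarrow> length (interleave as bs) = 2 * length as"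
  by (simp add: interleave_flat)

lemma interleave_update1: "length as = length bs \<Longrightarrow> interleave (as[i := a]) bs = (interleave as bs)[2 * i := a]"
  and interleave_update2: "length as = length bs \<Longrightarrow> interleave as (bs[i := a]) = (interleave as bs)[Suc (2 * i) := a]"
proof (induction as bs arbitrary: i rule: interleave.induct)
  case (1 a as b bs)
  { case 1 with "1.IH" show ?case by (cases i) auto }
  { case 2 with "1.IH" show ?case by (cases i) auto }
qed auto

lemma mset_Cons_remove1: "x \<in> set xs \<Longrightarrow> mset xs = mset (x # remove1 x xs)"
  by simp

text \<open>Permutations of the tail together with the exchange of the first two entries generate
  all permutations. The step is separate from the induction because the dual has a distinguished
  first pair and enters here directly.\<close>

lemma mset_invariant_step:
  assumes tail: "\<And>p ps qs. length (p # ps) = n \<Longrightarrow> mset ps = mset qs \<Longrightarrow> f (p # ps) = f (p # qs)"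
    and head: "\<And>p q r. length (p # q # r) = n \<Longrightarrow> f (p # q # r) = f (q # p # r)"
    and "length xs = n" "mset xs = mset ys"
  shows "f xs = f ys"
proof (cases xs)
  case Nil
  then show ?thesis using assms(4) by simp
next
  case (Cons x xs')
  then obtain y ys' where ys: "ys = y # ys'" using assms(4) by (cases ys) auto
  have len: "length ys = n" using assms(3,4) by (metis size_mset)
  show ?thesis
  proof (cases "x = y")
    case True
    then show ?thesis using tail[of x xs' ys'] assms(3,4) Cons ys by simp
  next
    case False
    have "mset (x # xs') = mset (y # ys')" using assms(4) Cons ys by simp
    then have "y \<in> set xs'" "x \<in> set ys'" using False by (metis set_ConsD list.set_intros(1) mset_eq_setD)+
    define zs where "zs = remove1 y xs'"
    have 1: "mset xs' = mset (y # zs)" using \<open>y \<in> set xs'\<close> by (simp add: zs_def)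
    have 2: "mset ys' = mset (x # zs)" using assms(4) 1 Cons ys by (simp add: add_mset_commute)
    have l: "length (y # x # zs) = n" using len 2 ys by (metis length_Cons size_mset)
    have "f xs = f (x # y # zs)" using tail[of x xs' "y # zs"] 1 assms(3) Cons by simp
    also have "\<dots> = f (y # x # zs)" using head[of x y zs] l by simp
    also have "\<dots> = f ys" using tail[of y "x # zs" ys'] 2 l ys by simp
    finally show ?thesis .
  qed
qed

lemma mset_invariant:
  assumes "\<And>ps k l. length ps = n \<Longrightarrow> k < n \<Longrightarrow> l < n \<Longrightarrow> f (ps[k := ps!l, l := ps!k]) = f ps"
    and "length xs = n" "mset xs = mset ys"
  shows "f xs = f ys"
  using assms
proof (induction n arbitrary: f xs ys)
  case 0
  then show ?case by simp
next
  case (Suc n)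
  show ?case
  proof (rule mset_invariant_step[OF _ _ Suc.prems(2,3)])
    fix p and ps qs :: "'a list" assume l: "length (p # ps) = Suc n" and m: "mset ps = mset qs"
    show "f (p # ps) = f (p # qs)"
    proof (rule Suc.IH[of "\<lambda>l. f (p # l)"])
      fix rs :: "'a list" and k l assume "length rs = n" "k < n" "l < n"
      then show "f (p # rs[k := rs!l, l := rs!k]) = f (p # rs)"
        using Suc.prems(1)[of "p # rs" "Suc k" "Suc l"] by simp
    qed (use l m in auto)
  next
    fix p q and r :: "'a list" assume "length (p # q # r) = Suc n"
    then show "f (p # q # r) = f (q # p # r)" using Suc.prems(1)[of "p # q # r" 0 1] by simp
  qed
qed

text \<open>The normal is a multiple of e0 + x^0 x, and its part along x is annihilated by tangency;
  each contraction therefore only picks the time component.\<close>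

lemma nvec_contraction:
  assumes "\<And>\<nu>s i. length \<nu>s = n \<Longrightarrow> i < n \<Longrightarrow> (\<Sum>\<alpha>\<in>UNIV. of_real (x$\<alpha>) * S (\<nu>s[i := \<alpha>])) = 0"
  shows "(\<Sum>\<nu>s\<in>lists_len n. of_real (\<Prod>k<n. nvec x (\<nu>s!k)) * S \<nu>s) = of_real (inverse (sqrt (1 + (x$0)\<^sup>2)) ^ n) * (S (replicate n 0) :: complex)"
  using assms
proof (induction n arbitrary: S)
  case 0
  then show ?case by (simp add: lists_len_0)
next
  case (Suc n)
  let ?N = "inverse (sqrt (1 + (x$0)\<^sup>2))"
  have IH: "(\<Sum>\<nu>s\<in>lists_len n. of_real (\<Prod>k<n. nvec x (\<nu>s!k)) * S (\<nu> # \<nu>s)) = of_real (?N ^ n) * S (\<nu> # replicate n 0)" for \<nu>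
  proof (rule Suc.IH[of "\<lambda>l. S (\<nu> # l)"])
    fix \<nu>s :: "5 list" and i assume "length \<nu>s = n" "i < n"
    then show "(\<Sum>\<alpha>\<in>UNIV. of_real (x$\<alpha>) * S (\<nu> # \<nu>s[i := \<alpha>])) = 0" using Suc.prems[of "\<nu> # \<nu>s" "Suc i"] by simp
  qed
  have tan: "(\<Sum>\<alpha>\<in>UNIV. of_real (x$\<alpha>) * S (\<alpha> # replicate n 0)) = 0"
    using Suc.prems[of "replicate (Suc n) 0" 0] by simp
  have nv: "of_real (nvec x \<nu>) * z = of_real ?N * ((if \<nu> = 0 then z else 0) + of_real (x$0) * (of_real (x$\<nu>) * z))" for \<nu> and z :: complex
    by (simp add: nvec_def divide_inverse algebra_simps)
  have "(\<Sum>\<nu>s\<in>lists_len (Suc n). of_real (\<Prod>k<Suc n. nvec x (\<nu>s!k)) * S \<nu>s) =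
     (\<Sum>\<nu>\<in>UNIV. of_real (nvec x \<nu>) * (\<Sum>\<nu>s\<in>lists_len n. of_real (\<Prod>k<n. nvec x (\<nu>s!k)) * S (\<nu> # \<nu>s)))"
    by (simp add: sum_lists_len_Suc prod.lessThan_Suc_shift sum_distrib_left mult.assoc del: prod.lessThan_Suc)
  also have "\<dots> = of_real (?N ^ n) * (\<Sum>\<nu>\<in>UNIV. of_real (nvec x \<nu>) * S (\<nu> # replicate n 0))"
    unfolding IH sum_distrib_left by (simp add: mult_ac)
  also have "(\<Sum>\<nu>\<in>UNIV. of_real (nvec x \<nu>) * S (\<nu> # replicate n 0)) = of_real ?N * S (0 # replicate n 0)"
    unfolding nv by (simp add: sum_distrib_left[symmetric] sum.distrib tan)
  finally show ?case by (simp add: mult_ac)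
qed

text \<open>R^5 is spanned by e0, w and the tangent space of the 3-sphere at w. The induction peels
  off the first slot: contracted with a fixed tangent vector there, S is a tensor of lower rank of
  the same kind.\<close>

lemma tangential_components_determine:
  assumes w: "on_S3 w"
    and "\<And>ms i. length ms = n \<Longrightarrow> i < n \<Longrightarrow> (\<Sum>\<alpha>\<in>UNIV. of_real (w$\<alpha>) * S (ms[i := \<alpha>])) = 0"
    and "\<And>ms i. length ms = n \<Longrightarrow> i < n \<Longrightarrow> S (ms[i := 0]) = 0"
    and "\<And>us. length us = n \<Longrightarrow> (\<forall>u\<in>set us. tangent_S3 w u) \<Longrightarrow>
       (\<Sum>ms\<in>lists_len n. of_real (\<Prod>k<n. (us!k)$(ms!k)) * S ms) = 0"
    and "length ms = n"
  shows "S ms = (0 :: complex)"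
  using assms(2-)
proof (induction n arbitrary: S ms)
  case 0
  then show ?case using "0.prems"(3)[of "[]"] by (simp add: lists_len_0)
next
  case (Suc n)
  obtain m ms' where ms: "ms = m # ms'" "length ms' = n" using Suc.prems(4) by (cases ms) auto
  have u: "(\<Sum>\<alpha>\<in>UNIV. of_real (u$\<alpha>) * S (\<alpha> # ms')) = 0" if "tangent_S3 w u" for u
  proof (rule Suc.IH[of "\<lambda>l. \<Sum>\<alpha>\<in>UNIV. of_real (u$\<alpha>) * S (\<alpha> # l)"])
    fix l :: "5 list" and i assume a: "length l = n" "i < n"
    have "(\<Sum>\<beta>\<in>UNIV. of_real (w$\<beta>) * (\<Sum>\<alpha>\<in>UNIV. of_real (u$\<alpha>) * S (\<alpha> # l[i := \<beta>]))) =
       (\<Sum>\<alpha>\<in>UNIV. of_real (u$\<alpha>) * (\<Sum>\<beta>\<in>UNIV. of_real (w$\<beta>) * S (\<alpha> # l[i := \<beta>])))"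
      unfolding sum_distrib_left by (subst sum.swap) (simp add: mult_ac)
    also have "\<dots> = 0" using Suc.prems(1)[of "_ # l" "Suc i"] a by (intro sum.neutral) simp
    finally show "(\<Sum>\<beta>\<in>UNIV. of_real (w$\<beta>) * (\<Sum>\<alpha>\<in>UNIV. of_real (u$\<alpha>) * S (\<alpha> # l[i := \<beta>]))) = 0" .
  next
    fix l :: "5 list" and i assume a: "length l = n" "i < n"
    show "(\<Sum>\<alpha>\<in>UNIV. of_real (u$\<alpha>) * S (\<alpha> # l[i := 0])) = 0"
      using Suc.prems(2)[of "_ # l" "Suc i"] a by (intro sum.neutral) simp
  next
    fix us assume a: "length us = n" "\<forall>u\<in>set us. tangent_S3 w u"
    have "(\<Sum>l\<in>lists_len n. of_real (\<Prod>k<n. (us!k)$(l!k)) * (\<Sum>\<alpha>\<in>UNIV. of_real (u$\<alpha>) * S (\<alpha> # l))) =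
      (\<Sum>ms\<in>lists_len (Suc n). of_real (\<Prod>k<Suc n. ((u # us)!k)$(ms!k)) * S ms)"
      unfolding sum_lists_len_Suc sum_distrib_left
      by (subst sum.swap) (simp add: prod.lessThan_Suc_shift mult_ac del: prod.lessThan_Suc)
    also have "\<dots> = 0" using Suc.prems(3)[of "u # us"] a that by simp
    finally show "(\<Sum>l\<in>lists_len n. of_real (\<Prod>k<n. (us!k)$(l!k)) * (\<Sum>\<alpha>\<in>UNIV. of_real (u$\<alpha>) * S (\<alpha> # l))) = 0" .
  qed (rule ms(2))
  have z: "S (0 # ms') = 0" using Suc.prems(2)[of "0 # ms'" 0] ms by simp
  have ww: "(\<Sum>\<alpha>\<in>UNIV. of_real (w$\<alpha>) * S (\<alpha> # ms')) = 0" using Suc.prems(1)[of "0 # ms'" 0] ms by simp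
  show ?case
  proof (cases "m = 0")
    case True
    then show ?thesis using z ms by simp
  next
    case False
    \<comment> \<open>The tangential part of the m-th basis vector; what it misses is along w, where
      S vanishes.\<close>
    let ?u = "axis m 1 - (w$m) *\<^sub>R w"
    have ax: "axis m (1::real) $ (0::5) = 0" using False by (simp add: axis_def)
    have mm: "mink (axis m 1) w = w$m"
      using False exhaust_5[of m] by (auto simp: mink_5 axis_def)
    have "tangent_S3 w ?u"
      using w ax by (simp add: tangent_S3_def mink_linear mm on_S3_def)
    from u[OF this] have "(\<Sum>\<alpha>\<in>UNIV. of_real ((axis m 1 :: real^5)$\<alpha>) * S (\<alpha> # ms')) - of_real (w$m) * (\<Sum>\<alpha>\<in>UNIV. of_real (w$\<alpha>) * S (\<alpha> # ms')) = 0"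
      by (simp add: left_diff_distrib sum_subtractf sum_distrib_left mult.assoc)
    moreover have "(\<Sum>\<alpha>\<in>UNIV. of_real ((axis m 1 :: real^5)$\<alpha>) * S (\<alpha> # ms')) = S (m # ms')"
      by (simp add: axis_def of_real_def if_distrib[of "\<lambda>x. x *\<^sub>R _"] if_distrib[of "\<lambda>x. x * _"] cong: if_cong)
    ultimately show ?thesis using ww ms by simp
  qed
qed

text \<open>The point gpt z w is a positive multiple of w + conf_time z e0.\<close>

definition conf_time :: "real \<Rightarrow> real" where
  "conf_time z = 1 / (z * sqrt (1 + 1 / z\<^sup>2))"

lemma conf_time_pos: "z > 0 \<Longrightarrow> conf_time z = 1 / sqrt (1 + z\<^sup>2)"
  and conf_time_neg: "z < 0 \<Longrightarrow> conf_time z = - (1 / sqrt (1 + z\<^sup>2))"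
proof -
  have "sqrt (z\<^sup>2 * (1 + 1 / z\<^sup>2)) = sqrt (1 + z\<^sup>2)" if "z \<noteq> 0"
    using that by (simp add: distrib_left add.commute)
  then have *: "\<bar>z\<bar> * sqrt (1 + 1 / z\<^sup>2) = sqrt (1 + z\<^sup>2)" if "z \<noteq> 0"
    using that by (simp add: real_sqrt_mult)
  show "z > 0 \<Longrightarrow> conf_time z = 1 / sqrt (1 + z\<^sup>2)" using * by (simp add: conf_time_def)
  assume "z < 0"
  then have "z * sqrt (1 + 1 / z\<^sup>2) = - sqrt (1 + z\<^sup>2)" using * by simp
  then show "conf_time z = - (1 / sqrt (1 + z\<^sup>2))" by (simp add: conf_time_def)
qed

section \<open>The approach to infinity\<close>

lemma filterlim_conf_time_right: "filterlim conf_time (at_left 1) (at_right 0)"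
proof -
  have "((\<lambda>z::real. 1 / sqrt (1 + z\<^sup>2)) \<longlongrightarrow> 1 / sqrt (1 + 0\<^sup>2)) (at_right 0)"
    by (intro tendsto_intros) auto
  then have "((\<lambda>z::real. 1 / sqrt (1 + z\<^sup>2)) \<longlongrightarrow> 1) (at_right 0)" by simp
  moreover have ev: "\<forall>\<^sub>F z in at_right 0. conf_time z = 1 / sqrt (1 + z\<^sup>2) \<and> 1 / sqrt (1 + z\<^sup>2) < 1"
    unfolding eventually_at_right_field by (rule exI[of _ 1]) (auto simp: conf_time_pos add_pos_nonneg)
  ultimately have "(conf_time \<longlongrightarrow> 1) (at_right 0)"
    by (elim Lim_transform_eventually) (auto elim!: eventually_mono)
  then show ?thesis unfolding filterlim_at using ev by (auto elim!: eventually_mono)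
qed

lemma filterlim_conf_time_left: "filterlim conf_time (at_right (-1)) (at_left 0)"
proof -
  have "((\<lambda>z::real. - (1 / sqrt (1 + z\<^sup>2))) \<longlongrightarrow> - (1 / sqrt (1 + 0\<^sup>2))) (at_left 0)"
    by (intro tendsto_intros) auto
  then have "((\<lambda>z::real. - (1 / sqrt (1 + z\<^sup>2))) \<longlongrightarrow> -1) (at_left 0)" by simp
  moreover have ev: "\<forall>\<^sub>F z in at_left 0. conf_time z = - (1 / sqrt (1 + z\<^sup>2)) \<and> - (1 / sqrt (1 + z\<^sup>2)) > -1"
    unfolding eventually_at_left_field by (rule exI[of _ "-1"]) (auto simp: conf_time_neg add_pos_nonneg)
  ultimately have "(conf_time \<longlongrightarrow> -1) (at_left 0)"
    by (elim Lim_transform_eventually) (auto elim!: eventually_mono)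
  then show ?thesis unfolding filterlim_at using ev by (auto elim!: eventually_mono)
qed

text \<open>Evenness identifies the past limit at w with the future limit at - w, which is minus the
  past limit at w.\<close>

lemma past_limit_zero_of_even:
  assumes F: "wave_on_dS4 F" and even: "\<And>x. x \<in> dS4 \<Longrightarrow> F (- x) = F x" and w: "on_S3 w"
  shows "past_limit F w = 0"
proof -
  have ev: "hext 1 F (- X) = hext 1 F X" if "X \<in> cone" for X
    using even[OF normalize_dS4[OF that]] by (simp add: hext_def mink_linear)
  have "((\<lambda>c::real. - c) \<longlongrightarrow> - 1) (at_left 1)" by (intro tendsto_intros)
  moreover have "\<forall>\<^sub>F c in at_left (1::real). - c > - 1"
    unfolding eventually_at_left_field by (rule exI[of _ 0]) auto
  ultimately have "filterlim (\<lambda>c::real. - c) (at_right (- 1)) (at_left 1)"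
    unfolding filterlim_at by (auto elim!: eventually_mono)
  from filterlim_compose[OF wave_limits(1)[OF F w] this]
  have "((\<lambda>c. hext 1 F (w + (- c) *\<^sub>R e0)) \<longlongrightarrow> past_limit F w) (at_left 1)" .
  moreover have "\<forall>\<^sub>F c in at_left 1. hext 1 F (w + (- c) *\<^sub>R e0) = hext 1 F (- w + c *\<^sub>R e0)"
  proof (rule eventually_mono[OF eventually_slice_left])
    fix c :: real assume "\<bar>c\<bar> < 1"
    then show "hext 1 F (w + (- c) *\<^sub>R e0) = hext 1 F (- w + c *\<^sub>R e0)"
      using ev[OF slice_in_cone[OF on_S3_minus[OF w], of c]] by (simp add: algebra_simps)
  qed
  ultimately have "((\<lambda>c. hext 1 F (- w + c *\<^sub>R e0)) \<longlongrightarrow> past_limit F w) (at_left 1)"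
    by (rule Lim_transform_eventually)
  from tendsto_unique[OF trivial_limit_at_left_real this wave_limits(2)[OF F on_S3_minus[OF w]]]
  have "2 * past_limit F w = 0" by simp
  then show ?thesis by simp
qed

lemma gpt_slice:
  assumes z: "z \<noteq> 0" and w: "on_S3 w"
  shows "gpt z w = sqrt (1 + 1 / z\<^sup>2) *\<^sub>R (w + conf_time z *\<^sub>R e0)" "gpt z w \<in> dS4"
proof -
  have p: "1 + 1 / z\<^sup>2 > 0" by (simp add: add_pos_nonneg)
  then have "sqrt (1 + 1 / z\<^sup>2) \<noteq> 0" by simp
  then have "sqrt (1 + 1 / z\<^sup>2) * conf_time z = 1 / z" by (simp add: conf_time_def)
  then show "gpt z w = sqrt (1 + 1 / z\<^sup>2) *\<^sub>R (w + conf_time z *\<^sub>R e0)"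
    by (simp add: gpt_def scaleR_add_right add.commute)
  have "mink (gpt z w) (gpt z w) = (sqrt (1 + 1 / z\<^sup>2))\<^sup>2 - 1 / z\<^sup>2"
    using w by (simp add: gpt_def mink_linear mink_e0 on_S3_def power2_eq_square)
  then show "gpt z w \<in> dS4" using p by (simp add: dS4_def)
qed

text \<open>The division by z in the boundary data is absorbed by the degree -1: what remains is the
  factor \<open>conf_time z\<close>, which tends to 1 or -1.\<close>

lemma hext_gpt:
  assumes z: "z \<noteq> 0" and w: "on_S3 w"
  shows "F (gpt z w) / of_real z = of_real (conf_time z) * hext 1 F (w + conf_time z *\<^sub>R e0)"
proof -
  have p: "sqrt (1 + 1 / z\<^sup>2) > 0" by (simp add: add_pos_nonneg)
  have "F (gpt z w) = hext 1 F (sqrt (1 + 1 / z\<^sup>2) *\<^sub>R (w + conf_time z *\<^sub>R e0))"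
    using gpt_slice[OF z w] hext_dS4[of "gpt z w" 1 F] by simp
  also have "\<dots> = of_real (inverse (sqrt (1 + 1 / z\<^sup>2))) * hext 1 F (w + conf_time z *\<^sub>R e0)"
    using hext_hom[OF p, of 1] by (simp add: scaleR_conv_of_real[where 'a=complex])
  finally show ?thesis using z p by (simp add: conf_time_def field_simps)
qed

text \<open>The common interface of the field and of its dual. As the magnetic part of the field is
  the electric part of the dual, everything below is needed for electric parts alone.\<close>

locale asymptotic_tensor =
  fixes s :: nat and T :: "real^5 \<Rightarrow> 5 list \<Rightarrow> complex"
  assumes rank: "s \<ge> 1"
    and wave: "\<And>ms. length ms = 2 * s \<Longrightarrow> wave_on_dS4 (\<lambda>x. T x ms)"
    and tan: "\<And>x ms i. x \<in> dS4 \<Longrightarrow> length ms = 2 * s \<Longrightarrow> i < 2 * s \<Longrightarrow> (\<Sum>\<alpha>\<in>UNIV. of_real (x$\<alpha>) * T x (ms[i := \<alpha>])) = 0"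
    and anti: "\<And>x m n r. x \<in> dS4 \<Longrightarrow> length r = 2 * s - 2 \<Longrightarrow> T x (n # m # r) = - T x (m # n # r)"
    and perm: "\<And>x ps qs. x \<in> dS4 \<Longrightarrow> length ps = s \<Longrightarrow> mset ps = mset qs \<Longrightarrow> T x (flat ps) = T x (flat qs)"
    and wedge: "\<And>w a b c r. on_S3 w \<Longrightarrow> length r = 2 * s - 2 \<Longrightarrow>
      of_real (lower (w - e0) a) * past_limit (\<lambda>x. T x (b # c # r)) w + of_real (lower (w - e0) b) * past_limit (\<lambda>x. T x (c # a # r)) w
      + of_real (lower (w - e0) c) * past_limit (\<lambda>x. T x (a # b # r)) w = 0"
begin

lemma Efield_eq:
  assumes x: "x \<in> dS4" and ms: "length ms = s"
  shows "Efield s T x ms = of_real (inverse (sqrt (1 + (x$0)\<^sup>2)) ^ s) * T x (interleave ms (replicate s 0))"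
  unfolding Efield_def
proof (rule nvec_contraction)
  fix \<nu>s :: "5 list" and i assume "length \<nu>s = s" "i < s"
  then show "(\<Sum>\<alpha>\<in>UNIV. of_real (x$\<alpha>) * T x (interleave ms (\<nu>s[i := \<alpha>]))) = 0"
    using tan[OF x, of "interleave ms \<nu>s" "Suc (2 * i)"] ms by (simp add: interleave_update2 length_interleave)
qed

text \<open>The s coordinate vectors at z are longer by the factor sqrt (1 + 1/z^2) than unit
  vectors, and each of the s normals contributes the inverse of this factor.\<close>

lemma comp_over_z_eq:
  assumes z: "z \<noteq> 0" and w: "on_S3 w"
  shows "comp_over_z s (Efield s T) w us z = of_real (conf_time z) * (\<Sum>ms\<in>lists_len s. of_real (\<Prod>k<s. (us!k)$(ms!k)) *
     hext 1 (\<lambda>x. T x (interleave ms (replicate s 0))) (w + conf_time z *\<^sub>R e0))"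
proof -
  let ?q = "sqrt (1 + 1 / z\<^sup>2)"
  have q: "?q > 0" by (simp add: add_pos_nonneg)
  have g0: "sqrt (1 + (gpt z w $ 0)\<^sup>2) = ?q" using w by (simp add: gpt_def on_S3_def axis_def power_one_over)
  have "of_real (\<Prod>k<s. ?q * (us!k)$(ms!k)) * Efield s T (gpt z w) ms / of_real z =
    of_real (conf_time z) * (of_real (\<Prod>k<s. (us!k)$(ms!k)) * hext 1 (\<lambda>x. T x (interleave ms (replicate s 0))) (w + conf_time z *\<^sub>R e0))"
    if ms: "ms \<in> lists_len s" for ms
  proof -
    let ?F = "\<lambda>x. T x (interleave ms (replicate s 0))"
    have l: "length ms = s" using ms by (simp add: lists_len_def)
    have "of_real (\<Prod>k<s. ?q * (us!k)$(ms!k)) * Efield s T (gpt z w) ms / of_real z =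
      of_real (\<Prod>k<s. (us!k)$(ms!k)) * (of_real (?q ^ s * inverse ?q ^ s) * (?F (gpt z w) / of_real z))"
      unfolding Efield_eq[OF gpt_slice(2)[OF z w] l] g0 by (simp add: prod.distrib mult_ac)
    also have "?q ^ s * inverse ?q ^ s = 1" using q by (simp flip: power_mult_distrib)
    finally show ?thesis unfolding hext_gpt[OF z w, of ?F] by (simp add: mult_ac)
  qed
  then show ?thesis
    unfolding comp_over_z_def sum_divide_distrib sum_distrib_left by (intro sum.cong refl)
qed

lemma length_arg: "ms \<in> lists_len s \<Longrightarrow> length (interleave ms (replicate s 0)) = 2 * s"
  by (simp add: lists_len_def length_interleave)

lemma comp_tendsto_right:
  assumes w: "on_S3 w"
  shows "(comp_over_z s (Efield s T) w us \<longlongrightarrow>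
     (\<Sum>ms\<in>lists_len s. of_real (\<Prod>k<s. (us!k)$(ms!k)) * - past_limit (\<lambda>x. T x (interleave ms (replicate s 0))) (- w))) (at_right 0)"
proof -
  let ?G = "\<lambda>c. of_real c * (\<Sum>ms\<in>lists_len s. of_real (\<Prod>k<s. (us!k)$(ms!k)) *
     hext 1 (\<lambda>x. T x (interleave ms (replicate s 0))) (w + c *\<^sub>R e0))"
  have id: "((\<lambda>c::real. c) \<longlongrightarrow> 1) (at_left 1)" by (rule tendsto_ident_at)
  have "(?G \<longlongrightarrow> of_real 1 * (\<Sum>ms\<in>lists_len s. of_real (\<Prod>k<s. (us!k)$(ms!k)) * - past_limit (\<lambda>x. T x (interleave ms (replicate s 0))) (- w))) (at_left 1)"
    by (intro tendsto_mult tendsto_of_real id tendsto_sum tendsto_const wave_limits(2)[OF wave w] length_arg)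
  from filterlim_compose[OF this filterlim_conf_time_right]
  have "((\<lambda>z. ?G (conf_time z)) \<longlongrightarrow> (\<Sum>ms\<in>lists_len s. of_real (\<Prod>k<s. (us!k)$(ms!k)) * - past_limit (\<lambda>x. T x (interleave ms (replicate s 0))) (- w))) (at_right 0)"
    by (simp only: of_real_1 mult_1_left)
  moreover have "\<forall>\<^sub>F z in at_right 0. ?G (conf_time z) = comp_over_z s (Efield s T) w us z"
    unfolding eventually_at_right_field by (rule exI[of _ 1]) (auto simp: comp_over_z_eq w)
  ultimately show ?thesis by (rule Lim_transform_eventually)
qed

lemma comp_tendsto_left:
  assumes w: "on_S3 w"
  shows "(comp_over_z s (Efield s T) w us \<longlongrightarrow>
     - (\<Sum>ms\<in>lists_len s. of_real (\<Prod>k<s. (us!k)$(ms!k)) * past_limit (\<lambda>x. T x (interleave ms (replicate s 0))) w)) (at_left 0)"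
proof -
  let ?G = "\<lambda>c. of_real c * (\<Sum>ms\<in>lists_len s. of_real (\<Prod>k<s. (us!k)$(ms!k)) *
     hext 1 (\<lambda>x. T x (interleave ms (replicate s 0))) (w + c *\<^sub>R e0))"
  have id: "((\<lambda>c::real. c) \<longlongrightarrow> -1) (at_right (-1))" by (rule tendsto_ident_at)
  have "(?G \<longlongrightarrow> of_real (-1) * (\<Sum>ms\<in>lists_len s. of_real (\<Prod>k<s. (us!k)$(ms!k)) * past_limit (\<lambda>x. T x (interleave ms (replicate s 0))) w)) (at_right (-1))"
    by (intro tendsto_mult tendsto_of_real id tendsto_sum tendsto_const wave_limits(1)[OF wave w] length_arg)
  from filterlim_compose[OF this filterlim_conf_time_left]
  have "((\<lambda>z. ?G (conf_time z)) \<longlongrightarrow> - (\<Sum>ms\<in>lists_len s. of_real (\<Prod>k<s. (us!k)$(ms!k)) * past_limit (\<lambda>x. T x (interleave ms (replicate s 0))) w)) (at_left 0)"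
    by (simp only: of_real_minus of_real_1 mult_minus_left mult_1_left)
  moreover have "\<forall>\<^sub>F z in at_left 0. ?G (conf_time z) = comp_over_z s (Efield s T) w us z"
    unfolding eventually_at_left_field by (rule exI[of _ "-1"]) (auto simp: comp_over_z_eq w)
  ultimately show ?thesis by (rule Lim_transform_eventually)
qed

lemma limits_zero_of_even:
  assumes even: "\<And>x ms. x \<in> dS4 \<Longrightarrow> length ms = 2 * s \<Longrightarrow> T (- x) ms = T x ms" and w: "on_S3 w"
  shows "(comp_over_z s (Efield s T) w us \<longlongrightarrow> 0) (at_right 0)" "(comp_over_z s (Efield s T) w us \<longlongrightarrow> 0) (at_left 0)"
proof -
  have z: "past_limit (\<lambda>x. T x (interleave ms (replicate s 0))) w = 0" if "ms \<in> lists_len s" "on_S3 w" for ms w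
    by (rule past_limit_zero_of_even[OF wave[OF length_arg[OF that(1)]] even[OF _ length_arg[OF that(1)]] that(2)])
  show "(comp_over_z s (Efield s T) w us \<longlongrightarrow> 0) (at_right 0)"
    using comp_tendsto_right[OF w, of us] by (simp add: z[OF _ on_S3_minus[OF w]])
  show "(comp_over_z s (Efield s T) w us \<longlongrightarrow> 0) (at_left 0)"
    using comp_tendsto_left[OF w, of us] by (simp add: z[OF _ w])
qed

section \<open>Symmetries of the limiting tensor\<close>

lemma past_limit_unique:
  assumes "wave_on_dS4 F" "on_S3 w" "((\<lambda>c. hext 1 F (w + c *\<^sub>R e0)) \<longlongrightarrow> L) (at_right (-1))"
  shows "past_limit F w = L"
  by (rule tendsto_unique[OF trivial_limit_at_right_real wave_limits(1)[OF assms(1,2)] assms(3)])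

lemma past_limit_anti:
  assumes w: "on_S3 w" and r: "length r = 2 * s - 2"
  shows "past_limit (\<lambda>x. T x (n # m # r)) w = - past_limit (\<lambda>x. T x (m # n # r)) w"
proof -
  have l: "length (m # n # r) = 2 * s" for m n using r rank by simp
  have "hext 1 (\<lambda>x. T x (n # m # r)) X = - hext 1 (\<lambda>x. T x (m # n # r)) X" if "X \<in> cone" for X
    unfolding hext_def using anti[OF normalize_dS4[OF that] r, of n m] by simp
  then have "\<forall>\<^sub>F c in at_right (-1). - hext 1 (\<lambda>x. T x (m # n # r)) (w + c *\<^sub>R e0) = hext 1 (\<lambda>x. T x (n # m # r)) (w + c *\<^sub>R e0)"
    using eventually_mono[OF eventually_slice_right] slice_in_cone[OF w] by (smt (verit))
  from Lim_transform_eventually[OF tendsto_minus[OF wave_limits(1)[OF wave[OF l] w]] this]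
  show ?thesis by (rule past_limit_unique[OF wave[OF l] w])
qed

lemma past_limit_perm:
  assumes w: "on_S3 w" and l: "length ps = s" and m: "mset ps = mset qs"
  shows "past_limit (\<lambda>x. T x (flat ps)) w = past_limit (\<lambda>x. T x (flat qs)) w"
proof -
  have lq: "length qs = s" using l m by (metis size_mset)
  have "hext 1 (\<lambda>x. T x (flat qs)) X = hext 1 (\<lambda>x. T x (flat ps)) X" if "X \<in> cone" for X
    unfolding hext_def using perm[OF normalize_dS4[OF that] l m] by simp
  then have "\<forall>\<^sub>F c in at_right (-1). hext 1 (\<lambda>x. T x (flat qs)) (w + c *\<^sub>R e0) = hext 1 (\<lambda>x. T x (flat ps)) (w + c *\<^sub>R e0)"
    using eventually_mono[OF eventually_slice_right] slice_in_cone[OF w] by (smt (verit))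
  from Lim_transform_eventually[OF wave_limits(1)[OF wave w] this]
  show ?thesis using l lq by (intro past_limit_unique[OF wave w]) auto
qed

text \<open>Points of dS4 run off to infinity, but by homogeneity tangency holds equally at
  \<open>w + c *\<^sub>R e0\<close>, where both the vector and the field converge. The limiting
  vector is null.\<close>

lemma past_limit_tangent:
  assumes w: "on_S3 w" and ms: "length ms = 2 * s" "i < 2 * s"
  shows "(\<Sum>\<alpha>\<in>UNIV. of_real ((w - e0)$\<alpha>) * past_limit (\<lambda>x. T x (ms[i := \<alpha>])) w) = 0"
proof -
  let ?G = "\<lambda>c. \<Sum>\<alpha>\<in>UNIV. of_real ((w + c *\<^sub>R e0)$\<alpha>) * hext 1 (\<lambda>x. T x (ms[i := \<alpha>])) (w + c *\<^sub>R e0)"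
  have l: "length (ms[i := \<alpha>]) = 2 * s" for \<alpha> using ms by simp
  have id: "((\<lambda>c::real. c) \<longlongrightarrow> -1) (at_right (-1))" by (rule tendsto_ident_at)
  have "(?G \<longlongrightarrow> (\<Sum>\<alpha>\<in>UNIV. of_real ((w + (-1) *\<^sub>R e0)$\<alpha>) * past_limit (\<lambda>x. T x (ms[i := \<alpha>])) w)) (at_right (-1))"
    by (intro tendsto_sum tendsto_mult tendsto_of_real tendsto_vec_nth tendsto_add tendsto_const tendsto_scaleR id wave_limits(1)[OF wave[OF l] w])
  moreover have "?G c = 0" if "\<bar>c\<bar> < 1" for c
  proof -
    let ?X = "w + c *\<^sub>R e0" and ?q = "inverse (sqrt (mink (w + c *\<^sub>R e0) (w + c *\<^sub>R e0)))"
    have X: "?X \<in> cone" by (rule slice_in_cone[OF w that])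
    have "?G c = (\<Sum>\<alpha>\<in>UNIV. of_real ((?q *\<^sub>R ?X)$\<alpha>) * T (?q *\<^sub>R ?X) (ms[i := \<alpha>]))"
      unfolding hext_def power_one_right by (simp only: scaleR_conv_of_real[where 'a=complex] vector_scaleR_component of_real_mult real_scaleR_def mult_ac)
    also have "\<dots> = 0" by (rule tan[OF normalize_dS4[OF X] ms])
    finally show ?thesis .
  qed
  then have "\<forall>\<^sub>F c in at_right (-1). ?G c = 0" by (rule eventually_mono[OF eventually_slice_right])
  ultimately have "((\<lambda>c::real. 0) \<longlongrightarrow> (\<Sum>\<alpha>\<in>UNIV. of_real ((w + (-1) *\<^sub>R e0)$\<alpha>) * past_limit (\<lambda>x. T x (ms[i := \<alpha>])) w)) (at_right (-1))"
    by (rule Lim_transform_eventually)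
  from tendsto_unique[OF trivial_limit_at_right_real this tendsto_const] show ?thesis by simp
qed

text \<open>A time index in a first position yields the pair (0, 0), which symmetry moves to the
  front and antisymmetry kills. Contraction with the null vector w - e0 then reduces to contraction
  with w, and the electric components are determined by their tangential ones.\<close>

lemma past_limit_electric_zero:
  assumes w: "on_S3 w" and ms: "length ms = s"
    and lim: "\<And>us. length us = s \<Longrightarrow> (\<forall>u\<in>set us. tangent_S3 w u) \<Longrightarrow> (comp_over_z s (Efield s T) w us \<longlongrightarrow> 0) (at_left 0)"
  shows "past_limit (\<lambda>x. T x (interleave ms (replicate s 0))) w = 0"
proof (rule tangential_components_determine[OF w, where S="\<lambda>ms. past_limit (\<lambda>x. T x (interleave ms (replicate s 0))) w", OF _ _ _ ms])
  have zero: "past_limit (\<lambda>x. T x (interleave (ms[i := 0]) (replicate s 0))) w = 0" if a: "length ms = s" "i < s" for ms i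
  proof -
    let ?ps = "zip (ms[i := 0]) (replicate s 0)"
    have "?ps ! i = (0, 0)" using a by simp
    then have "(0, 0) \<in> set ?ps" using a by (metis length_list_update length_replicate length_zip min.idem nth_mem)
    then have m: "mset ?ps = mset ((0, 0) # remove1 (0, 0) ?ps)" by (rule mset_Cons_remove1)
    have l: "length ?ps = s" using a by simp
    have r1: "length (remove1 (0, 0) ?ps) = s - 1" using l \<open>(0, 0) \<in> set ?ps\<close> by (metis length_remove1)
    have r: "length (flat (remove1 (0, 0) ?ps)) = 2 * s - 2" unfolding length_flat r1 by (simp add: diff_mult_distrib2)
    have "past_limit (\<lambda>x. T x (interleave (ms[i := 0]) (replicate s 0))) w = past_limit (\<lambda>x. T x (0 # 0 # flat (remove1 (0, 0) ?ps))) w"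
      using past_limit_perm[OF w l m] a by (simp add: interleave_flat)
    moreover have "2 * past_limit (\<lambda>x. T x (0 # 0 # flat (remove1 (0, 0) ?ps))) w = 0"
      using past_limit_anti[OF w r, of 0 0] by simp
    ultimately show ?thesis by simp
  qed
  show "past_limit (\<lambda>x. T x (interleave (ms[i := 0]) (replicate s 0))) w = 0" if "length ms = s" "i < s" for ms i
    using zero[OF that] .
  show "(\<Sum>\<alpha>\<in>UNIV. of_real (w$\<alpha>) * past_limit (\<lambda>x. T x (interleave (ms[i := \<alpha>]) (replicate s 0))) w) = 0" if a: "length ms = s" "i < s" for ms i
  proof -
    have "(\<Sum>\<alpha>\<in>UNIV. of_real ((w - e0)$\<alpha>) * past_limit (\<lambda>x. T x (interleave (ms[i := \<alpha>]) (replicate s 0))) w) = 0"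
      using past_limit_tangent[OF w, of "interleave ms (replicate s 0)" "2 * i"] a by (simp add: interleave_update1 length_interleave)
    then have "(\<Sum>\<alpha>\<in>UNIV. of_real (w$\<alpha>) * past_limit (\<lambda>x. T x (interleave (ms[i := \<alpha>]) (replicate s 0))) w)
       = (\<Sum>\<alpha>\<in>UNIV. of_real (e0$\<alpha>) * past_limit (\<lambda>x. T x (interleave (ms[i := \<alpha>]) (replicate s 0))) w)"
      by (simp add: left_diff_distrib sum_subtractf)
    also have "\<dots> = 0"
      using zero[OF a] by (intro sum.neutral) (auto simp: axis_def)
    finally show ?thesis .
  qed
  show "(\<Sum>ms\<in>lists_len s. of_real (\<Prod>k<s. (us!k)$(ms!k)) * past_limit (\<lambda>x. T x (interleave ms (replicate s 0))) w) = 0"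
    if "length us = s" "\<forall>u\<in>set us. tangent_S3 w u" for us
    using tendsto_unique[OF trivial_limit_at_left_real comp_tendsto_left[OF w] lim[OF that]] by simp
qed

text \<open>Since w - e0 has time component 1 after lowering the index, wedge expresses a component
  with the pair (b, c) through components with the pairs (b, 0) and (c, 0).\<close>

lemma past_limit_zero:
  assumes w: "on_S3 w"
    and lim: "\<And>us. length us = s \<Longrightarrow> (\<forall>u\<in>set us. tangent_S3 w u) \<Longrightarrow> (comp_over_z s (Efield s T) w us \<longlongrightarrow> 0) (at_left 0)"
    and ps: "length ps = s"
  shows "past_limit (\<lambda>x. T x (flat ps)) w = 0"
  using ps
proof (induction "length (filter (\<lambda>p. snd p \<noteq> 0) ps)" arbitrary: ps rule: less_induct)
  case less
  show ?case
  proof (cases "\<exists>p\<in>set ps. snd p \<noteq> 0")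
    case False
    then have "map snd ps = replicate s 0" using less.prems by (intro replicate_eqI) auto
    then have "ps = zip (map fst ps) (replicate s 0)" by (metis zip_map_fst_snd)
    then have "flat ps = interleave (map fst ps) (replicate s 0)" using less.prems by (metis interleave_flat length_map length_replicate)
    then show ?thesis using past_limit_electric_zero[OF w _ lim, of "map fst ps"] less.prems by simp
  next
    case True
    then obtain b c where p: "(b, c) \<in> set ps" "c \<noteq> 0" by auto
    define rs where "rs = remove1 (b, c) ps"
    have m: "mset ps = mset ((b, c) # rs)" unfolding rs_def by (rule mset_Cons_remove1[OF p(1)])
    have lr: "Suc (length rs) = s" using m less.prems by (metis length_Cons size_mset)
    then have r: "length (flat rs) = 2 * s - 2" by simp
    have "length (filter (\<lambda>p. snd p \<noteq> 0) ps) = length (filter (\<lambda>p. snd p \<noteq> 0) ((b, c) # rs))"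
      using m by (metis mset_filter size_mset)
    then have lt: "length (filter (\<lambda>p. snd p \<noteq> 0) ((d, 0) # rs)) < length (filter (\<lambda>p. snd p \<noteq> 0) ps)" for d :: 5
      using p by simp
    have z: "past_limit (\<lambda>x. T x (d # 0 # flat rs)) w = 0" for d
      using less.hyps[OF lt, of d] lr by simp
    have z': "past_limit (\<lambda>x. T x (0 # d # flat rs)) w = 0" for d
      using past_limit_anti[OF w r, of 0 d] z by simp
    have "lower (w - e0) 0 = 1" using w by (simp add: lower_def eta_def on_S3_def mink_e0)
    then have "past_limit (\<lambda>x. T x (b # c # flat rs)) w = 0"
      using wedge[OF w r, of 0 b c] by (simp add: z z')
    then show ?thesis using past_limit_perm[OF w less.prems m] by simp
  qed
qed

lemma even_of_limits_zero:
  assumes lim: "\<And>w us. on_S3 w \<Longrightarrow> length us = s \<Longrightarrow> (\<forall>u\<in>set us. tangent_S3 w u) \<Longrightarrow> (comp_over_z s (Efield s T) w us \<longlongrightarrow> 0) (at_left 0)"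
    and x: "x \<in> dS4" and ms: "length ms = 2 * s"
  shows "T (- x) ms = T x ms"
proof -
  obtain ps where ps: "length ps = s" "flat ps = ms" using flat_surj[OF ms] by blast
  show ?thesis
    using even_of_past_limit_zero[OF wave[OF ms] _ x] past_limit_zero[OF _ lim ps(1)] ps(2) by blast
qed

end

section \<open>The dual field\<close>

lemma lev3_cyclic: "lev3 m n (\<lambda>\<rho> \<sigma> l. A \<sigma> l \<rho>) = lev3 m n A"
proof -
  have "levi m n \<rho> \<sigma> l = levi m n \<sigma> l \<rho>" for \<rho> \<sigma> l
    using levi_swap(4)[of m n \<sigma> l \<rho>] levi_swap(3)[of m n \<sigma> \<rho> l] by simp
  note cyc = this
  have "lev3 m n (\<lambda>\<rho> \<sigma> l. A \<sigma> l \<rho>) = (\<Sum>\<rho>\<in>UNIV. \<Sum>\<sigma>\<in>UNIV. \<Sum>l\<in>UNIV. of_real (levi m n \<sigma> l \<rho>) * A \<sigma> l \<rho>)"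
    unfolding lev3_def
  proof (intro sum.cong refl)
    fix \<rho> \<sigma> l
    show "of_real (levi m n \<rho> \<sigma> l) * A \<sigma> l \<rho> = of_real (levi m n \<sigma> l \<rho>) * A \<sigma> l \<rho>" by (simp only: cyc[of \<rho> \<sigma> l])
  qed
  also have "\<dots> = lev3 m n A"
    unfolding lev3_def by (subst sum.swap, rule sum.cong[OF refl], rule sum.swap)
  finally show ?thesis .
qed

lemma lev3_zero_of_cyclic:
  assumes "\<And>a b c. A a b c + A b c a + A c a b = 0"
  shows "lev3 m n A = 0"
proof -
  have "lev3 m n A + lev3 m n (\<lambda>\<rho> \<sigma> l. A \<sigma> l \<rho>) + lev3 m n (\<lambda>\<rho> \<sigma> l. A l \<rho> \<sigma>) = 0"
    unfolding lev3_def sum.distrib[symmetric] distrib_left[symmetric] assms by simp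
  moreover have "lev3 m n (\<lambda>\<rho> \<sigma> l. A l \<rho> \<sigma>) = lev3 m n A"
    using lev3_cyclic[of m n "\<lambda>\<rho> \<sigma> l. A l \<rho> \<sigma>"] by simp
  ultimately have "3 * lev3 m n A = 0" using lev3_cyclic[of m n A] by simp
  then show ?thesis by simp
qed

lemma antisym_double_sum:
  fixes g :: "5 \<Rightarrow> 5 \<Rightarrow> complex"
  assumes "\<And>a b. g b a = - g a b" shows "(\<Sum>a\<in>UNIV. \<Sum>b\<in>UNIV. g a b) = 0"
proof -
  have "(\<Sum>a\<in>UNIV. \<Sum>b\<in>UNIV. g a b) = (\<Sum>b\<in>UNIV. \<Sum>a\<in>UNIV. - g b a)"
    by (subst sum.swap) (intro sum.cong refl assms)
  also have "\<dots> = - (\<Sum>a\<in>UNIV. \<Sum>b\<in>UNIV. g a b)" by (simp only: sum_negf)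
  finally have X: "(\<Sum>a\<in>UNIV. \<Sum>b\<in>UNIV. g a b) = - (\<Sum>a\<in>UNIV. \<Sum>b\<in>UNIV. g a b)" .
  have "z = 0" if "z = - z" for z :: complex using that by (simp add: complex_eq_iff)
  from this[OF X] show ?thesis .
qed

lemma sum_lev3: "(\<Sum>\<alpha>\<in>UNIV. lev3 m n (A \<alpha>)) = lev3 m n (\<lambda>\<rho> \<sigma> l. \<Sum>\<alpha>\<in>UNIV. A \<alpha> \<rho> \<sigma> l)"
  unfolding lev3_def sum_distrib_left
  by (subst sum.swap, rule sum.cong[OF refl], subst sum.swap, rule sum.cong[OF refl], rule sum.swap)

lemma star_linear: "(\<Sum>\<alpha>\<in>UNIV. c \<alpha> * star x (F \<alpha>) m n) = star x (\<lambda>\<rho> \<sigma>. \<Sum>\<alpha>\<in>UNIV. c \<alpha> * F \<alpha> \<rho> \<sigma>) m n"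
  unfolding star_def lev3_cmult[symmetric] sum_lev3 by (simp add: sum_distrib_left mult_ac)

text \<open>The normal enters the antisymmetric symbol twice.\<close>

lemma star_contract: "(\<Sum>\<alpha>\<in>UNIV. of_real (lower x \<alpha>) * star x F \<alpha> n) = 0"
proof -
  let ?f = "\<lambda>\<alpha> \<rho> \<sigma> l. complex_of_real (lower x \<alpha>) * (of_real (levi \<alpha> n \<rho> \<sigma> l) * (of_real (lower x l) * F \<rho> \<sigma>))"
  have "(\<Sum>\<alpha>\<in>UNIV. of_real (lower x \<alpha>) * star x F \<alpha> n) = (\<Sum>\<alpha>\<in>UNIV. \<Sum>\<rho>\<in>UNIV. \<Sum>\<sigma>\<in>UNIV. \<Sum>l\<in>UNIV. ?f \<alpha> \<rho> \<sigma> l)"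
    by (simp add: star_def lev3_def sum_distrib_left)
  also have "\<dots> = (\<Sum>\<rho>\<in>UNIV. \<Sum>\<sigma>\<in>UNIV. \<Sum>\<alpha>\<in>UNIV. \<Sum>l\<in>UNIV. ?f \<alpha> \<rho> \<sigma> l)"
    by (subst sum.swap, rule sum.cong[OF refl], rule sum.swap)
  also have "\<dots> = 0"
  proof (rule sum.neutral, rule ballI, rule sum.neutral, rule ballI)
    fix \<rho> \<sigma>
    show "(\<Sum>\<alpha>\<in>UNIV. \<Sum>l\<in>UNIV. ?f \<alpha> \<rho> \<sigma> l) = 0"
    proof (rule antisym_double_sum[where g="\<lambda>\<alpha> l. ?f \<alpha> \<rho> \<sigma> l"])
      fix a b
      show "?f b \<rho> \<sigma> a = - ?f a \<rho> \<sigma> b" using levi_swap_far(3)[of b n \<rho> \<sigma> a] by simp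
    qed
  qed
  finally show ?thesis .
qed

lemma box_sum:
  assumes U: "open U" "dS4 \<subseteq> U" and F: "\<And>i. i \<in> I \<Longrightarrow> smooth_on U (F i)" and x: "x \<in> dS4"
  shows "(\<Sum>a\<in>UNIV. of_real (eta a) * tder a 2 (tder a 1 (\<lambda>x. \<Sum>i\<in>I. c i * F i x)) x) =
    (\<Sum>i\<in>I. c i * (\<Sum>a\<in>UNIV. of_real (eta a) * tder a 2 (tder a 1 (F i)) x))"
proof -
  have xU: "x \<in> U" using x U by auto
  have d: "F i differentiable (at y)" "tder a 1 (F i) differentiable (at y)" if "y \<in> U" "i \<in> I" for a i y
    using smooth_on_differentiable[OF F] smooth_on_differentiable[OF smooth_on_tder[OF U(1) F]] that by auto
  have cd: "(\<lambda>y. c i * F i y) differentiable (at y)" "(\<lambda>y. c i * tder a 1 (F i) y) differentiable (at y)" if "y \<in> U" "i \<in> I" for a i y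
    using differentiable_mult[OF differentiable_const d(1)[OF that]] differentiable_mult[OF differentiable_const d(2)[OF that]] by auto
  have t1: "tder a 1 (\<lambda>x. \<Sum>i\<in>I. c i * F i x) y = (\<Sum>i\<in>I. c i * tder a 1 (F i) y)" if "y \<in> U" for a y
    by (subst tder_sum) (auto intro!: sum.cong cd tder_cmult d that)
  have ds: "(\<lambda>y. \<Sum>i\<in>I. c i * tder a 1 (F i) y) differentiable (at x)" for a
  proof (cases "finite I")
    case True
    then show ?thesis using cd(2)[OF xU] by (intro differentiable_sum) blast+
  qed simp
  have t2: "tder a 2 (tder a 1 (\<lambda>x. \<Sum>i\<in>I. c i * F i x)) x = (\<Sum>i\<in>I. c i * tder a 2 (tder a 1 (F i)) x)" for a
  proof -
    have "tder a 2 (tder a 1 (\<lambda>x. \<Sum>i\<in>I. c i * F i x)) x = tder a 2 (\<lambda>y. \<Sum>i\<in>I. c i * tder a 1 (F i) y) x"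
      by (rule tder_cong[OF U(1) xU t1[symmetric] ds, symmetric])
    also have "\<dots> = (\<Sum>i\<in>I. tder a 2 (\<lambda>y. c i * tder a 1 (F i) y) x)"
      by (rule tder_sum[OF cd(2)[OF xU]])
    also have "\<dots> = (\<Sum>i\<in>I. c i * tder a 2 (tder a 1 (F i)) x)"
      by (intro sum.cong refl tder_cmult d(2)[OF xU])
    finally show ?thesis .
  qed
  show ?thesis unfolding t2 sum_distrib_left by (subst sum.swap) (simp add: mult_ac)
qed

text \<open>The Hodge dual on the first pair; for a field strength
  \<open>star_pair_symmetric\<close> makes the choice of the pair immaterial.\<close>

fun dual :: "(real^5 \<Rightarrow> 5 list \<Rightarrow> complex) \<Rightarrow> real^5 \<Rightarrow> 5 list \<Rightarrow> complex" where
  "dual T x (m # n # r) = (1/2) * (\<Sum>\<rho>\<in>UNIV. \<Sum>\<sigma>\<in>UNIV. of_real (eps_mix x m n \<rho> \<sigma>) * T x (\<rho> # \<sigma> # r))"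
| "dual T x _ = 0"

lemma dual_star: "dual T x (m # n # r) = of_real (eta m * eta n / 2) * star x (\<lambda>\<rho> \<sigma>. T x (\<rho> # \<sigma> # r)) m n"
  by (simp add: star_def lev3_def eps_mix_def sum_distrib_left sum_distrib_right mult_ac)

lemma star_dual: "star x (\<lambda>\<rho> \<sigma>. T x (\<rho> # \<sigma> # r)) m n = 2 * of_real (eta m * eta n) * dual T x (m # n # r)"
  unfolding dual_star by (simp add: eta_sq_complex mult_ac)

lemma past_limit_eqI:
  "((\<lambda>c. hext 1 F (w + c *\<^sub>R e0)) \<longlongrightarrow> L) (at_right (-1)) \<Longrightarrow> past_limit F w = L"
  unfolding past_limit_def by (rule tendsto_Lim[OF trivial_limit_at_right_real])

lemma past_limit_uminus:
  assumes F: "wave_on_dS4 F" and w: "on_S3 w" and G: "\<And>x. x \<in> dS4 \<Longrightarrow> G x = - F x"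
  shows "past_limit G w = - past_limit F w"
proof (rule past_limit_eqI, rule Lim_transform_eventually[OF tendsto_minus[OF wave_limits(1)[OF F w]]])
  show "\<forall>\<^sub>F c in at_right (-1). - hext 1 F (w + c *\<^sub>R e0) = hext 1 G (w + c *\<^sub>R e0)"
  proof (rule eventually_mono[OF eventually_slice_right])
    fix c :: real assume "\<bar>c\<bar> < 1"
    then show "- hext 1 F (w + c *\<^sub>R e0) = hext 1 G (w + c *\<^sub>R e0)"
      using G[OF normalize_dS4[OF slice_in_cone[OF w]]] by (simp add: hext_def)
  qed
qed

lemma slice_mink: "on_S3 w \<Longrightarrow> mink (w + c *\<^sub>R e0) (w + c *\<^sub>R e0) = 1 - c\<^sup>2"
  by (simp add: mink_linear mink_e0 on_S3_def power2_eq_square)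

lemma slice_scale:
  assumes w: "on_S3 w" and c: "\<bar>c\<bar> < 1"
  defines "x \<equiv> inverse (sqrt (1 - c\<^sup>2)) *\<^sub>R (w + c *\<^sub>R e0)"
  shows "x \<in> dS4" "w + c *\<^sub>R e0 = sqrt (1 - c\<^sup>2) *\<^sub>R x" "F x = of_real (sqrt (1 - c\<^sup>2)) * hext 1 F (w + c *\<^sub>R e0)"
    "sqrt (1 - c\<^sup>2) > 0"
proof -
  show p: "sqrt (1 - c\<^sup>2) > 0" using c by (simp add: abs_square_less_1)
  show "x \<in> dS4" using normalize_dS4[OF slice_in_cone[OF w c]] by (simp add: x_def slice_mink[OF w])
  show "w + c *\<^sub>R e0 = sqrt (1 - c\<^sup>2) *\<^sub>R x" using p by (simp add: x_def)
  show "F x = of_real (sqrt (1 - c\<^sup>2)) * hext 1 F (w + c *\<^sub>R e0)"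
    using p by (simp add: hext_def slice_mink[OF w] x_def scaleR_conv_of_real[where 'a=complex])
qed

lemma tendsto_sqrt_slice: "((\<lambda>c. complex_of_real (sqrt (1 - c\<^sup>2))) \<longlongrightarrow> 0) (at_right (-1))"
proof -
  have id: "((\<lambda>c::real. c) \<longlongrightarrow> -1) (at_right (-1))" by (rule tendsto_ident_at)
  have "((\<lambda>c. complex_of_real (sqrt (1 - c\<^sup>2))) \<longlongrightarrow> of_real (sqrt (1 - (-1)\<^sup>2))) (at_right (-1))"
    by (intro tendsto_of_real tendsto_real_sqrt tendsto_diff tendsto_const tendsto_power id)
  then show ?thesis by simp
qed

lemma tendsto_slice_coord: "((\<lambda>c. complex_of_real ((w + c *\<^sub>R e0)$i)) \<longlongrightarrow> of_real ((w - e0)$i)) (at_right (-1))"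
proof -
  have id: "((\<lambda>c::real. c) \<longlongrightarrow> -1) (at_right (-1))" by (rule tendsto_ident_at)
  have "((\<lambda>c. complex_of_real ((w + c *\<^sub>R e0)$i)) \<longlongrightarrow> of_real ((w + (-1) *\<^sub>R e0)$i)) (at_right (-1))"
    by (intro tendsto_of_real tendsto_vec_nth tendsto_add tendsto_const tendsto_scaleR id)
  then show ?thesis by simp
qed

section \<open>Wave equations and symmetries of the field and its dual\<close>

context spin_field
begin

text \<open>As for the Maxwell field: the Bianchi identity rewrites the wave operator as derivatives
  of divergences, once the two flat derivatives have been commuted.\<close>

lemma boxd_zero:
  assumes x: "x \<in> dS4" and ms: "length ms = 2 * s"
  shows "boxd (\<lambda>y. \<Phi> y ms) x = 0"
proof -
  obtain m n r where mr: "ms = m # n # r" "length r = 2 * s - 2"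
    using ms s1 by (cases ms; cases "tl ms") auto
  have l: "length (a # b # r) = 2 * s" for a b using mr s1 by simp
  let ?F = "\<lambda>a b y. \<Phi> y (a # b # r)"
  have sm: "smooth_on U (?F a b)" "smooth_on U (tder c k (?F a b))" for a b c k
    using smooth[OF l] smooth_on_tder[OF U(1) smooth[OF l]] by auto
  have dt: "tder c k (?F a b) differentiable (at x)" for a b c k
    using smooth_on_differentiable[OF sm(2)] U(2) x by auto
  have tw: "tder b 3 (tder a 2 G) x = tder a 3 (tder b 2 G) x" if "smooth_on U G" for a b G
    using tder_commute[OF U that x, of b 2 a] by (simp add: numeral_3_eq_3 numeral_2_eq_2)
  have 1: "tder a 3 (tder a 2 (?F m n)) x = - tder m 3 (tder a 2 (?F n a)) x - tder n 3 (tder a 2 (?F a m)) x" for a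
  proof -
    have "tder a 3 (\<lambda>y. tder a 2 (?F m n) y + tder m 2 (?F n a) y + tder n 2 (?F a m) y) x = 0"
    proof (rule tder_zero[OF U _ _ x])
      show "smooth_on U (\<lambda>y. tder a 2 (?F m n) y + tder m 2 (?F n a) y + tder n 2 (?F a m) y)"
        by (intro smooth_on_add U sm)
      show "tder a 2 (?F m n) y + tder m 2 (?F n a) y + tder n 2 (?F a m) y = 0" if "y \<in> dS4" for y
        using dP_bianchi[OF that mr(2), of a m n] by (simp add: dP_def)
    qed
    then have "tder a 3 (tder a 2 (?F m n)) x + tder a 3 (tder m 2 (?F n a)) x + tder a 3 (tder n 2 (?F a m)) x = 0"
      by (simp add: tder_add dt)
    then have "tder a 3 (tder a 2 (?F m n)) x = - (tder a 3 (tder m 2 (?F n a)) x + tder a 3 (tder n 2 (?F a m)) x)"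
      by (simp only: add.assoc eq_neg_iff_add_eq_0)
    then show ?thesis unfolding tw[OF sm(1), of a m] tw[OF sm(1), of a n] by simp
  qed
  have 2: "(\<Sum>a\<in>UNIV. of_real (eta a) * tder p 3 (tder a 2 (G a)) x) = 0"
    if G: "\<And>a. smooth_on U (G a)" and z: "\<And>y. y \<in> dS4 \<Longrightarrow> (\<Sum>a\<in>UNIV. of_real (eta a) * tder a 2 (G a) y) = 0" for p and G :: "5 \<Rightarrow> real^5 \<Rightarrow> complex"
  proof -
    have dG: "tder a 2 (G a) differentiable (at x)" for a
      using smooth_on_differentiable[OF smooth_on_tder[OF U(1) G]] U(2) x by auto
    have "0 = tder p 3 (\<lambda>y. \<Sum>a\<in>UNIV. of_real (eta a) * tder a 2 (G a) y) x"
      by (rule tder_zero[OF U _ z x, symmetric]) (intro smooth_on_sum smooth_on_cmult smooth_on_tder U G)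
    also have "\<dots> = (\<Sum>a\<in>UNIV. tder p 3 (\<lambda>y. of_real (eta a) * tder a 2 (G a) y) x)"
      by (rule tder_sum) (intro differentiable_mult differentiable_const dG)
    also have "\<dots> = (\<Sum>a\<in>UNIV. of_real (eta a) * tder p 3 (tder a 2 (G a)) x)"
      by (intro sum.cong refl tder_cmult dG)
    finally show ?thesis by simp
  qed
  have A: "(\<Sum>a\<in>UNIV. of_real (eta a) * tder n 3 (tder a 2 (?F a m)) x) = 0"
    by (rule 2[OF sm(1)]) (use dP_div[of _ "m # r"] mr s1 in \<open>simp add: dP_def\<close>)
  have B: "(\<Sum>a\<in>UNIV. of_real (eta a) * tder m 3 (tder a 2 (?F n a)) x) = 0"
  proof (rule 2[OF sm(1)])
    fix y assume y: "y \<in> dS4"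
    have "tder a 2 (?F n a) y = (-1) * tder a 2 (?F a n) y" for a
      by (rule tder_eq_cmult[OF l l y]) (simp add: antisym[OF _ mr(2), of _ n a])
    then show "(\<Sum>a\<in>UNIV. of_real (eta a) * tder a 2 (?F n a) y) = 0"
      using dP_div[OF y, of "n # r"] mr s1 by (simp add: dP_def sum_negf)
  qed
  show ?thesis unfolding boxd_def mr(1) 1 by (simp add: right_diff_distrib sum_subtractf sum_negf A B)
qed

lemma wave_field: "length ms = 2 * s \<Longrightarrow> wave_on_dS4 (\<lambda>x. \<Phi> x ms)"
  unfolding wave_on_dS4_def
  using conformal_wave_hext[OF U smooth] box_weight_shift[OF U smooth] boxd_zero by fastforce

text \<open>The dual is the field times a coordinate, contracted with the symbol. By
  \<open>box_coord_mult\<close> its wave operator is, apart from terms that vanish for the field,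
  the contraction of the symbol with the first derivatives, which is zero by the Bianchi
  identity.\<close>

lemma wave_dual:
  assumes ms: "length ms = 2 * s" shows "wave_on_dS4 (\<lambda>x. dual \<Phi> x ms)"
proof -
  obtain m n r where mr: "ms = m # n # r" "length r = 2 * s - 2"
    using ms s1 by (cases ms; cases "tl ms") auto
  have l: "length (a # b # r) = 2 * s" for a b using mr s1 by simp
  \<comment> \<open>The triple sum is written as one sum over triples, constants split from
    functions, to match \<open>box_sum\<close>.\<close>
  define c :: "5 \<times> 5 \<times> 5 \<Rightarrow> complex" where
    "c p = of_real (eta m * eta n / 2 * (levi m n (fst p) (fst (snd p)) (snd (snd p)) * eta (snd (snd p))))" for p
  define F :: "5 \<times> 5 \<times> 5 \<Rightarrow> real^5 \<Rightarrow> complex" where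
    "F p x = of_real (x $ snd (snd p)) * \<Phi> x (fst p # fst (snd p) # r)" for p x
  have sF: "smooth_on U (F p)" for p unfolding F_def by (intro smooth_on_coord_mult U smooth l)
  have sum3: "(\<Sum>p\<in>UNIV. f p) = (\<Sum>\<rho>\<in>UNIV. \<Sum>\<sigma>\<in>UNIV. \<Sum>l\<in>UNIV. f (\<rho>, \<sigma>, l))" for f :: "5 \<times> 5 \<times> 5 \<Rightarrow> complex"
    by (simp add: sum.cartesian_product)
  have D: "(\<lambda>x. dual \<Phi> x ms) = (\<lambda>x. \<Sum>p\<in>UNIV. c p * F p x)"
    unfolding mr dual_star star_def lev3_def sum3 c_def F_def
    by (simp add: sum_distrib_left lower_def mult_ac)
  have sG: "smooth_on U (\<lambda>x. \<Sum>p\<in>UNIV. c p * F p x)" by (intro smooth_on_sum smooth_on_cmult U sF)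
  have "(\<Sum>a\<in>UNIV. of_real (eta a) * tder a 2 (tder a 1 (\<lambda>x. \<Sum>p\<in>UNIV. c p * F p x)) x) = 0" if x: "x \<in> dS4" for x
  proof -
    have "(\<Sum>a\<in>UNIV. of_real (eta a) * tder a 2 (tder a 1 (F p)) x) = 2 * of_real (eta (snd (snd p))) * dP x (snd (snd p)) (fst p # fst (snd p) # r)" for p
      unfolding F_def using box_coord_mult[OF U smooth[OF l] x] boxd_zero[OF x l] by (simp add: dP_def)
    then have "(\<Sum>a\<in>UNIV. of_real (eta a) * tder a 2 (tder a 1 (\<lambda>x. \<Sum>p\<in>UNIV. c p * F p x)) x) =
      (\<Sum>p\<in>UNIV. c p * (2 * of_real (eta (snd (snd p))) * dP x (snd (snd p)) (fst p # fst (snd p) # r)))"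
      using box_sum[where I=UNIV and c=c and F=F, OF U sF x] by simp
    also have "\<dots> = of_real (eta m * eta n) * lev3 m n (\<lambda>\<rho> \<sigma> l. dP x l (\<rho> # \<sigma> # r))"
      unfolding sum3 c_def lev3_def by (simp add: sum_distrib_left mult_ac eta_sq_complex)
    also have "lev3 m n (\<lambda>\<rho> \<sigma> l. dP x l (\<rho> # \<sigma> # r)) = 0"
      by (rule lev3_zero_of_cyclic) (use dP_bianchi[OF x mr(2)] in \<open>simp add: add_ac\<close>)
    finally show ?thesis by simp
  qed
  from conformal_wave_hext[OF U sG this] show ?thesis unfolding wave_on_dS4_def D by blast
qed

lemma perm_field:
  assumes x: "x \<in> dS4" and ps: "length ps = s" "mset ps = mset qs"
  shows "\<Phi> x (flat ps) = \<Phi> x (flat qs)"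
proof (rule mset_invariant[where f="\<lambda>ps. \<Phi> x (flat ps)", OF _ ps])
  fix ps :: "(5 \<times> 5) list" and k l assume a: "length ps = s" "k < s" "l < s"
  show "\<Phi> x (flat (ps[k := ps!l, l := ps!k])) = \<Phi> x (flat ps)"
    using pairsym_pos[OF x, of "flat ps" k l] a flat_nth[of k ps] flat_nth[of l ps] by (simp add: flat_update)
qed

text \<open>Permuting the pairs behind the first is a symmetry of the field under the dual;
  exchanging the first two pairs is the equality of left and right duals.\<close>

lemma perm_dual:
  assumes x: "x \<in> dS4" and ps: "length ps = s" "mset ps = mset qs"
  shows "dual \<Phi> x (flat ps) = dual \<Phi> x (flat qs)"
proof (rule mset_invariant_step[where f="\<lambda>ps. dual \<Phi> x (flat ps)", OF _ _ ps])
  fix p :: "5 \<times> 5" and ps qs assume a: "length (p # ps) = s" "mset ps = mset qs"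
  obtain m n where p: "p = (m, n)" by (cases p)
  have "\<Phi> x (\<rho> # \<sigma> # flat ps) = \<Phi> x (\<rho> # \<sigma> # flat qs)" for \<rho> \<sigma>
    using perm_field[OF x, of "(\<rho>, \<sigma>) # ps" "(\<rho>, \<sigma>) # qs"] a by simp
  then show "dual \<Phi> x (flat (p # ps)) = dual \<Phi> x (flat (p # qs))" by (simp add: p)
next
  fix p q :: "5 \<times> 5" and r assume a: "length (p # q # r) = s"
  obtain m n k l where p: "p = (m, n)" "q = (k, l)" by (cases p; cases q)
  have s2: "s \<ge> 2" and r: "length (flat r) = 2 * s - 4" using a by auto
  have "of_real (eta m * eta n) * star x (\<lambda>\<rho> \<sigma>. \<Phi> x (\<rho> # \<sigma> # k # l # flat r)) m n =
     of_real (eta k * eta l) * star x (\<lambda>\<rho> \<sigma>. \<Phi> x (\<rho> # \<sigma> # m # n # flat r)) k l"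
  proof (rule star_pair_symmetric[where T="\<lambda>m n p q. \<Phi> x (m # n # p # q # flat r)"])
    fix m n p q
    show "\<Phi> x (n # m # p # q # flat r) = - \<Phi> x (m # n # p # q # flat r)" using r s2 by (intro antisym x) simp
    show "\<Phi> x (m # n # p # q # flat r) = \<Phi> x (p # q # m # n # flat r)" by (rule pairsym[OF x s2 r])
    show "(\<Sum>\<alpha>\<in>UNIV. of_real (eta \<alpha>) * \<Phi> x (\<alpha> # n # \<alpha> # q # flat r)) = 0"
      using r s2 by (intro trace_pairs x) simp_all
    show "(\<Sum>\<alpha>\<in>UNIV. of_real (x$\<alpha>) * \<Phi> x (\<alpha> # n # p # q # flat r)) = 0"
      using r s2 by (intro tangent_Cons x) simp
  qed
  then show "dual \<Phi> x (flat (p # q # r)) = dual \<Phi> x (flat (q # p # r))"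
    by (simp only: p flat.simps dual_star) simp
qed

lemma dual_antisym: "dual \<Phi> x (n # m # r) = - dual \<Phi> x (m # n # r)"
  unfolding dual_star by (simp add: star_swap[of x _ n m] mult.commute)

lemma tangent_dual:
  assumes x: "x \<in> dS4" and ms: "length ms = 2 * s" "i < 2 * s"
  shows "(\<Sum>\<alpha>\<in>UNIV. of_real (x$\<alpha>) * dual \<Phi> x (ms[i := \<alpha>])) = 0"
proof -
  obtain m n r where mr: "ms = m # n # r" "length r = 2 * s - 2"
    using ms s1 by (cases ms; cases "tl ms") auto
  have 0: "(\<Sum>\<alpha>\<in>UNIV. of_real (x$\<alpha>) * dual \<Phi> x (\<alpha> # n # r)) = 0" for n
  proof -
    have "(\<Sum>\<alpha>\<in>UNIV. of_real (x$\<alpha>) * dual \<Phi> x (\<alpha> # n # r)) =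
       of_real (eta n / 2) * (\<Sum>\<alpha>\<in>UNIV. of_real (lower x \<alpha>) * star x (\<lambda>\<rho> \<sigma>. \<Phi> x (\<rho> # \<sigma> # r)) \<alpha> n)"
      unfolding dual_star lower_def by (simp add: sum_distrib_left mult_ac)
    then show ?thesis by (simp add: star_contract)
  qed
  consider "i = 0" | "i = 1" | j where "i = Suc (Suc j)" by (metis One_nat_def not0_implies_Suc)
  then show ?thesis
  proof cases
    case 1
    then show ?thesis using 0 mr by simp
  next
    case 2
    then show ?thesis using 0[of m] mr by (simp add: dual_antisym[of x m] sum_negf del: dual.simps)
  next
    case 3
    have "(\<Sum>\<alpha>\<in>UNIV. of_real (x$\<alpha>) * dual \<Phi> x (m # n # r[j := \<alpha>])) =
       of_real (eta m * eta n / 2) * (\<Sum>\<alpha>\<in>UNIV. of_real (x$\<alpha>) * star x (\<lambda>\<rho> \<sigma>. \<Phi> x (\<rho> # \<sigma> # r[j := \<alpha>])) m n)"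
      unfolding dual_star by (simp add: sum_distrib_left mult_ac)
    also have "\<dots> = 0"
    proof -
      have "(\<Sum>\<alpha>\<in>UNIV. of_real (x$\<alpha>) * \<Phi> x (\<rho> # \<sigma> # r[j := \<alpha>])) = 0" for \<rho> \<sigma>
        using tangent[OF x, of "\<rho> # \<sigma> # r" "Suc (Suc j)"] mr ms 3 s1 by simp
      then show ?thesis unfolding star_linear by (simp add: star_def lev3_def)
    qed
    finally show ?thesis using mr 3 by (simp del: dual.simps)
  qed
qed

text \<open>On the slices, star applied to the degree -1 extension of the field is sqrt (1 - c^2) times that of the dual field.
  The latter has a limit as c tends to -1, so the former tends to zero.\<close>

lemma wedge_field:
  assumes w: "on_S3 w" and r: "length r = 2 * s - 2"
  shows "of_real (lower (w - e0) a) * past_limit (\<lambda>x. \<Phi> x (b # c # r)) w + of_real (lower (w - e0) b) * past_limit (\<lambda>x. \<Phi> x (c # a # r)) w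
      + of_real (lower (w - e0) c) * past_limit (\<lambda>x. \<Phi> x (a # b # r)) w = 0"
proof (rule star_zero_imp_wedge_zero)
  have l: "length (m # n # r) = 2 * s" for m n using r s1 by simp
  fix m n
  show "past_limit (\<lambda>x. \<Phi> x (n # m # r)) w = - past_limit (\<lambda>x. \<Phi> x (m # n # r)) w"
    by (rule past_limit_uminus[OF wave_field[OF l] w antisym[OF _ r]])
  let ?G = "\<lambda>c. star (w + c *\<^sub>R e0) (\<lambda>\<rho> \<sigma>. hext 1 (\<lambda>x. \<Phi> x (\<rho> # \<sigma> # r)) (w + c *\<^sub>R e0)) m n"
  let ?R = "\<lambda>c. of_real (sqrt (1 - c\<^sup>2)) * (2 * of_real (eta m * eta n) * hext 1 (\<lambda>x. dual \<Phi> x (m # n # r)) (w + c *\<^sub>R e0))"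
  have "(?G \<longlongrightarrow> star (w - e0) (\<lambda>\<rho> \<sigma>. past_limit (\<lambda>x. \<Phi> x (\<rho> # \<sigma> # r)) w) m n) (at_right (-1))"
    unfolding star_def lev3_def lower_def of_real_mult
    by (intro tendsto_sum tendsto_mult tendsto_const tendsto_slice_coord wave_limits(1)[OF wave_field[OF l] w])
  moreover have "?G c = ?R c" if c: "\<bar>c\<bar> < 1" for c
  proof -
    define q where "q = sqrt (1 - c\<^sup>2)"
    define x where "x = inverse (sqrt (1 - c\<^sup>2)) *\<^sub>R (w + c *\<^sub>R e0)"
    note S = slice_scale[OF w c, folded x_def q_def]
    have "star (w + c *\<^sub>R e0) (\<lambda>\<rho> \<sigma>. hext 1 (\<lambda>x. \<Phi> x (\<rho> # \<sigma> # r)) (w + c *\<^sub>R e0)) m n = star x (\<lambda>\<rho> \<sigma>. \<Phi> x (\<rho> # \<sigma> # r)) m n"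
      unfolding S(3)[of "\<lambda>x. \<Phi> x (_ # _ # r)"] unfolding star_def S(2) by (simp add: lower_def mult_ac)
    also have "\<dots> = of_real q * (2 * of_real (eta m * eta n) * hext 1 (\<lambda>x. dual \<Phi> x (m # n # r)) (w + c *\<^sub>R e0))"
      unfolding star_dual S(3)[of "\<lambda>x. dual \<Phi> x (m # n # r)"] by (simp add: mult_ac)
    finally show ?thesis by (simp only: q_def)
  qed
  then have "\<forall>\<^sub>F c in at_right (-1). ?G c = ?R c" by (rule eventually_mono[OF eventually_slice_right])
  ultimately have 1: "(?R \<longlongrightarrow> star (w - e0) (\<lambda>\<rho> \<sigma>. past_limit (\<lambda>x. \<Phi> x (\<rho> # \<sigma> # r)) w) m n) (at_right (-1))"
    by (rule Lim_transform_eventually)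
  have "(?R \<longlongrightarrow> 0 * (2 * of_real (eta m * eta n) * past_limit (\<lambda>x. dual \<Phi> x (m # n # r)) w)) (at_right (-1))"
    by (intro tendsto_mult tendsto_const tendsto_sqrt_slice wave_limits(1)[OF wave_dual[OF l] w])
  from tendsto_unique[OF trivial_limit_at_right_real 1 this]
  show "star (w - e0) (\<lambda>\<rho> \<sigma>. past_limit (\<lambda>x. \<Phi> x (\<rho> # \<sigma> # r)) w) m n = 0" by simp
qed

text \<open>In \<open>star_wedge\<close> the coordinate and the degree -1 extension of the dual
  scale inversely, so the left side is the same at a slice point as on dS4. The field on the right
  side becomes sqrt (1 - c^2) times its convergent extension and tends to zero.\<close>

lemma wedge_dual:
  assumes w: "on_S3 w" and r: "length r = 2 * s - 2"
  shows "of_real (lower (w - e0) p) * past_limit (\<lambda>x. dual \<Phi> x (m # n # r)) w + of_real (lower (w - e0) m) * past_limit (\<lambda>x. dual \<Phi> x (n # p # r)) w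
      + of_real (lower (w - e0) n) * past_limit (\<lambda>x. dual \<Phi> x (p # m # r)) w = 0"
proof -
  have l: "length (m # n # r) = 2 * s" for m n using r s1 by simp
  let ?V = "\<lambda>m n. past_limit (\<lambda>x. dual \<Phi> x (m # n # r)) w"
  have anti: "?V n m = - ?V m n" for m n
    by (rule past_limit_uminus[OF wave_dual[OF l] w dual_antisym])
  let ?k = "\<lambda>i. complex_of_real ((w - e0)$i)"
  let ?h = "\<lambda>m n c. hext 1 (\<lambda>x. dual \<Phi> x (m # n # r)) (w + c *\<^sub>R e0)"
  let ?X = "\<lambda>i c. complex_of_real ((w + c *\<^sub>R e0)$i)"
  let ?L = "\<lambda>c. 2 * of_real (eta m * eta n) * (?X p c * ?h m n c) - 2 * of_real (eta p * eta n) * (?X m c * ?h p n c)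
     - 2 * of_real (eta m * eta p) * (?X n c * ?h m p c)"
  let ?S = "\<lambda>c. \<Sum>\<rho>\<in>UNIV. \<Sum>\<sigma>\<in>UNIV. of_real (levi m n \<rho> \<sigma> p) * hext 1 (\<lambda>x. \<Phi> x (\<rho> # \<sigma> # r)) (w + c *\<^sub>R e0)"
  have "(?L \<longlongrightarrow> 2 * of_real (eta m * eta n) * (?k p * ?V m n) - 2 * of_real (eta p * eta n) * (?k m * ?V p n)
     - 2 * of_real (eta m * eta p) * (?k n * ?V m p)) (at_right (-1))"
    by (intro tendsto_diff tendsto_mult tendsto_const tendsto_slice_coord wave_limits(1)[OF wave_dual[OF l] w])
  moreover have "(\<lambda>c. of_real (sqrt (1 - c\<^sup>2)) * ?S c) c = ?L c" if c: "\<bar>c\<bar> < 1" for c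
  proof -
    define q where "q = sqrt (1 - c\<^sup>2)"
    define x where "x = inverse (sqrt (1 - c\<^sup>2)) *\<^sub>R (w + c *\<^sub>R e0)"
    note S = slice_scale[OF w c, folded x_def q_def]
    have xx: "mink x x = 1" using S(1) by (simp add: dS4_def)
    have "of_real (x$p) * star x (\<lambda>\<rho> \<sigma>. \<Phi> x (\<rho> # \<sigma> # r)) m n = of_real (x$m) * star x (\<lambda>\<rho> \<sigma>. \<Phi> x (\<rho> # \<sigma> # r)) p n
       + of_real (x$n) * star x (\<lambda>\<rho> \<sigma>. \<Phi> x (\<rho> # \<sigma> # r)) m p
       + of_real (mink x x) * (\<Sum>\<rho>\<in>UNIV. \<Sum>\<sigma>\<in>UNIV. of_real (levi m n \<rho> \<sigma> p) * \<Phi> x (\<rho> # \<sigma> # r))"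
    proof (rule star_wedge)
      show "(\<Sum>\<alpha>\<in>UNIV. of_real (x$\<alpha>) * \<Phi> x (\<alpha> # \<sigma> # r)) = 0" for \<sigma>
        using r s1 by (intro tangent_Cons S(1)) simp
      show "\<Phi> x (n # m # r) = - \<Phi> x (m # n # r)" for m n by (rule antisym[OF S(1) r])
    qed
    then have E: "2 * of_real (eta m * eta n) * (of_real (x$p) * dual \<Phi> x (m # n # r)) - 2 * of_real (eta p * eta n) * (of_real (x$m) * dual \<Phi> x (p # n # r))
      - 2 * of_real (eta m * eta p) * (of_real (x$n) * dual \<Phi> x (m # p # r)) = (\<Sum>\<rho>\<in>UNIV. \<Sum>\<sigma>\<in>UNIV. of_real (levi m n \<rho> \<sigma> p) * \<Phi> x (\<rho> # \<sigma> # r))"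
      unfolding star_dual xx by (simp add: algebra_simps del: dual.simps)
    have X: "?X i c * ?h a b c = of_real (x$i) * dual \<Phi> x (a # b # r)" for i a b
      unfolding S(3)[of "\<lambda>x. dual \<Phi> x (a # b # r)"] unfolding S(2) by (simp add: mult_ac del: dual.simps)
    have "?L c = (\<Sum>\<rho>\<in>UNIV. \<Sum>\<sigma>\<in>UNIV. of_real (levi m n \<rho> \<sigma> p) * \<Phi> x (\<rho> # \<sigma> # r))"
      unfolding X E ..
    also have "\<dots> = of_real q * ?S c"
      unfolding S(3)[of "\<lambda>x. \<Phi> x (_ # _ # r)"] by (simp add: sum_distrib_left mult_ac)
    finally show ?thesis by (simp only: q_def)
  qed
  then have "\<forall>\<^sub>F c in at_right (-1). ?L c = of_real (sqrt (1 - c\<^sup>2)) * ?S c"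
    by (intro eventually_mono[OF eventually_slice_right]) (rule sym)
  ultimately have 1: "((\<lambda>c. of_real (sqrt (1 - c\<^sup>2)) * ?S c) \<longlongrightarrow> 2 * of_real (eta m * eta n) * (?k p * ?V m n) - 2 * of_real (eta p * eta n) * (?k m * ?V p n)
     - 2 * of_real (eta m * eta p) * (?k n * ?V m p)) (at_right (-1))"
    by (rule Lim_transform_eventually)
  have "((\<lambda>c. of_real (sqrt (1 - c\<^sup>2)) * ?S c) \<longlongrightarrow> 0 * (\<Sum>\<rho>\<in>UNIV. \<Sum>\<sigma>\<in>UNIV. of_real (levi m n \<rho> \<sigma> p) * past_limit (\<lambda>x. \<Phi> x (\<rho> # \<sigma> # r)) w)) (at_right (-1))"
    by (intro tendsto_mult tendsto_sum tendsto_const tendsto_sqrt_slice wave_limits(1)[OF wave_field[OF l] w])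
  from tendsto_unique[OF trivial_limit_at_right_real 1 this]
  \<comment> \<open>The factor in front lowers the three indices and removes the 2, to match the
    form of the wedge condition.\<close>
  have Z: "of_real (eta m * eta n * eta p / 2) * (2 * of_real (eta m * eta n) * (?k p * ?V m n) - 2 * of_real (eta p * eta n) * (?k m * ?V p n)
     - 2 * of_real (eta m * eta p) * (?k n * ?V m p)) = 0" by simp
  define K where "K i = complex_of_real ((w - e0)$i)" for i
  have lK: "complex_of_real (lower (w - e0) i) = of_real (eta i) * K i" for i
    by (simp only: lower_def K_def of_real_mult)
  have "of_real (lower (w - e0) p) * ?V m n + of_real (lower (w - e0) m) * ?V n p + of_real (lower (w - e0) n) * ?V p m =
    of_real (eta m * eta n * eta p / 2) * (2 * of_real (eta m * eta n) * (?k p * ?V m n) - 2 * of_real (eta p * eta n) * (?k m * ?V p n)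
     - 2 * of_real (eta m * eta p) * (?k n * ?V m p))"
    unfolding K_def[symmetric] lK
    by (simp add: right_diff_distrib distrib_left mult_ac eta_sq_complex anti[of p n] anti[of m p] del: dual.simps)
  then show ?thesis unfolding Z .
qed

lemma asymptotic_field: "asymptotic_tensor s \<Phi>"
  by unfold_locales (fact s1 wave_field tangent antisym perm_field wedge_field)+

lemma asymptotic_dual: "asymptotic_tensor s (dual \<Phi>)"
  by unfold_locales (fact s1 wave_dual tangent_dual perm_dual wedge_dual | rule dual_antisym)+

end

section \<open>Antipodal parity of solutions\<close>

lemma field_strength_at_cong:
  assumes eq: "\<And>ms. length ms = 2 * s \<Longrightarrow> T ms = T' ms" and T: "field_strength_at s x T"
  shows "field_strength_at s x T'"
proof -
  have [simp]: "T' ms = T ms" if "length ms = 2 * s" for ms using eq[OF that] by simp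
  show ?thesis using T unfolding field_strength_at_def lists_len_def alt3_def Let_def swap_pos_def by simp
qed

lemma field_strength_at_combination:
  assumes T: "field_strength_at s x T" and T': "field_strength_at s x T'"
  shows "field_strength_at s x (\<lambda>ms. a * T ms + b * T' ms)"
proof -
  have lin: "(\<Sum>\<alpha>\<in>UNIV. c \<alpha> * (a * f \<alpha> + b * g \<alpha>)) = a * (\<Sum>\<alpha>\<in>UNIV. c \<alpha> * f \<alpha>) + b * (\<Sum>\<alpha>\<in>UNIV. c \<alpha> * g \<alpha>)"
    for c f g :: "5 \<Rightarrow> complex"
    by (simp add: sum.distrib sum_distrib_left algebra_simps)
  have alt: "alt3 (\<lambda>ms. a * T ms + b * T' ms) i j k ms = a * alt3 T i j k ms + b * alt3 T' i j k ms" for i j k ms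
    by (simp add: alt3_def Let_def algebra_simps)
  show ?thesis
    using T T' unfolding field_strength_at_def lin alt by (elim conjE) (intro conjI; simp)
qed

lemma field_strength_at_uminus: "field_strength_at s (- x) T \<Longrightarrow> field_strength_at s x T"
  by (simp add: field_strength_at_def sum_negf)

lemma Ck_subset: "Ck k U f \<Longrightarrow> V \<subseteq> U \<Longrightarrow> Ck k V f"
  by (induction k arbitrary: f) (auto intro: continuous_on_subset)

lemma frechet_derivative_reflect:
  assumes "f differentiable (at (- x))"
  shows "((\<lambda>x. f (- x)) has_derivative (\<lambda>v. - frechet_derivative f (at (- x)) v)) (at x)"
proof -
  have "(f has_derivative frechet_derivative f (at (- x))) (at (- x))"
    using assms by (simp add: frechet_derivative_works)
  from has_derivative_compose[OF has_derivative_minus[OF has_derivative_ident] this]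
  show ?thesis using linear_frechet_derivative[OF assms] by (simp add: linear_neg)
qed

lemma Ck_reflect:
  assumes "open U" shows "Ck k U f \<Longrightarrow> Ck k (uminus ` U) (\<lambda>x. f (- x))"
proof (induction k arbitrary: f)
  case 0
  have "continuous_on U f" using 0 by simp
  then show ?case
    by (auto intro!: continuous_on_compose2[of U f] continuous_intros)
next
  case (Suc k)
  have oU: "open (uminus ` U)" using assms by (rule open_negations)
  have d: "((\<lambda>x. f (- x)) has_derivative (\<lambda>v. - frechet_derivative f (at (- x)) v)) (at x)" if "x \<in> uminus ` U" for x
    by (rule frechet_derivative_reflect) (use Suc.prems that in auto)
  have "Ck k (uminus ` U) (\<lambda>x. (-1) * frechet_derivative f (at (- x)) v)" for v
    using Suc.prems by (intro Ck_cmult oU Suc.IH[of "\<lambda>x. frechet_derivative f (at x) v"]) simp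
  then have "Ck k (uminus ` U) (\<lambda>x. frechet_derivative (\<lambda>x. f (- x)) (at x) v)" for v
    by (rule Ck_cong[OF oU, rotated]) (use frechet_derivative_at[OF d] in \<open>auto dest: fun_cong\<close>)
  then show ?case using d by (auto simp: differentiable_def)
qed

lemma smooth_on_reflect: "open U \<Longrightarrow> smooth_on U f \<Longrightarrow> smooth_on (uminus ` U) (\<lambda>x. f (- x))"
  by (simp add: smooth_on_def Ck_reflect)

lemma smooth_on_subset: "smooth_on U f \<Longrightarrow> V \<subseteq> U \<Longrightarrow> smooth_on V f"
  by (auto simp: smooth_on_def intro: Ck_subset)

lemma dS4_uminus: "x \<in> dS4 \<Longrightarrow> - x \<in> dS4"
  by (simp add: dS4_def mink_linear)

lemma proj_tensor_cong:
  "(\<And>\<beta>s. length \<beta>s = length ms \<Longrightarrow> T \<beta>s = T' \<beta>s) \<Longrightarrow> proj_tensor x T ms = proj_tensor x T' ms"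
  unfolding proj_tensor_def by (rule sum.cong) (auto simp: lists_len_def)

text \<open>The projector is even in x; the sign of the second term comes from the inner derivative
  of the reflection.\<close>

lemma nabla_combination:
  assumes d: "\<And>ms y. length ms = n \<Longrightarrow> y \<in> dS4 \<Longrightarrow> (\<lambda>y. \<Phi> y ms) differentiable (at y)"
    and x: "x \<in> dS4" and ms: "length ms = Suc n"
  shows "nabla (\<lambda>y ms. a * \<Phi> y ms + b * \<Phi> (- y) ms) x ms = a * nabla \<Phi> x ms + (- b) * nabla \<Phi> (- x) ms"
proof -
  have Proj: "Proj (- x) = Proj x" by (auto simp: Proj_def lower_def fun_eq_iff)
  have "Dtensor (\<lambda>y ms. a * \<Phi> y ms + b * \<Phi> (- y) ms) x \<beta>s = a * Dtensor \<Phi> x \<beta>s + (- b) * Dtensor \<Phi> (- x) \<beta>s"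
    if l: "length \<beta>s = length ms" for \<beta>s
  proof -
    obtain \<alpha> \<gamma>s where b: "\<beta>s = \<alpha> # \<gamma>s" "length \<gamma>s = n" using l ms by (cases \<beta>s) auto
    have d1: "(\<lambda>y. \<Phi> y \<gamma>s) differentiable (at x)" and d2: "(\<lambda>y. \<Phi> y \<gamma>s) differentiable (at (- x))"
      using d[OF b(2)] x dS4_uminus by auto
    have "((\<lambda>y. a * \<Phi> y \<gamma>s + b * \<Phi> (- y) \<gamma>s) has_derivative
       (\<lambda>v. a * frechet_derivative (\<lambda>y. \<Phi> y \<gamma>s) (at x) v + b * (- frechet_derivative (\<lambda>y. \<Phi> y \<gamma>s) (at (- x)) v))) (at x)"
      using d1 d2 by (intro has_derivative_add has_derivative_mult_right frechet_derivative_reflect[of "\<lambda>y. \<Phi> y \<gamma>s"])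
        (simp_all add: frechet_derivative_works)
    from pd_eqI[OF this] show ?thesis by (simp add: b pd_def)
  qed
  then have "nabla (\<lambda>y ms. a * \<Phi> y ms + b * \<Phi> (- y) ms) x ms = proj_tensor x (\<lambda>\<beta>s. a * Dtensor \<Phi> x \<beta>s + (- b) * Dtensor \<Phi> (- x) \<beta>s) ms"
    unfolding nabla_def by (rule proj_tensor_cong)
  also have "\<dots> = a * nabla \<Phi> x ms + (- b) * nabla \<Phi> (- x) ms"
    unfolding nabla_def proj_tensor_def Proj distrib_left sum.distrib sum_distrib_left by (simp only: mult_ac)
  finally show ?thesis .
qed

text \<open>The equations are linear and homogeneous, so the sign from
  \<open>nabla_combination\<close> does no harm. General coefficients serve the even and the odd
  part at once.\<close>

lemma solution_combination:
  assumes s1: "s \<ge> 1" and "solution s \<phi>"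
  shows "solution s (\<lambda>x ms. a * \<phi> x ms + b * \<phi> (- x) ms)"
proof -
  obtain U \<Phi> where U: "open U" "dS4 \<subseteq> U" and sm': "\<forall>ms\<in>lists_len (2 * s). smooth_on U (\<lambda>y. \<Phi> y ms)"
    and ext': "\<forall>x\<in>dS4. \<forall>ms\<in>lists_len (2 * s). \<Phi> x ms = \<phi> x ms" and eqs: "field_eqs s \<Phi>"
    using assms(2) unfolding solution_def by (elim conjE exE) (rule that)
  have sm: "smooth_on U (\<lambda>y. \<Phi> y ms)" if "length ms = 2 * s" for ms using sm' that by (simp add: lists_len_def)
  have ext: "\<Phi> x ms = \<phi> x ms" if "x \<in> dS4" "length ms = 2 * s" for x ms using ext' that by (simp add: lists_len_def)
  have fs: "field_strength_at s x (\<phi> x)" if "x \<in> dS4" for x using assms(2) that by (simp add: solution_def)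
  \<comment> \<open>The neighbourhood must be symmetric under reflection for the reflected extension
    to be smooth on it as well.\<close>
  let ?V = "U \<inter> uminus ` U"
  let ?\<Psi> = "\<lambda>y ms. a * \<Phi> y ms + b * \<Phi> (- y) ms"
  have oU': "open (uminus ` U)" by (rule open_negations[OF U(1)])
  have oV: "open ?V" by (rule open_Int[OF U(1) oU'])
  have dV: "dS4 \<subseteq> ?V"
  proof
    fix x assume x: "x \<in> dS4"
    then have "- (- x) \<in> uminus ` U" using U(2) dS4_uminus by blast
    then show "x \<in> ?V" using x U(2) by auto
  qed
  have smV: "smooth_on ?V (\<lambda>y. ?\<Psi> y ms)" if "length ms = 2 * s" for ms
  proof -
    have "smooth_on ?V (\<lambda>y. \<Phi> y ms)" by (rule smooth_on_subset[OF sm[OF that]]) simp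
    moreover have "smooth_on ?V (\<lambda>y. \<Phi> (- y) ms)"
      by (rule smooth_on_subset[OF smooth_on_reflect[OF U(1) sm[OF that]]]) simp
    ultimately show ?thesis by (intro smooth_on_add smooth_on_cmult oV)
  qed
  have dif: "(\<lambda>y. \<Phi> y ms) differentiable (at y)" if "length ms = 2 * s" "y \<in> dS4" for ms y
    by (rule smooth_on_differentiable[OF sm[OF that(1)]]) (use U(2) that(2) in blast)
  have nab: "nabla ?\<Psi> x ms = a * nabla \<Phi> x ms + (- b) * nabla \<Phi> (- x) ms" if "x \<in> dS4" "length ms = Suc (2 * s)" for x ms
    by (rule nabla_combination[OF dif that])
  have lin: "(\<Sum>\<alpha>\<in>UNIV. c \<alpha> * (a * f \<alpha> + d * g \<alpha>)) = a * (\<Sum>\<alpha>\<in>UNIV. c \<alpha> * f \<alpha>) + d * (\<Sum>\<alpha>\<in>UNIV. c \<alpha> * g \<alpha>)"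
    for c f g :: "5 \<Rightarrow> complex" and d
    by (simp add: sum.distrib sum_distrib_left algebra_simps)
  have "field_eqs s ?\<Psi>"
  proof (cases "s = 1")
    case True
    have 1: "(\<Sum>\<mu>\<in>UNIV. of_real (eta \<mu>) * nabla ?\<Psi> x [\<mu>, \<mu>, \<nu>]) = 0" if x: "x \<in> dS4" for x \<nu>
    proof -
      have "(\<Sum>\<mu>\<in>UNIV. of_real (eta \<mu>) * nabla ?\<Psi> x [\<mu>, \<mu>, \<nu>]) = (\<Sum>\<mu>\<in>UNIV. of_real (eta \<mu>) * (a * nabla \<Phi> x [\<mu>, \<mu>, \<nu>] + (- b) * nabla \<Phi> (- x) [\<mu>, \<mu>, \<nu>]))"
        by (intro sum.cong refl arg_cong2[where f="(*)"] nab x) (simp add: True)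
      then show ?thesis unfolding lin using eqs x dS4_uminus[OF x] True by (simp add: field_eqs_def)
    qed
    have 2: "alt3 (nabla ?\<Psi> x) 0 1 2 ms = 0" if x: "x \<in> dS4" and ms: "length ms = 3" for x ms
    proof -
      have z: "alt3 (nabla \<Phi> x) 0 1 2 ms = 0" "alt3 (nabla \<Phi> (- x)) 0 1 2 ms = 0"
        using eqs x dS4_uminus[OF x] True ms by (auto simp: field_eqs_def lists_len_def)
      have "alt3 (nabla ?\<Psi> x) 0 1 2 ms = a * alt3 (nabla \<Phi> x) 0 1 2 ms + (- b) * alt3 (nabla \<Phi> (- x)) 0 1 2 ms"
      proof -
        have n: "nabla ?\<Psi> x (ms[i := u, j := v, k := w]) = a * nabla \<Phi> x (ms[i := u, j := v, k := w]) + (- b) * nabla \<Phi> (- x) (ms[i := u, j := v, k := w])" for i j k u v w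
          by (rule nab[OF x]) (simp add: ms True)
        show ?thesis unfolding alt3_def Let_def n by (simp only: algebra_simps)
      qed
      then show ?thesis by (simp only: z) simp
    qed
    show ?thesis using 1 2 True by (simp add: field_eqs_def lists_len_def)
  next
    case False
    have "(\<Sum>\<mu>\<in>UNIV. of_real (eta \<mu>) * nabla ?\<Psi> x (\<mu> # \<mu> # r)) = 0" if x: "x \<in> dS4" and r: "length r = 2 * s - 1" for x r
    proof -
      have "(\<Sum>\<mu>\<in>UNIV. of_real (eta \<mu>) * nabla ?\<Psi> x (\<mu> # \<mu> # r)) = (\<Sum>\<mu>\<in>UNIV. of_real (eta \<mu>) * (a * nabla \<Phi> x (\<mu> # \<mu> # r) + (- b) * nabla \<Phi> (- x) (\<mu> # \<mu> # r)))"
        using r s1 by (intro sum.cong refl arg_cong2[where f="(*)"] nab x) simp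
      then show ?thesis unfolding lin using eqs x dS4_uminus[OF x] False r by (simp add: field_eqs_def lists_len_def)
    qed
    then show ?thesis using False by (simp add: field_eqs_def lists_len_def)
  qed
  note eqs' = this
  have fs': "\<forall>x\<in>dS4. field_strength_at s x (\<lambda>ms. a * \<phi> x ms + b * \<phi> (- x) ms)"
    by (intro ballI, rule field_strength_at_combination[OF fs field_strength_at_uminus[OF fs[OF dS4_uminus]]])
  have smV': "\<forall>ms\<in>lists_len (2 * s). smooth_on ?V (\<lambda>y. ?\<Psi> y ms)"
    using smV by (simp add: lists_len_def)
  have extV: "\<forall>x\<in>dS4. \<forall>ms\<in>lists_len (2 * s). ?\<Psi> x ms = a * \<phi> x ms + b * \<phi> (- x) ms"
  proof (intro ballI)
    fix x and ms :: "5 list" assume "x \<in> dS4" "ms \<in> lists_len (2 * s)"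
    then show "?\<Psi> x ms = a * \<phi> x ms + b * \<phi> (- x) ms"
      using ext[of x ms] ext[of "- x" ms] dS4_uminus[of x] by (simp add: lists_len_def)
  qed
  show ?thesis
    unfolding solution_def
  proof (rule conjI[OF fs'], rule exI[of _ ?V], rule exI[of _ ?\<Psi>], intro conjI)
    show "open ?V" by (rule oV)
    show "dS4 \<subseteq> ?V" by (rule dV)
    show "\<forall>ms\<in>lists_len (2 * s). smooth_on ?V (\<lambda>y. ?\<Psi> y ms)" by (rule smV')
    show "\<forall>x\<in>dS4. \<forall>ms\<in>lists_len (2 * s). ?\<Psi> x ms = a * \<phi> x ms + b * \<phi> (- x) ms" by (rule extV)
    show "field_eqs s ?\<Psi>" by (rule eqs')
  qed
qed

text \<open>Pulling the contraction with the first normal out of the dual is only a reordering of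
  sums; it turns magnetic statements into electric ones for the dual.\<close>

lemma Bfield_eq_Efield_dual:
  assumes "length ms = s" "s \<ge> 1"
  shows "Bfield s T x ms = Efield s (dual T) x ms"
proof -
  obtain m ms' n where m: "ms = m # ms'" and n: "s = Suc n" using assms by (cases ms; cases s) auto
  have "Efield s (dual T) x ms = (\<Sum>\<nu>\<in>UNIV. \<Sum>\<nu>s\<in>lists_len n. of_real (nvec x \<nu> * (\<Prod>k<n. nvec x (\<nu>s!k))) *
      ((1/2) * (\<Sum>\<rho>\<in>UNIV. \<Sum>\<sigma>\<in>UNIV. of_real (eps_mix x m \<nu> \<rho> \<sigma>) * T x (\<rho> # \<sigma> # interleave ms' \<nu>s))))"
    unfolding Efield_def n m by (simp add: sum_lists_len_Suc prod.lessThan_Suc_shift del: prod.lessThan_Suc)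
  also have "\<dots> = (\<Sum>\<nu>\<in>UNIV. \<Sum>\<nu>s\<in>lists_len n. \<Sum>\<rho>\<in>UNIV. \<Sum>\<sigma>\<in>UNIV. (1/2) *
      (of_real (eps_mix x m \<nu> \<rho> \<sigma> * nvec x \<nu> * (\<Prod>k<n. nvec x (\<nu>s!k))) * T x (\<rho> # \<sigma> # interleave ms' \<nu>s)))"
    by (simp add: sum_distrib_left mult_ac)
  also have "\<dots> = (\<Sum>\<nu>\<in>UNIV. \<Sum>\<rho>\<in>UNIV. \<Sum>\<sigma>\<in>UNIV. \<Sum>\<nu>s\<in>lists_len n. (1/2) *
      (of_real (eps_mix x m \<nu> \<rho> \<sigma> * nvec x \<nu> * (\<Prod>k<n. nvec x (\<nu>s!k))) * T x (\<rho> # \<sigma> # interleave ms' \<nu>s)))"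
    by (rule sum.cong[OF refl], subst sum.swap, rule sum.cong[OF refl], rule sum.swap)
  also have "\<dots> = Bfield s T x ms"
    unfolding Bfield_def n m by (simp add: sum_distrib_left)
  finally show ?thesis by simp
qed

lemma comp_over_z_cong:
  assumes "\<And>ms. length ms = s \<Longrightarrow> F (gpt z w) ms = G (gpt z w) ms"
  shows "comp_over_z s F w us z = comp_over_z s G w us z"
  unfolding comp_over_z_def using assms by (intro arg_cong2[where f="(/)"] sum.cong refl) (simp add: lists_len_def)

lemma eps_mix_uminus: "eps_mix (- x) m n \<rho> \<sigma> = - eps_mix x m n \<rho> \<sigma>"
  by (simp add: eps_mix_def lower_def sum_negf)

lemma star_uminus: "star (- x) F m n = - star x F m n"
  by (simp add: star_def lev3_def lower_def sum_negf)

section \<open>Parity of the field and of its dual\<close>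

context spin_field
begin

text \<open>The tensor epsilon is odd in x, so evenness of the dual makes the star of F, the sum of
  the fields at x and - x, vanish. Then x wedge F = 0, and contraction with x gives F = 0 because F
  is tangent.\<close>

lemma odd_of_dual_even:
  assumes even: "\<And>x ms. x \<in> dS4 \<Longrightarrow> length ms = 2 * s \<Longrightarrow> dual \<Phi> (- x) ms = dual \<Phi> x ms"
    and x: "x \<in> dS4" and ms: "length ms = 2 * s"
  shows "\<Phi> (- x) ms = - \<Phi> x ms"
proof -
  obtain b c r where mr: "ms = b # c # r" "length r = 2 * s - 2"
    using ms s1 by (cases ms; cases "tl ms") auto
  have l: "length (m # n # r) = 2 * s" for m n using mr s1 by simp
  have mx: "- x \<in> dS4" by (rule dS4_uminus[OF x])
  define F where "F m n = \<Phi> x (m # n # r) + \<Phi> (- x) (m # n # r)" for m n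
  have anti: "F n m = - F m n" for m n
    using antisym[OF x mr(2), of n m] antisym[OF mx mr(2), of n m] by (simp add: F_def)
  have st: "star x F m n = 0" for m n
  proof -
    have "star x (\<lambda>\<rho> \<sigma>. \<Phi> x (\<rho> # \<sigma> # r)) m n = - star x (\<lambda>\<rho> \<sigma>. \<Phi> (- x) (\<rho> # \<sigma> # r)) m n"
      using even[OF x l, of m n] star_dual[of x \<Phi> r m n] star_dual[of "- x" \<Phi> r m n] by (simp add: star_uminus del: dual.simps)
    moreover have "star x F m n = star x (\<lambda>\<rho> \<sigma>. \<Phi> x (\<rho> # \<sigma> # r)) m n + star x (\<lambda>\<rho> \<sigma>. \<Phi> (- x) (\<rho> # \<sigma> # r)) m n"
      by (simp add: F_def star_def lev3_def distrib_left sum.distrib)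
    ultimately show ?thesis by simp
  qed
  have tan: "(\<Sum>\<alpha>\<in>UNIV. of_real (x$\<alpha>) * F \<alpha> n) = 0" for n
  proof -
    have lr: "length (n # r) = 2 * s - 1" using mr s1 by simp
    have "(\<Sum>\<alpha>\<in>UNIV. of_real (x$\<alpha>) * F \<alpha> n) = (\<Sum>\<alpha>\<in>UNIV. of_real (x$\<alpha>) * \<Phi> x (\<alpha> # n # r)) - (\<Sum>\<alpha>\<in>UNIV. of_real ((- x)$\<alpha>) * \<Phi> (- x) (\<alpha> # n # r))"
      by (simp add: F_def distrib_left sum.distrib sum_negf)
    then show ?thesis using tangent_Cons[OF x lr] tangent_Cons[OF mx lr] by simp
  qed
  have xx: "(\<Sum>\<alpha>\<in>UNIV. complex_of_real (x$\<alpha>) * of_real (lower x \<alpha>)) = 1"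
  proof -
    have "(\<Sum>\<alpha>\<in>UNIV. x$\<alpha> * lower x \<alpha>) = 1" using x by (simp add: lower_sum dS4_def)
    then show ?thesis by (simp flip: of_real_mult of_real_sum)
  qed
  have "0 = (\<Sum>\<alpha>\<in>UNIV. of_real (x$\<alpha>) * (of_real (lower x \<alpha>) * F b c + of_real (lower x b) * F c \<alpha> + of_real (lower x c) * F \<alpha> b))"
    using star_zero_imp_wedge_zero[OF st anti, of _ b c] by simp
  also have "\<dots> = (\<Sum>\<alpha>\<in>UNIV. of_real (x$\<alpha>) * of_real (lower x \<alpha>)) * F b c - of_real (lower x b) * (\<Sum>\<alpha>\<in>UNIV. of_real (x$\<alpha>) * F \<alpha> c)
     + of_real (lower x c) * (\<Sum>\<alpha>\<in>UNIV. of_real (x$\<alpha>) * F \<alpha> b)"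
    by (simp add: anti[of c] distrib_left right_diff_distrib sum.distrib sum_subtractf sum_distrib_left sum_distrib_right mult_ac)
  finally have "F b c = 0" by (simp add: xx tan)
  then show ?thesis by (simp add: F_def mr add_eq_0_iff)
qed

text \<open>The sign of the field and the sign of the odd factor \<open>eps_mix\<close> compensate
  each other.\<close>

lemma dual_even_of_odd:
  assumes odd: "\<And>x ms. x \<in> dS4 \<Longrightarrow> length ms = 2 * s \<Longrightarrow> \<Phi> (- x) ms = - \<Phi> x ms"
    and x: "x \<in> dS4" and ms: "length ms = 2 * s"
  shows "dual \<Phi> (- x) ms = dual \<Phi> x ms"
proof -
  obtain m n r where mr: "ms = m # n # r" "length r = 2 * s - 2"
    using ms s1 by (cases ms; cases "tl ms") auto
  have "\<Phi> (- x) (\<rho> # \<sigma> # r) = - \<Phi> x (\<rho> # \<sigma> # r)" for \<rho> \<sigma> using odd[OF x] mr s1 by simp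
  then show ?thesis by (simp add: mr eps_mix_uminus)
qed

end

section \<open>Boundary data of solutions\<close>

lemma solution_imp_spin_field:
  assumes "s \<ge> 1" "solution s \<phi>"
  obtains U \<Phi> where "spin_field s U \<Phi>" "\<And>x ms. x \<in> dS4 \<Longrightarrow> length ms = 2 * s \<Longrightarrow> \<Phi> x ms = \<phi> x ms"
proof -
  obtain U \<Phi> where U: "open U" "dS4 \<subseteq> U" and sm': "\<forall>ms\<in>lists_len (2 * s). smooth_on U (\<lambda>y. \<Phi> y ms)"
    and ext': "\<forall>x\<in>dS4. \<forall>ms\<in>lists_len (2 * s). \<Phi> x ms = \<phi> x ms" and eqs: "field_eqs s \<Phi>"
    using assms(2) unfolding solution_def by (elim conjE exE) (rule that)
  have sm: "smooth_on U (\<lambda>y. \<Phi> y ms)" if "length ms = 2 * s" for ms using sm' that by (simp add: lists_len_def)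
  have ext: "\<Phi> x ms = \<phi> x ms" if "x \<in> dS4" "length ms = 2 * s" for x ms using ext' that by (simp add: lists_len_def)
  have fs: "field_strength_at s x (\<Phi> x)" if "x \<in> dS4" for x
    by (rule field_strength_at_cong[of s "\<phi> x"]) (use ext assms(2) that in \<open>auto simp: solution_def\<close>)
  have "spin_field s U \<Phi>" by unfold_locales (fact assms(1) U sm fs eqs)+
  then show thesis using that ext by blast
qed

lemma tendsto_cong_nonzero:
  fixes f g :: "real \<Rightarrow> complex"
  assumes "\<And>z. z \<noteq> 0 \<Longrightarrow> f z = g z"
  shows "(f \<longlongrightarrow> L) (at 0 within S) = (g \<longlongrightarrow> L) (at 0 within S)"
  by (rule tendsto_cong) (simp add: eventually_at_filter assms)

lemma Efield_cong:
  assumes "\<And>ms'. length ms' = 2 * s \<Longrightarrow> T x ms' = T' x ms'" "length ms = s"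
  shows "Efield s T x ms = Efield s T' x ms"
  unfolding Efield_def
  by (intro sum.cong refl arg_cong2[where f="(*)"] assms(1)) (simp add: assms(2) lists_len_def length_interleave)

lemma dual_cong:
  assumes "\<And>ms. length ms = 2 * s \<Longrightarrow> T x ms = T' x ms" "length ms = 2 * s" "s \<ge> 1"
  shows "dual T x ms = dual T' x ms"
proof -
  obtain m n r where "ms = m # n # r" "length r = 2 * s - 2"
    using assms(2,3) by (cases ms; cases "tl ms") auto
  then show ?thesis using assms(1,3) by simp
qed

text \<open>\<open>Lim\<close> is a chosen value that describes a limit only where one exists;
  existence is therefore part of the argument.\<close>

lemma tendsto_zero_of_Lim_zero:
  fixes f :: "real \<Rightarrow> complex"
  assumes "(f \<longlongrightarrow> L) (at_left 0)" "Lim (at_left 0) f = 0"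
  shows "(f \<longlongrightarrow> 0) (at_left 0)"
  using assms tendsto_Lim[OF trivial_limit_at_left_real assms(1)] by simp

theorem theorem2:
  fixes s :: nat and \<phi> :: "real^5 \<Rightarrow> 5 list \<Rightarrow> complex"
  assumes "s \<ge> 1" and "solution s \<phi>"
  shows
   "(\<forall>\<omega> us. bdry_args s \<omega> us \<longrightarrow>
       (\<exists>L. (comp_over_z s (Efield s \<phi>) \<omega> us \<longlongrightarrow> L) (at_right 0)) \<and>
       (\<exists>L. (comp_over_z s (Efield s \<phi>) \<omega> us \<longlongrightarrow> L) (at_left 0)) \<and>
       (\<exists>L. (comp_over_z s (Bfield s \<phi>) \<omega> us \<longlongrightarrow> L) (at_right 0)) \<and>
       (\<exists>L. (comp_over_z s (Bfield s \<phi>) \<omega> us \<longlongrightarrow> L) (at_left 0)))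
    \<and> (\<exists>\<phi>e \<phi>o. solution s \<phi>e \<and> solution s \<phi>o \<and> antip_even (2 * s) \<phi>e \<and> antip_odd (2 * s) \<phi>o \<and>
         (\<forall>x\<in>dS4. \<forall>\<mu>s\<in>lists_len (2 * s). \<phi> x \<mu>s = \<phi>e x \<mu>s + \<phi>o x \<mu>s))
    \<and> (\<forall>\<psi>. solution s \<psi> \<and> antip_even (2 * s) \<psi> \<and> antip_odd (2 * s) \<psi> \<longrightarrow>
         (\<forall>x\<in>dS4. \<forall>\<mu>s\<in>lists_len (2 * s). \<psi> x \<mu>s = 0))
    \<and> (antip_even (2 * s) \<phi> \<longrightarrow>
         (\<forall>\<omega> us. bdry_args s \<omega> us \<longrightarrow> bdryE_plus s \<phi> \<omega> us = 0 \<and> bdryE_minus s \<phi> \<omega> us = 0))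
    \<and> (antip_odd (2 * s) \<phi> \<longrightarrow>
         (\<forall>\<omega> us. bdry_args s \<omega> us \<longrightarrow> bdryB_plus s \<phi> \<omega> us = 0 \<and> bdryB_minus s \<phi> \<omega> us = 0))
    \<and> ((\<forall>\<omega> us. bdry_args s \<omega> us \<longrightarrow> bdryE_minus s \<phi> \<omega> us = 0) \<longrightarrow> antip_even (2 * s) \<phi>)
    \<and> ((\<forall>\<omega> us. bdry_args s \<omega> us \<longrightarrow> bdryB_minus s \<phi> \<omega> us = 0) \<longrightarrow> antip_odd (2 * s) \<phi>)"
proof -
  obtain U \<Phi> where sf: "spin_field s U \<Phi>"
    and ext: "\<And>x ms. x \<in> dS4 \<Longrightarrow> length ms = 2 * s \<Longrightarrow> \<Phi> x ms = \<phi> x ms"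
    using solution_imp_spin_field[OF assms] by blast
  interpret spin_field s U \<Phi> by (rule sf)
  interpret E: asymptotic_tensor s \<Phi> by (rule asymptotic_field)
  interpret B: asymptotic_tensor s "dual \<Phi>" by (rule asymptotic_dual)
  have compE: "comp_over_z s (Efield s \<phi>) \<omega> us z = comp_over_z s (Efield s \<Phi>) \<omega> us z"
    if "on_S3 \<omega>" "z \<noteq> 0" for \<omega> us z
    by (intro comp_over_z_cong Efield_cong ext[symmetric] gpt_slice that)
  have compB: "comp_over_z s (Bfield s \<phi>) \<omega> us z = comp_over_z s (Efield s (dual \<Phi>)) \<omega> us z"
    if "on_S3 \<omega>" "z \<noteq> 0" for \<omega> us z
  proof (rule comp_over_z_cong)
    fix ms :: "5 list" assume l: "length ms = s"
    show "Bfield s \<phi> (gpt z \<omega>) ms = Efield s (dual \<Phi>) (gpt z \<omega>) ms"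
      unfolding Bfield_eq_Efield_dual[OF l assms(1)]
      by (intro Efield_cong dual_cong[of s] ext[symmetric] gpt_slice that l assms(1))
  qed
  have limE: "(comp_over_z s (Efield s \<phi>) \<omega> us \<longlongrightarrow> L) (at 0 within S) = (comp_over_z s (Efield s \<Phi>) \<omega> us \<longlongrightarrow> L) (at 0 within S)"
    if "on_S3 \<omega>" for \<omega> us L S
    by (intro tendsto_cong_nonzero compE that)
  have limB: "(comp_over_z s (Bfield s \<phi>) \<omega> us \<longlongrightarrow> L) (at 0 within S) = (comp_over_z s (Efield s (dual \<Phi>)) \<omega> us \<longlongrightarrow> L) (at 0 within S)"
    if "on_S3 \<omega>" for \<omega> us L S
    by (intro tendsto_cong_nonzero compB that)
  \<comment> \<open>The rank is even, so the parity of the pullback is simply the parity of the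
    ambient components.\<close>
  have par: "((-1) ^ (2 * s) :: complex) = 1" by (simp add: power_mult)
  have S3: "on_S3 \<omega>" if "bdry_args s \<omega> us" for \<omega> us using that by (simp add: bdry_args_def)
  have limits: "\<forall>\<omega> us. bdry_args s \<omega> us \<longrightarrow>
       (\<exists>L. (comp_over_z s (Efield s \<phi>) \<omega> us \<longlongrightarrow> L) (at_right 0)) \<and>
       (\<exists>L. (comp_over_z s (Efield s \<phi>) \<omega> us \<longlongrightarrow> L) (at_left 0)) \<and>
       (\<exists>L. (comp_over_z s (Bfield s \<phi>) \<omega> us \<longlongrightarrow> L) (at_right 0)) \<and>
       (\<exists>L. (comp_over_z s (Bfield s \<phi>) \<omega> us \<longlongrightarrow> L) (at_left 0))"
  proof (intro allI impI conjI)
    fix \<omega> us assume "bdry_args s \<omega> us"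
    note \<omega> = S3[OF this]
    show "\<exists>L. (comp_over_z s (Efield s \<phi>) \<omega> us \<longlongrightarrow> L) (at_right 0)"
      unfolding limE[OF \<omega>] by (rule exI, rule E.comp_tendsto_right[OF \<omega>])
    show "\<exists>L. (comp_over_z s (Efield s \<phi>) \<omega> us \<longlongrightarrow> L) (at_left 0)"
      unfolding limE[OF \<omega>] by (rule exI, rule E.comp_tendsto_left[OF \<omega>])
    show "\<exists>L. (comp_over_z s (Bfield s \<phi>) \<omega> us \<longlongrightarrow> L) (at_right 0)"
      unfolding limB[OF \<omega>] by (rule exI, rule B.comp_tendsto_right[OF \<omega>])
    show "\<exists>L. (comp_over_z s (Bfield s \<phi>) \<omega> us \<longlongrightarrow> L) (at_left 0)"
      unfolding limB[OF \<omega>] by (rule exI, rule B.comp_tendsto_left[OF \<omega>])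
  qed
  have decomposition: "\<exists>\<phi>e \<phi>o. solution s \<phi>e \<and> solution s \<phi>o \<and> antip_even (2 * s) \<phi>e \<and> antip_odd (2 * s) \<phi>o \<and>
         (\<forall>x\<in>dS4. \<forall>\<mu>s\<in>lists_len (2 * s). \<phi> x \<mu>s = \<phi>e x \<mu>s + \<phi>o x \<mu>s)"
  proof (intro exI conjI)
    show "solution s (\<lambda>x ms. (1/2) * \<phi> x ms + (1/2) * \<phi> (- x) ms)"
      and "solution s (\<lambda>x ms. (1/2) * \<phi> x ms + (-1/2) * \<phi> (- x) ms)"
      by (rule solution_combination[OF assms])+
  qed (simp_all add: antip_even_def antip_odd_def par)
  have disjoint: "\<forall>\<psi>. solution s \<psi> \<and> antip_even (2 * s) \<psi> \<and> antip_odd (2 * s) \<psi> \<longrightarrow>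
         (\<forall>x\<in>dS4. \<forall>\<mu>s\<in>lists_len (2 * s). \<psi> x \<mu>s = 0)"
  proof (intro allI impI ballI)
    fix \<psi> x and \<mu>s :: "5 list"
    assume a: "solution s \<psi> \<and> antip_even (2 * s) \<psi> \<and> antip_odd (2 * s) \<psi>" "x \<in> dS4" "\<mu>s \<in> lists_len (2 * s)"
    have "\<psi> (- x) \<mu>s = (-1) ^ (2 * s) * \<psi> x \<mu>s" using a unfolding antip_even_def by blast
    moreover have "\<psi> (- x) \<mu>s = - ((-1) ^ (2 * s) * \<psi> x \<mu>s)" using a unfolding antip_odd_def by blast
    ultimately have "(-1) ^ (2 * s) * \<psi> x \<mu>s = - ((-1) ^ (2 * s) * \<psi> x \<mu>s)" by (rule trans[OF sym])
    then have "\<psi> x \<mu>s = - \<psi> x \<mu>s" unfolding par mult_1_left .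
    moreover have "z = 0" if "z = - z" for z :: complex using that by (simp add: complex_eq_iff)
    ultimately show "\<psi> x \<mu>s = 0" by blast
  qed
  have evenE: "antip_even (2 * s) \<phi> \<longrightarrow>
         (\<forall>\<omega> us. bdry_args s \<omega> us \<longrightarrow> bdryE_plus s \<phi> \<omega> us = 0 \<and> bdryE_minus s \<phi> \<omega> us = 0)"
  proof (intro impI allI)
    fix \<omega> us assume ev: "antip_even (2 * s) \<phi>" and b: "bdry_args s \<omega> us"
    have "\<Phi> (- x) ms = \<Phi> x ms" if x: "x \<in> dS4" and ms: "length ms = 2 * s" for x ms
      unfolding ext[OF x ms] ext[OF dS4_uminus[OF x] ms]
      using ev[unfolded antip_even_def par mult_1_left] x ms unfolding lists_len_def by blast
    note E.limits_zero_of_even[OF this S3[OF b], of us, folded limE[OF S3[OF b]]]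
    from tendsto_Lim[OF trivial_limit_at_right_real this(1)] tendsto_Lim[OF trivial_limit_at_left_real this(2)]
    show "bdryE_plus s \<phi> \<omega> us = 0 \<and> bdryE_minus s \<phi> \<omega> us = 0"
      by (simp add: bdryE_plus_def bdryE_minus_def)
  qed
  have oddB: "antip_odd (2 * s) \<phi> \<longrightarrow>
         (\<forall>\<omega> us. bdry_args s \<omega> us \<longrightarrow> bdryB_plus s \<phi> \<omega> us = 0 \<and> bdryB_minus s \<phi> \<omega> us = 0)"
  proof (intro impI allI)
    fix \<omega> us assume od: "antip_odd (2 * s) \<phi>" and b: "bdry_args s \<omega> us"
    have "\<Phi> (- x) ms = - \<Phi> x ms" if x: "x \<in> dS4" and ms: "length ms = 2 * s" for x ms
      unfolding ext[OF x ms] ext[OF dS4_uminus[OF x] ms]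
      by (rule od[unfolded antip_odd_def par mult_1_left lists_len_def, rule_format, OF x]) (simp add: ms)
    note odd = this
    \<comment> \<open>The purely electric case is the purely magnetic one for the dual, whose parity
      is opposite.\<close>
    have "dual \<Phi> (- x) ms = dual \<Phi> x ms" if "x \<in> dS4" "length ms = 2 * s" for x ms
      by (rule dual_even_of_odd[OF odd that])
    note B.limits_zero_of_even[OF this S3[OF b], of us, folded limB[OF S3[OF b]]]
    from tendsto_Lim[OF trivial_limit_at_right_real this(1)] tendsto_Lim[OF trivial_limit_at_left_real this(2)]
    show "bdryB_plus s \<phi> \<omega> us = 0 \<and> bdryB_minus s \<phi> \<omega> us = 0"
      by (simp add: bdryB_plus_def bdryB_minus_def)
  qed
  have conv_even: "(\<forall>\<omega> us. bdry_args s \<omega> us \<longrightarrow> bdryE_minus s \<phi> \<omega> us = 0) \<longrightarrow> antip_even (2 * s) \<phi>"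
  proof
    assume z: "\<forall>\<omega> us. bdry_args s \<omega> us \<longrightarrow> bdryE_minus s \<phi> \<omega> us = 0"
    have lim: "(comp_over_z s (Efield s \<Phi>) w us \<longlongrightarrow> 0) (at_left 0)"
      if w: "on_S3 w" and us: "length us = s" "\<forall>u\<in>set us. tangent_S3 w u" for w us
    proof -
      \<comment> \<open>The sign factor in the definition of the boundary data on past infinity is
        invertible and drops out.\<close>
      have "Lim (at_left 0) (comp_over_z s (Efield s \<phi>) w us) = 0"
        using z w us by (simp add: bdry_args_def bdryE_minus_def)
      from tendsto_zero_of_Lim_zero[OF E.comp_tendsto_left[OF w, of us, folded limE[OF w]] this]
      show ?thesis unfolding limE[OF w] .
    qed
    show "antip_even (2 * s) \<phi>"
      unfolding antip_even_def par mult_1_left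
    proof (intro ballI)
      fix x and ms :: "5 list" assume x: "x \<in> dS4" and "ms \<in> lists_len (2 * s)"
      then have ms: "length ms = 2 * s" by (simp add: lists_len_def)
      show "\<phi> (- x) ms = \<phi> x ms"
        using E.even_of_limits_zero[OF lim x ms] unfolding ext[OF x ms] ext[OF dS4_uminus[OF x] ms] .
    qed
  qed
  have conv_odd: "(\<forall>\<omega> us. bdry_args s \<omega> us \<longrightarrow> bdryB_minus s \<phi> \<omega> us = 0) \<longrightarrow> antip_odd (2 * s) \<phi>"
  proof
    assume z: "\<forall>\<omega> us. bdry_args s \<omega> us \<longrightarrow> bdryB_minus s \<phi> \<omega> us = 0"
    have lim: "(comp_over_z s (Efield s (dual \<Phi>)) w us \<longlongrightarrow> 0) (at_left 0)"
      if w: "on_S3 w" and us: "length us = s" "\<forall>u\<in>set us. tangent_S3 w u" for w us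
    proof -
      have "Lim (at_left 0) (comp_over_z s (Bfield s \<phi>) w us) = 0"
        using z w us by (simp add: bdry_args_def bdryB_minus_def)
      from tendsto_zero_of_Lim_zero[OF B.comp_tendsto_left[OF w, of us, folded limB[OF w]] this]
      show ?thesis unfolding limB[OF w] .
    qed
    show "antip_odd (2 * s) \<phi>"
      unfolding antip_odd_def par mult_1_left
    proof (intro ballI)
      fix x and ms :: "5 list" assume x: "x \<in> dS4" and "ms \<in> lists_len (2 * s)"
      then have ms: "length ms = 2 * s" by (simp add: lists_len_def)
      show "\<phi> (- x) ms = - \<phi> x ms"
        using odd_of_dual_even[OF B.even_of_limits_zero[OF lim] x ms] unfolding ext[OF x ms] ext[OF dS4_uminus[OF x] ms] .
    qed
  qed
  show ?thesis by (intro conjI limits decomposition disjoint evenE oddB conv_even conv_odd)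
qed

end
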